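(* Let $n,m\ge 1$, $\alpha\in(0,1)$, $\rho>0$, $\lambda>0$, $a\in\mathbb{R}^n$, $b\in\mathbb{R}^m$, and let $A_I, A_I^\ast, B_I, B_I^\ast$ be the interval matrix sets and $K_1(\cdot),K_2(\cdot)$ the set-valued mappings described in the context (assumption (A1)). Suppose that: (A2) $1-\rho\,\overline{a}_{ii}\ge h_{ii}$ for $i=1,\dots,n$; (A3) $1-\lambda\,\overline{b}_{jj}\ge l_{jj}$ for $j=1,\dots,m$; (A4) there exist constants $\mu_i>0$ $(i=1,\dots,n)$ and $\tau_j>0$ $(j=1,\dots,m)$ such that, for $i=1,\dots,n$, $$0<1-\rho\,\underline{a}_{ii}-h_{ii}+|h_{ii}|+\sum_{j=1,\,j\ne i}^n\frac{\mu_j}{\mu_i}\left(\widetilde a_{ji}+|h_{ji}|\right)+\sum_{j=1}^m\frac{\tau_j}{\mu_i}\lambda\,\widetilde{b^\ast}_{ji}<1,$$ and, for $j=1,\dots,m$, $$0<1-\lambda\,\underline{b}_{jj}-l_{jj}+|l_{jj}|+\sum_{i=1,\,i\ne j}^m\frac{\tau_i}{\tau_j}\left(\widetilde b_{ij}+|l_{ij}|\right)+\sum_{i=1}^n\frac{\mu_i}{\tau_j}\rho\,\widetilde{a^\ast}_{ij}<1,$$ where $$\widetilde a_{ji}=\max\{|\rho\underline a_{ji}+h_{ji}|,|\rho\overline a_{ji}+h_{ji}|\},\qquad \widetilde{a^\ast}_{ij}=\max\{|\underline{a^\ast}_{ij}|,|\overline{a^\ast}_{ij}|\},$$ $$\widetilde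 b_{ij}=\max\{|\lambda\underline b_{ij}+l_{ij}|,|\lambda\overline b_{ij}+l_{ij}|\},\qquad \widetilde{b^\ast}_{ji}=\max\{|\underline{b^\ast}_{ji}|,|\overline{b^\ast}_{ji}|\}.$$ Then for each $A\in A_I$, $A^\ast\in A_I^\ast$, $B\in B_I$ and $B^\ast\in B_I^\ast$, the system $${}_0^CD_t^\alpha x(t)=P_{K_1(x(t))}[x(t)-\rho(Ax(t)+A^\ast y(t))-\rho a]-x(t),\quad t\ge0,\quad x(0)=x_0,$$ $${}_0^CD_t^\alpha y(t)=P_{K_2(y(t))}[y(t)-\lambda(By(t)+B^\ast x(t))-\lambda b]-y(t),\quad t\ge0,\quad y(0)=y_0,$$ is globally Mittag-Leffler stable.
   Context: Interval matrices. Real matrices $\underline A\le\overline A$ ($n\times n$), $\underline{A^\ast}\le\overline{A^\ast}$ ($n\times m$), $\underline B\le\overline B$ ($m\times m$), $\underline{B^\ast}\le\overline{B^\ast}$ ($m\times n$) are given, inequalities being entrywise, with entries denoted $\underline a_{ij},\overline a_{ij}$, $\underline{a^\ast}_{ij},\overline{a^\ast}_{ij}$, $\underline b_{ij},\overline b_{ij}$, $\underline{b^\ast}_{ij},\overline{b^\ast}_{ij}$. Put $A_I=\{A\in\mathbb{R}^{n\times n}:\underline A\le A\le\overline A\}$, $A_I^\ast=\{A^\ast\in\mathbb{R}^{n\times m}:\underline{A^\ast}\le A^\ast\le\overline{A^\ast}\}$, $B_I=\{B\in\mathbb{R}^{m\times m}:\underline B\le B\le\overline B\}$, $B_I^\ast=\{B^\ast\in\mathbb{R}^{m\times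 n}:\underline{B^\ast}\le B^\ast\le\overline{B^\ast}\}$. (The star in $A^\ast,B^\ast$ is only part of the name, not an adjoint.) Assumption (A1) on the constraint sets. Real constants $h_{ij}$ ($1\le i,j\le n$), $l_{ji}$ ($1\le i,j\le m$), $c_{1,i}\le c_{2,i}$ ($1\le i\le n$), $d_{1,j}\le d_{2,j}$ ($1\le j\le m$) are given, and for $x\in\mathbb{R}^n$, $y\in\mathbb{R}^m$, $$K_1(x)=u^1(x)+K_1,\quad K_2(y)=u^2(y)+K_2,\quad u^1_i(x)=\sum_{j=1}^n h_{ij}x_j,\quad u^2_j(y)=\sum_{i=1}^m l_{ji}y_i,$$ $$K_1=\{x\in\mathbb{R}^n: c_{1,i}\le x_i\le c_{2,i},\ i=1,\dots,n\},\quad K_2=\{y\in\mathbb{R}^m: d_{1,j}\le y_j\le d_{2,j},\ j=1,\dots,m\},$$ where $v+K=\{v+w:w\in K\}$. Projection. For a nonempty closed convex set $K\subset\mathbb{R}^d$, $P_K[y]=\arg\min_{z\in K}\|y-z\|$ is the Euclidean metric projection; $P_{K(x)}$ is the projection onto $K(x)$. Caputo derivative, $\alpha\in(0,1)$: ${}_0^CD_t^\alpha x(t)=\frac{1}{\Gamma(1-\alpha)}\int_0^t(t-\tau)^{-\alpha}x'(\tau)\,d\tau$ for $t>0$ (componentwise for vector functions). Solutions are functions on $[0,\infty)$, absolutely continuous on compact intervals, satisfying the equations for $t>0$ and the initial conditions. Mittag-Leffler function: $E_\alpha(z)=\sum_{k=0}^\infty \frac{z^k}{\Gamma(\alpha k+1)}$.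 Equilibrium and stability. For fixed matrices, an equilibrium point is $(x^\ast,y^\ast)\in\mathbb{R}^n\times\mathbb{R}^m$ at which both right-hand sides of the system vanish. The system is globally Mittag-Leffler stable if it has an equilibrium point $(x^\ast,y^\ast)$ for which there exist constants $\gamma>0$, $\sigma>0$ and a locally Lipschitz function $M:\mathbb{R}^n\times\mathbb{R}^m\to[0,\infty)$ with $M(0)=0$ such that, for every initial value $(x_0,y_0)\in\mathbb{R}^n\times\mathbb{R}^m$, the solution satisfies $$\|(x(t),y(t))-(x^\ast,y^\ast)\|\le\left[M\left((x_0,y_0)-(x^\ast,y^\ast)\right)E_\alpha(-\gamma t^\alpha)\right]^\sigma\quad\text{for all }t\ge0 .$$ The choice of norm on $\mathbb{R}^n\times\mathbb{R}^m$ is immaterial. *)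

theory Defs
  imports "HOL-Analysis.Analysis"
begin

definition mittag_leffler :: "real \<Rightarrow> real \<Rightarrow> real" where
  "mittag_leffler \<alpha> z = (\<Sum>k. z ^ k / Gamma (\<alpha> * real k + 1))"

text \<open>Absolute continuity of a function on \<open>[a, b]\<close>. (The library's
  \<open>absolutely_continuous\<close> is the unrelated notion for measures.)\<close>

definition abs_continuous_on_interval ::
    "real \<Rightarrow> real \<Rightarrow> (real \<Rightarrow> 'a::real_normed_vector) \<Rightarrow> bool" where
  "abs_continuous_on_interval a b x \<longleftrightarrow>
     (\<forall>\<epsilon>>0. \<exists>\<delta>>0. \<forall>(N::nat) (u::nat \<Rightarrow> real) (v::nat \<Rightarrow> real).
        (\<forall>k<N. a \<le> u k \<and> u k \<le> v k \<and> v k \<le> b) \<and>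
        disjoint_family_on (\<lambda>k. {u k<..<v k}) {..<N} \<and>
        (\<Sum>k<N. v k - u k) < \<delta> \<longrightarrow>
        (\<Sum>k<N. norm (x (v k) - x (u k))) < \<epsilon>)"

text \<open>\<open>has_caputo_derivative \<alpha> x D t\<close>: the Caputo derivative of order \<open>\<alpha>\<close> with base
  point 0 exists at \<open>t\<close> and equals \<open>D\<close>. Integrability is required explicitly because the
  library integral of a non-integrable function is 0. For an absolutely continuous \<open>x\<close> the
  derivative \<open>x'\<close> exists almost everywhere, so the unspecified values of
  \<open>vector_derivative\<close> elsewhere do not affect the integral; it is taken over the completed
  Lebesgue measure so that they do not affect measurability either. The integral of a
  vector-valued function is componentwise.\<close>

definition has_caputo_derivative ::
    "real \<Rightarrow> (real \<Rightarrow> 'a::euclidean_space) \<Rightarrow> 'a \<Rightarrow> real \<Rightarrow> bool" where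
  "has_caputo_derivative \<alpha> x D t \<longleftrightarrow>
     set_integrable lebesgue {0..t}
       (\<lambda>\<tau>. ((t - \<tau>) powr (- \<alpha>)) *\<^sub>R vector_derivative x (at \<tau>)) \<and>
     D = (1 / Gamma (1 - \<alpha>)) *\<^sub>R
         set_lebesgue_integral lebesgue {0..t}
           (\<lambda>\<tau>. ((t - \<tau>) powr (- \<alpha>)) *\<^sub>R vector_derivative x (at \<tau>))"

text \<open>Solutions of the coupled system with right-hand sides \<open>f\<close> and \<open>g\<close>. Only the values on
  \<open>[0, \<infinity>)\<close> matter; the equations are imposed for \<open>t > 0\<close>.\<close>

definition caputo_solution ::
    "real \<Rightarrow> ('a \<Rightarrow> 'b \<Rightarrow> 'a) \<Rightarrow> ('a \<Rightarrow> 'b \<Rightarrow> 'b) \<Rightarrow> 'a \<Rightarrow> 'b \<Rightarrow>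
     (real \<Rightarrow> 'a::euclidean_space) \<Rightarrow> (real \<Rightarrow> 'b::euclidean_space) \<Rightarrow> bool" where
  "caputo_solution \<alpha> f g x0 y0 x y \<longleftrightarrow>
     (\<forall>a b. 0 \<le> a \<and> a \<le> b \<longrightarrow>
        abs_continuous_on_interval a b x \<and> abs_continuous_on_interval a b y) \<and>
     (\<forall>t>0. has_caputo_derivative \<alpha> x (f (x t) (y t)) t \<and>
            has_caputo_derivative \<alpha> y (g (x t) (y t)) t) \<and>
     x 0 = x0 \<and> y 0 = y0"

definition equilibrium_point ::
    "('a \<Rightarrow> 'b \<Rightarrow> 'a::euclidean_space) \<Rightarrow> ('a \<Rightarrow> 'b \<Rightarrow> 'b::euclidean_space) \<Rightarrow> 'a \<times> 'b \<Rightarrow> bool" where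
  "equilibrium_point f g z \<longleftrightarrow> f (fst z) (snd z) = 0 \<and> g (fst z) (snd z) = 0"

text \<open>``The solution satisfies the estimate'' is rendered as: a solution exists, it is unique
  on \<open>[0, \<infinity>)\<close>, and it satisfies the estimate. Without the existence clause the property could
  hold vacuously.\<close>

definition globally_mittag_leffler_stable ::
    "real \<Rightarrow> ('a::euclidean_space \<Rightarrow> 'b::euclidean_space \<Rightarrow> 'a) \<Rightarrow> ('a \<Rightarrow> 'b \<Rightarrow> 'b) \<Rightarrow> bool" where
  "globally_mittag_leffler_stable \<alpha> f g \<longleftrightarrow>
     (\<exists>xe ye. equilibrium_point f g (xe, ye) \<and>
       (\<exists>\<gamma>>0. \<exists>\<sigma>>0. \<exists>M :: 'a \<times> 'b \<Rightarrow> real.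
          (\<forall>z. 0 \<le> M z) \<and> M 0 = 0 \<and>
          (\<forall>z. \<exists>r>0. \<exists>L. L-lipschitz_on (cball z r) M) \<and>
          (\<forall>x0 y0.
             (\<exists>x y. caputo_solution \<alpha> f g x0 y0 x y) \<and>
             (\<forall>x y x' y'. caputo_solution \<alpha> f g x0 y0 x y \<and> caputo_solution \<alpha> f g x0 y0 x' y' \<longrightarrow>
                (\<forall>t\<ge>0. x t = x' t \<and> y t = y' t)) \<and>
             (\<forall>x y. caputo_solution \<alpha> f g x0 y0 x y \<longrightarrow>
                (\<forall>t\<ge>0. norm ((x t, y t) - (xe, ye)) \<le>
                   (M ((x0, y0) - (xe, ye)) * mittag_leffler \<alpha> (- \<gamma> * t powr \<alpha>)) powr \<sigma>)))))"

text \<open>The set \<open>K(x) = u(x) + K\<close> with \<open>u(x) = H x\<close> and \<open>K\<close> the box with corners \<open>c1\<close>, \<open>c2\<close>.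
  The library order on vectors, and hence on matrices, is entrywise.\<close>

definition moving_box ::
    "real^'n^'n \<Rightarrow> real^'n \<Rightarrow> real^'n \<Rightarrow> real^'n \<Rightarrow> (real^'n::finite) set" where
  "moving_box H c1 c2 x = (\<lambda>w. H *v x + w) ` {c1..c2}"

text \<open>The right-hand side \<open>P\<^bsub>K(x)\<^esub>[x - r (A x + A\<^sup>* y) - r a] - x\<close>; the second equation of the
  system has the same form with the roles of \<open>x\<close> and \<open>y\<close> exchanged.\<close>

definition projection_rhs ::
    "real \<Rightarrow> real^'n^'n \<Rightarrow> real^'m^'n \<Rightarrow> real^'n \<Rightarrow> (real^'n \<Rightarrow> (real^'n) set) \<Rightarrow>
     real^'n \<Rightarrow> real^'m \<Rightarrow> (real^'n::finite)" where
  "projection_rhs r A As a K x y =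
     closest_point (K x) (x - r *\<^sub>R (A *v x + As *v y) - r *\<^sub>R a) - x"

end

theory Submission
  imports Defs
begin

text \<open>
  Componentwise, the projection onto the moving box is a translated clamp, and clamps are
  1-Lipschitz; with (A2), (A3) this makes the column-sum condition (A4) say exactly that the map
  \<open>\<Phi>\<close> with right-hand side \<open>\<Phi> z - z\<close> is a contraction, with some factor \<open>\<theta> < 1\<close>, in the weighted
  norm \<open>\<Sum>\<^sub>i \<mu>\<^sub>i |x\<^sub>i| + \<Sum>\<^sub>j \<tau>\<^sub>j |y\<^sub>j|\<close>. Its fixed point is the equilibrium. The difference \<open>e\<close> of two
  solutions satisfies \<open>\<parallel>e(t)\<parallel> \<le> \<parallel>e(0)\<parallel> E\<^sub>\<alpha>(-(1-\<theta>) t\<^sup>\<alpha>)\<close> by a first-touching-time argument, since a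
  function has positive Caputo derivative at a point where it attains its maximum over the past
  and exceeds its initial value. This yields uniqueness and, applied to the constant solution,
  stability with \<open>\<gamma> = 1 - \<theta>\<close> and \<open>\<sigma> = 1\<close>.

  Existence comes from the equivalent Volterra equation \<open>z = z\<^sub>0 + I\<^sup>\<alpha> F(z)\<close>, solved by Banach's
  fixed point theorem in an exponentially weighted supremum norm. Its solution satisfies
  \<open>\<parallel>z(v) - z(u)\<parallel> \<le> C (v\<^sup>\<alpha> - u\<^sup>\<alpha>)\<close>, which gives absolute continuity and enough control of \<open>z'\<close> to
  recover the Caputo equation at every \<open>t > 0\<close> rather than almost everywhere. Throughout, one needs
  that absolutely continuous functions are differentiable almost everywhere and are the integrals
  of their derivatives.
\<close>

section \<open>Absolutely continuous functions\<close>

text \<open>The sums in (A4) run down the columns of the coefficient matrix, and weighted column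
  sums control a weighted l1 norm; this dictates the norm. Under (A2) the number 1 - \<rho> a_ii -
  h_ii is nonnegative for every admissible matrix, so it equals its absolute value and is largest at
  the lower end of the interval: hence (A4) contains that end without a modulus. There are finitely
  many columns, so sums below 1 stay below a common \<theta> < 1. The main obstacle is the notion of
  solution. The derivative exists only almost everywhere, while the equation is required at every t
  > 0, and Hoelder continuity of order \<alpha> alone does not imply absolute continuity. Increments
  bounded by those of t^\<alpha> inherit the absolute continuity of t^\<alpha>. The same bound,
  inserted into the Caputo integral after integration by parts, makes that integral continuous on t
  > 0, where an identity between integrals may be differentiated.\<close>

lemma abs_continuous_division:
  fixes f :: "real \<Rightarrow> 'a::real_normed_vector"
  assumes "abs_continuous_on_interval a b f" "\<epsilon> > 0"
  obtains \<delta> where "\<delta> > 0"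
    "\<And>D. D division_of \<Union>D \<Longrightarrow> \<Union>D \<subseteq> {a..b} \<Longrightarrow> (\<Sum>K\<in>D. Sup K - Inf K) < \<delta> \<Longrightarrow>
       (\<Sum>K\<in>D. norm (f (Sup K) - f (Inf K))) < \<epsilon>"
proof -
  obtain \<delta> where \<delta>: "\<delta> > 0" and
    ac: "\<And>(N::nat) u v. \<forall>k<N. a \<le> u k \<and> u k \<le> v k \<and> v k \<le> b \<Longrightarrow>
        disjoint_family_on (\<lambda>k. {u k<..<v k}) {..<N} \<Longrightarrow>
        (\<Sum>k<N. v k - u k) < \<delta> \<Longrightarrow>
        (\<Sum>k<N. norm (f (v k) - f (u k))) < \<epsilon>"
    using assms(1)[unfolded abs_continuous_on_interval_def, THEN spec, THEN mp, OF assms(2)] by auto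
  show thesis
  proof (rule that[OF \<delta>])
    fix D assume D: "D division_of \<Union>D" "\<Union>D \<subseteq> {a..b}" "(\<Sum>K\<in>D. Sup K - Inf K) < \<delta>"
    have fin: "finite D" using D(1) by blast
    obtain h where h: "bij_betw h {0..<card D} D"
      using ex_bij_betw_nat_finite[OF fin] by blast
    then have h': "bij_betw h {..<card D} D" by (simp add: atLeast0LessThan)
    have int: "\<exists>c d. K = {c..d} \<and> c \<le> d" if "K \<in> D" for K
      using division_ofD(3,4)[OF D(1) that] by (metis atLeastatMost_empty_iff box_real(2) not_le)
    have 1: "(\<Sum>k<card D. norm (f (Sup (h k)) - f (Inf (h k)))) < \<epsilon>"
    proof (rule ac)
      show "\<forall>k<card D. a \<le> Inf (h k) \<and> Inf (h k) \<le> Sup (h k) \<and> Sup (h k) \<le> b"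
      proof (intro allI impI)
        fix k assume "k < card D"
        then have "h k \<in> D" using h' by (auto simp: bij_betw_def)
        then obtain c d where "h k = {c..d}" "c \<le> d" "{c..d} \<subseteq> {a..b}"
          using int D(2) by (metis Union_upper subset_trans)
        then show "a \<le> Inf (h k) \<and> Inf (h k) \<le> Sup (h k) \<and> Sup (h k) \<le> b" by auto
      qed
      show "disjoint_family_on (\<lambda>k. {Inf (h k)<..<Sup (h k)}) {..<card D}"
        unfolding disjoint_family_on_def
      proof (intro ballI impI)
        fix i j assume ij: "i \<in> {..<card D}" "j \<in> {..<card D}" "i \<noteq> j"
        then have hij: "h i \<in> D" "h j \<in> D" "h i \<noteq> h j"
          using h' by (auto simp: bij_betw_def inj_on_def)
        obtain c d c' d' where "h i = {c..d}" "c \<le> d" "h j = {c'..d'}" "c' \<le> d'"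
          using int hij by metis
        then show "{Inf (h i)<..<Sup (h i)} \<inter> {Inf (h j)<..<Sup (h j)} = {}"
          using division_ofD(5)[OF D(1) hij] by (simp add: interior_cbox)
      qed
      show "(\<Sum>k<card D. Sup (h k) - Inf (h k)) < \<delta>"
        using D(3) sum.reindex_bij_betw[OF h', of "\<lambda>K. Sup K - Inf K"] by simp
    qed
    then show "(\<Sum>K\<in>D. norm (f (Sup K) - f (Inf K))) < \<epsilon>"
      using sum.reindex_bij_betw[OF h', of "\<lambda>K. norm (f (Sup K) - f (Inf K))"] by simp
  qed
qed

lemma sum_division_increment:
  fixes g :: "real \<Rightarrow> real"
  assumes "D division_of {a..b}" "a \<le> b"
  shows "(\<Sum>K\<in>D. g (Sup K) - g (Inf K)) = g b - g a"
proof -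
  have fin: "finite D" using assms(1) by blast
  \<comment> \<open>The tags carry no information; left ends are a convenient choice that makes the
    telescoping sum for tagged divisions available.\<close>
  have "(\<lambda>K. (Inf K, K)) ` D tagged_division_of {a..b}"
  proof (rule tagged_division_ofI)
    show "finite ((\<lambda>K. (Inf K, K)) ` D)" using fin by simp
    show "\<Union>{K. \<exists>x. (x, K) \<in> (\<lambda>K. (Inf K, K)) ` D} = {a..b}"
      using division_ofD(6)[OF assms(1)] by (auto simp: image_iff)
    fix x K assume "(x, K) \<in> (\<lambda>K. (Inf K, K)) ` D"
    then have K: "K \<in> D" "x = Inf K" by auto
    then obtain c d where cd: "K = {c..d}" "c \<le> d"
      using division_ofD(3,4)[OF assms(1)] by (metis atLeastatMost_empty_iff box_real(2) not_le)
    then show "x \<in> K" "\<exists>a b. K = cbox a b" using K by auto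
    show "K \<subseteq> {a..b}" using K division_ofD(2)[OF assms(1)] by blast
    fix x' K' assume "(x', K') \<in> (\<lambda>K. (Inf K, K)) ` D" "(x, K) \<noteq> (x', K')"
    then show "interior K \<inter> interior K' = {}" using K division_ofD(5)[OF assms(1)] by auto
  qed
  from additive_tagged_division_1[OF assms(2) this, of g]
  show ?thesis by (subst (asm) sum.reindex) (auto simp: inj_on_def)
qed

text \<open>Extending the part of \<open>I\<close> inside each member of \<open>J\<close> to a
  division of that member produces the gaps. The identity is claimed for every \<open>g\<close> at
  once because it is applied both to the function under study and to the identity, which measures
  length.\<close>

lemma nested_division_gaps:
  assumes J: "J division_of S" and I: "I division_of \<Union>I"
    and sub: "\<And>K. K \<in> I \<Longrightarrow> \<exists>L\<in>J. K \<subseteq> L \<and> interior K \<noteq> {}"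
  obtains G where "G division_of \<Union>G" "\<Union>G \<subseteq> S"
    "\<And>g :: real \<Rightarrow> real. (\<Sum>K\<in>J. g (Sup K) - g (Inf K)) =
       (\<Sum>K\<in>I. g (Sup K) - g (Inf K)) + (\<Sum>K\<in>G. g (Sup K) - g (Inf K))"
proof -
  define P where "P L = {K \<in> I. K \<subseteq> L}" for L
  have "\<exists>q. P L \<subseteq> q \<and> q division_of L" if L: "L \<in> J" for L
  proof -
    obtain c d where "L = cbox c d" using division_ofD(4)[OF J L] by blast
    moreover have "P L division_of \<Union>(P L)"
      using division_of_subset[OF I, of "P L"] by (auto simp: P_def)
    moreover have "\<Union>(P L) \<subseteq> L" by (auto simp: P_def)
    ultimately show ?thesis using partial_division_extend_interval by metis
  qed
  then obtain q where q: "\<And>L. L \<in> J \<Longrightarrow> P L \<subseteq> q L" "\<And>L. L \<in> J \<Longrightarrow> q L division_of L"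
    by metis
  have finJ: "finite J" and finI: "finite I" using J I by blast+
  have finq: "finite (q L)" if "L \<in> J" for L using q(2)[OF that] by blast
  \<comment> \<open>One-point intervals have increment 0, but one of them may occur in the divisions
    of two adjacent members of \<open>J\<close>; discarding them makes the sets \<open>R L\<close>
    disjoint.\<close>
  define R where "R L = {K \<in> q L - P L. interior K \<noteq> {}}" for L
  define G where "G = (\<Union>L\<in>J. R L)"
  have inL: "K \<subseteq> L" if "K \<in> q L" "L \<in> J" for K L using division_ofD(2)[OF q(2)[OF that(2)] that(1)] .
  have disjL: "interior K \<inter> interior K' = {}" if "L \<in> J" "L' \<in> J" "L \<noteq> L'" "K \<subseteq> L" "K' \<subseteq> L'" for K K' L L'
    using division_ofD(5)[OF J that(1-3)] interior_mono[OF that(4)] interior_mono[OF that(5)] by blast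
  show thesis
  proof
    show "G division_of \<Union>G"
    proof (rule division_ofI)
      show "finite G" unfolding G_def R_def using finJ finq by auto
      fix K assume "K \<in> G"
      then obtain L where L: "L \<in> J" "K \<in> R L" by (auto simp: G_def)
      show "K \<subseteq> \<Union>G" using \<open>K \<in> G\<close> by auto
      show "K \<noteq> {}" "\<exists>a b. K = cbox a b" using division_ofD(3,4)[OF q(2)[OF L(1)]] L(2) by (auto simp: R_def)
      fix K' assume K': "K' \<in> G" "K \<noteq> K'"
      then obtain L' where L': "L' \<in> J" "K' \<in> R L'" by (auto simp: G_def)
      show "interior K \<inter> interior K' = {}"
      proof (cases "L = L'")
        case True
        then show ?thesis using division_ofD(5)[OF q(2)[OF L(1)]] L(2) L'(2) K'(2) by (auto simp: R_def)
      next
        case False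
        then show ?thesis using disjL[OF L(1) L'(1)] inL L L' by (auto simp: R_def)
      qed
    qed simp
    show "\<Union>G \<subseteq> S" using inL division_ofD(2)[OF J] unfolding G_def R_def by blast
    fix g :: "real \<Rightarrow> real"
    let ?g = "\<lambda>K. g (Sup K) - g (Inf K)"
    have *: "?g L = (\<Sum>K\<in>P L. ?g K) + (\<Sum>K\<in>R L. ?g K)" if L: "L \<in> J" for L
    proof -
      obtain c d where cd: "L = {c..d}" "c \<le> d"
        using division_ofD(3,4)[OF J L] by (metis atLeastatMost_empty_iff box_real(2) not_le)
      have "?g L = (\<Sum>K\<in>q L. ?g K)"
        using sum_division_increment[of "q L" c d g] q(2)[OF L] cd by simp
      also have "\<dots> = (\<Sum>K\<in>P L. ?g K) + (\<Sum>K\<in>q L - P L. ?g K)"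
        using sum.subset_diff[OF q(1)[OF L] finq[OF L], of ?g] by (simp add: add.commute)
      also have "(\<Sum>K\<in>q L - P L. ?g K) = (\<Sum>K\<in>R L. ?g K)"
      proof (rule sum.mono_neutral_right)
        show "\<forall>K\<in>q L - P L - R L. ?g K = 0"
        proof
          fix K assume K: "K \<in> q L - P L - R L"
          then obtain c d where cd: "K = {c..d}" "c \<le> d"
            using division_ofD(3,4)[OF q(2)[OF L]]
            by (metis DiffD1 atLeastatMost_empty_iff box_real(2) not_le)
          moreover have "interior K = {}" using K by (auto simp: R_def)
          ultimately show "?g K = 0" by auto
        qed
      qed (use finq[OF L] in \<open>auto simp: R_def\<close>)
      finally show ?thesis .
    qed
    have "(\<Sum>L\<in>J. ?g L) = (\<Sum>L\<in>J. \<Sum>K\<in>P L. ?g K) + (\<Sum>L\<in>J. \<Sum>K\<in>R L. ?g K)"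
      by (simp only: sum.distrib[symmetric]) (rule sum.cong[OF refl *])
    also have "(\<Sum>L\<in>J. \<Sum>K\<in>P L. ?g K) = (\<Sum>K\<in>\<Union>(P ` J). ?g K)"
    proof (rule sum.UNION_disjoint[symmetric, OF finJ])
      show "\<forall>L\<in>J. finite (P L)" using finI by (auto simp: P_def)
      show "\<forall>i\<in>J. \<forall>j\<in>J. i \<noteq> j \<longrightarrow> P i \<inter> P j = {}"
      proof (intro ballI impI equals0I)
        fix i j K assume ij: "i \<in> J" "j \<in> J" "i \<noteq> j" and K: "K \<in> P i \<inter> P j"
        have "interior K \<inter> interior K = {}" using disjL[OF ij] K by (auto simp: P_def)
        moreover have "interior K \<noteq> {}" using sub[of K] K by (auto simp: P_def)
        ultimately show False by auto
      qed
    qed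
    also have "\<Union>(P ` J) = I" using sub by (auto simp: P_def)
    also have "(\<Sum>L\<in>J. \<Sum>K\<in>R L. ?g K) = (\<Sum>K\<in>G. ?g K)"
      unfolding G_def
    proof (rule sum.UNION_disjoint[symmetric, OF finJ])
      show "\<forall>L\<in>J. finite (R L)" using finq by (auto simp: R_def)
      show "\<forall>i\<in>J. \<forall>j\<in>J. i \<noteq> j \<longrightarrow> R i \<inter> R j = {}"
      proof (intro ballI impI equals0I)
        fix i j K assume ij: "i \<in> J" "j \<in> J" "i \<noteq> j" and K: "K \<in> R i \<inter> R j"
        have "K \<subseteq> i" "K \<subseteq> j" using inL ij K by (auto simp: R_def)
        then have "interior K \<inter> interior K = {}" using disjL[OF ij] by blast
        then show False using K by (auto simp: R_def)
      qed
    qed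
    finally show "(\<Sum>K\<in>J. ?g K) = (\<Sum>K\<in>I. ?g K) + (\<Sum>K\<in>G. ?g K)" .
  qed
qed

text \<open>Intervals are balls around their midpoints, so the Vitali covering theorem for balls
  applies, and continuity of the measure cuts the countable family down to a finite one at the price
  of \<epsilon>. Confinement to \<open>U\<close> bounds the total length from above. The measure of
  \<open>E\<close> inside the interiors is recorded because a second covering will be made inside
  the first.\<close>

lemma Vitali_finite_intervals:
  fixes P :: "real \<Rightarrow> real \<Rightarrow> bool"
  assumes E: "E \<in> lmeasurable" and U: "open U" "E \<subseteq> U" "U \<in> lmeasurable" and "\<epsilon> > 0"
    and P: "\<And>t d. t \<in> E \<Longrightarrow> 0 < d \<Longrightarrow> \<exists>u v. u < t \<and> t < v \<and> v - u < d \<and> P u v"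
  obtains D where "D division_of \<Union>D" "\<Union>D \<subseteq> U"
    "\<And>K. K \<in> D \<Longrightarrow> \<exists>u v. u < v \<and> K = {u..v} \<and> P u v"
    "measure lebesgue E - \<epsilon> < measure lebesgue (E \<inter> (\<Union>K\<in>D. interior K))"
    "measure lebesgue E - \<epsilon> < (\<Sum>K\<in>D. Sup K - Inf K)"
    "(\<Sum>K\<in>D. Sup K - Inf K) \<le> measure lebesgue U"
proof -
  define Q where "Q = {(u, v). u < v \<and> P u v \<and> {u..v} \<subseteq> U}"
  define c where "c = (\<lambda>(u, v). (u + v) / 2 :: real)"
  define r where "r = (\<lambda>(u, v). (v - u) / 2 :: real)"
  have cb: "cball (c p) (r p) = {fst p..snd p}" for p
    by (auto simp: cball_eq_atLeastAtMost c_def r_def field_simps split: prod.split)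
  obtain C where C: "countable C" "C \<subseteq> Q"
     "pairwise (\<lambda>i j. disjnt (cball (c i) (r i)) (cball (c j) (r j))) C"
     "negligible (E - (\<Union>i \<in> C. cball (c i) (r i)))"
  proof (rule Vitali_covering_theorem_cballs[of Q r E c])
    show "0 < r i" if "i \<in> Q" for i using that by (auto simp: Q_def r_def)
    fix t d :: real assume t: "t \<in> E" "0 < d"
    obtain e where e: "e > 0" "ball t e \<subseteq> U" using U t by (meson openE subsetD)
    obtain u v where uv: "u < t" "t < v" "v - u < min d e" "P u v"
      using P[OF t(1), of "min d e"] t e by auto
    have "{u..v} \<subseteq> ball t e" using uv by (auto simp: dist_real_def)
    then have "(u, v) \<in> Q" using uv e by (auto simp: Q_def)
    moreover have "t \<in> cball (c (u, v)) (r (u, v))" unfolding cb using uv by auto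
    moreover have "r (u, v) < d" using uv t by (auto simp: r_def)
    ultimately show "\<exists>i. i \<in> Q \<and> t \<in> cball (c i) (r i) \<and> r i < d" by blast
  qed auto
  \<comment> \<open>Passing to open intervals loses only countably many end points, a null
    set.\<close>
  define B where "B = (\<lambda>p. E \<inter> {fst p<..<snd p})"
  have Bm: "B p \<in> lmeasurable" for p unfolding B_def using E by (intro fmeasurable_Int_fmeasurable) auto
  have neg: "negligible (E - \<Union>(B ` C))"
  proof (rule negligible_subset)
    have "negligible (fst ` C \<union> snd ` C)"
      using C(1) countable_imp_null_set_lborel[of "fst ` C \<union> snd ` C"]
      by (simp add: negligible_iff_null_sets null_sets_completionI)
    then show "negligible ((E - (\<Union>i \<in> C. cball (c i) (r i))) \<union> (fst ` C \<union> snd ` C))"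
      using C(4) by simp
    show "E - \<Union>(B ` C) \<subseteq> (E - (\<Union>i \<in> C. cball (c i) (r i))) \<union> (fst ` C \<union> snd ` C)"
    proof
      fix t assume "t \<in> E - \<Union>(B ` C)"
      then have t: "t \<in> E" "\<forall>p\<in>C. \<not> (fst p < t \<and> t < snd p)" by (auto simp: B_def)
      show "t \<in> (E - (\<Union>i \<in> C. cball (c i) (r i))) \<union> (fst ` C \<union> snd ` C)"
      proof (cases "\<exists>p\<in>C. t \<in> {fst p..snd p}")
        case True
        then obtain p where "p \<in> C" "fst p \<le> t" "t \<le> snd p" by auto
        with t(2) have "t = fst p \<or> t = snd p" by force
        with \<open>p \<in> C\<close> show ?thesis by blast
      qed (use t in \<open>auto simp: cb\<close>)
    qed
  qed
  have UB: "\<Union>(B ` C) \<in> sets lebesgue"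
    using Bm C(1) by (intro sets.countable_Union) auto
  have UBm: "\<Union>(B ` C) \<in> lmeasurable"
    by (rule fmeasurableI2[OF E _ UB]) (auto simp: B_def)
  have mE: "measure lebesgue (\<Union>(B ` C)) = measure lebesgue E"
  proof (rule measure_negligible_symdiff)
    show "E \<in> lmeasurable" by (rule E)
    have "(E - \<Union>(B ` C)) \<union> (\<Union>(B ` C) - E) = E - \<Union>(B ` C)" by (auto simp: B_def)
    then show "negligible ((E - \<Union>(B ` C)) \<union> (\<Union>(B ` C) - E))" using neg by simp
  qed
  obtain D' where D': "D' \<subseteq> B ` C" "finite D'" "measure lebesgue (\<Union>(B ` C)) - \<epsilon> < measure lebesgue (\<Union>D')"
  proof (rule measure_countable_Union_approachable[of "B ` C" \<epsilon> "measure lebesgue E"])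
    fix D' assume D': "D' \<subseteq> B ` C" "finite D'"
    show "measure lebesgue (\<Union>D') \<le> measure lebesgue E"
    proof (rule measure_mono_fmeasurable)
      show "\<Union>D' \<subseteq> E" using D' by (auto simp: B_def)
      show "\<Union>D' \<in> sets lebesgue" using D' Bm by (intro sets.finite_Union) auto
    qed fact
  qed (use C Bm \<open>\<epsilon> > 0\<close> in auto)
  obtain F where F: "F \<subseteq> C" "finite F" "D' = B ` F"
    using finite_subset_image[OF D'(2,1)] by blast
  define I where "I = (\<lambda>p. {fst p..snd p} :: real set)"
  have FQ: "fst p < snd p \<and> P (fst p) (snd p) \<and> I p \<subseteq> U" if "p \<in> F" for p
  proof -
    have "p \<in> Q" using that F(1) C(2) by auto
    then show ?thesis by (simp add: Q_def I_def split_beta)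
  qed
  have disj: "I p \<inter> I p' = {}" if "p \<in> F" "p' \<in> F" "p \<noteq> p'" for p p'
    using C(3) that F(1) unfolding pairwise_def cb I_def disjnt_def by blast
  have inj: "inj_on I F"
  proof (rule inj_onI)
    fix p p' assume "p \<in> F" "p' \<in> F" "I p = I p'"
    then show "p = p'" using FQ[of p] FQ[of p'] by (auto simp: I_def Icc_eq_Icc prod_eq_iff)
  qed
  have dj: "disjoint (I ` F)"
    unfolding disjoint_def
  proof (intro ballI impI)
    fix A B assume "A \<in> I ` F" "B \<in> I ` F" "A \<noteq> B"
    then obtain p p' where "p \<in> F" "p' \<in> F" "A = I p" "B = I p'" "p \<noteq> p'" by blast
    then show "A \<inter> B = {}" using disj[of p p'] by simp
  qed
  have 1: "I ` F division_of \<Union>(I ` F)"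
  proof (rule division_ofI)
    show "finite (I ` F)" using F by simp
    fix K assume "K \<in> I ` F"
    then obtain p where p: "p \<in> F" "K = I p" by auto
    show "K \<subseteq> \<Union>(I ` F)" using p by auto
    show "K \<noteq> {}" using p FQ[of p] by (auto simp: I_def)
    show "\<exists>a b. K = cbox a b" using p by (auto simp: I_def)
    fix K' assume "K' \<in> I ` F" "K \<noteq> K'"
    then show "interior K \<inter> interior K' = {}"
      using disj p interior_subset by blast
  qed simp
  have int: "interior (I p) = {fst p<..<snd p}" for p by (simp add: I_def interior_atLeastAtMost_real)
  have eqB: "\<Union>D' = E \<inter> (\<Union>K\<in>I ` F. interior K)" using F by (auto simp: B_def int)
  have m1: "measure lebesgue E - \<epsilon> < measure lebesgue (E \<inter> (\<Union>K\<in>I ` F. interior K))"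
    using D'(3) unfolding mE eqB .
  have UI: "\<Union>(I ` F) \<in> lmeasurable" using F(2) by (intro fmeasurable.finite_Union) (auto simp: I_def)
  have msum: "(\<Sum>K\<in>I ` F. Sup K - Inf K) = measure lebesgue (\<Union>(I ` F))"
  proof -
    have "measure lebesgue (\<Union>(I ` F)) = (\<Sum>K\<in>I ` F. measure lebesgue K)"
      using F(2) dj by (intro measure_Union') (auto simp: I_def disjoint_def pairwise_def disjnt_def)
    also have "\<dots> = (\<Sum>K\<in>I ` F. Sup K - Inf K)"
      by (rule sum.cong) (use FQ in \<open>auto simp: I_def less_imp_le\<close>)
    finally show ?thesis ..
  qed
  show thesis
  proof
    show "I ` F division_of \<Union>(I ` F)" by (rule 1)
    show "\<Union>(I ` F) \<subseteq> U" using FQ by auto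
    show "\<And>K. K \<in> I ` F \<Longrightarrow> \<exists>u v. u < v \<and> K = {u..v} \<and> P u v"
      using FQ unfolding I_def by blast
    show "measure lebesgue E - \<epsilon> < measure lebesgue (E \<inter> (\<Union>K\<in>I ` F. interior K))" by (rule m1)
    have "measure lebesgue (E \<inter> (\<Union>K\<in>I ` F. interior K)) \<le> measure lebesgue (\<Union>(I ` F))"
    proof (rule measure_mono_fmeasurable[OF _ _ UI])
      show "E \<inter> (\<Union>K\<in>I ` F. interior K) \<subseteq> \<Union>(I ` F)" using interior_subset by blast
      show "E \<inter> (\<Union>K\<in>I ` F. interior K) \<in> sets lebesgue"
        using E F(2) by (intro sets.Int sets.finite_UN) auto
    qed
    then show "measure lebesgue E - \<epsilon> < (\<Sum>K\<in>I ` F. Sup K - Inf K)" using m1 msum by simp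
    show "(\<Sum>K\<in>I ` F. Sup K - Inf K) \<le> measure lebesgue U"
      unfolding msum using UI U FQ by (intro measure_mono_fmeasurable) auto
  qed
qed

section \<open>Differentiability almost everywhere\<close>

text \<open>Were the measure m of \<open>E\<close> positive, intervals \<open>J\<close> of slope
  below p would cover it up to a small error, and inside them intervals \<open>I\<close> of slope
  above q would again almost cover it. The increment over \<open>J\<close> is that over
  \<open>I\<close> plus that over the gaps; the gaps are short, so absolute continuity makes their
  share small. All total lengths being close to m, q m would be at most p m plus an error below (q -
  p) m.\<close>

lemma abs_continuous_conflicting_slopes_null:
  fixes f :: "real \<Rightarrow> real"
  assumes ac: "abs_continuous_on_interval a b f" and "p < q"
    and E: "E \<in> lmeasurable" "E \<subseteq> {a<..<b}"
    and up: "\<And>t d. t \<in> E \<Longrightarrow> 0 < d \<Longrightarrow> \<exists>u v. u < t \<and> t < v \<and> v - u < d \<and> q * (v - u) < f v - f u"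
    and lo: "\<And>t d. t \<in> E \<Longrightarrow> 0 < d \<Longrightarrow> \<exists>u v. u < t \<and> t < v \<and> v - u < d \<and> f v - f u < p * (v - u)"
  shows "negligible E"
proof (rule ccontr)
  define m where "m = measure lebesgue E"
  assume "\<not> negligible E"
  then have m: "m > 0" using E(1) by (simp add: m_def negligible_iff_measure zero_less_measure_iff)
  define \<epsilon> where "\<epsilon> = (q - p) * m / 4"
  have \<epsilon>: "\<epsilon> > 0" using m \<open>p < q\<close> by (simp add: \<epsilon>_def)
  obtain \<delta> where \<delta>: "\<delta> > 0" and small:
    "\<And>D. D division_of \<Union>D \<Longrightarrow> \<Union>D \<subseteq> {a..b} \<Longrightarrow> (\<Sum>K\<in>D. Sup K - Inf K) < \<delta> \<Longrightarrow>
       (\<Sum>K\<in>D. norm (f (Sup K) - f (Inf K))) < \<epsilon>"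
    using abs_continuous_division[OF ac \<epsilon>] by blast
  \<comment> \<open>The covering error will be \<eta>. The gaps turn out shorter than 3 \<eta>,
    hence the bound \<open>\<delta> / 4\<close>; the bound through \<open>Y\<close> lets the errors
    2 (q - p) \<eta> and 3 |p| \<eta> be absorbed by the three quarters of (q - p) m that remain
    after subtracting \<epsilon>.\<close>
  define Y where "Y = 16 * (q - p + \<bar>p\<bar>)"
  have Y: "Y > 0" using \<open>p < q\<close> by (simp add: Y_def)
  define \<eta> where "\<eta> = min (\<delta> / 4) ((q - p) * m / Y)"
  have \<eta>: "\<eta> > 0" using \<delta> m \<open>p < q\<close> Y by (auto simp: \<eta>_def)
  have "\<eta> \<le> (q - p) * m / Y" by (simp add: \<eta>_def)
  then have "\<eta> * Y \<le> (q - p) * m" using Y by (simp add: pos_le_divide_eq)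
  then have \<eta>1: "16 * ((q - p) * \<eta>) + 16 * (\<bar>p\<bar> * \<eta>) \<le> (q - p) * m" by (simp add: Y_def algebra_simps)
  obtain T where T: "open T" "E \<subseteq> T" "T - E \<in> lmeasurable" "emeasure lebesgue (T - E) < ennreal \<eta>"
    using sets_lebesgue_outer_open[of E \<eta>] E \<eta> by (auto intro: fmeasurableD)
  have mT: "measure lebesgue (T - E) < \<eta>"
    using T(3,4) \<eta> by (simp add: emeasure_eq_measure2 ennreal_less_iff)
  define U where "U = T \<inter> {a<..<b}"
  have "bounded U" by (rule bounded_subset[OF compact_imp_bounded[OF compact_Icc[of a b]]]) (auto simp: U_def)
  moreover have Uo: "open U" using T(1) by (simp add: U_def open_Int)
  ultimately have U: "open U" "E \<subseteq> U" "U \<in> lmeasurable"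
    using T(2) E(2) by (auto simp: U_def[symmetric] lmeasurable_open) (auto simp: U_def)
  have "measure lebesgue U \<le> measure lebesgue (E \<union> (T - E))"
    using fmeasurable.Un[OF E(1) T(3)] U by (intro measure_mono_fmeasurable) (auto simp: U_def)
  also have "\<dots> \<le> measure lebesgue E + measure lebesgue (T - E)"
    using E T by (intro measure_Un_le) auto
  finally have mU: "measure lebesgue U < m + \<eta>" using mT by (simp add: m_def)
  obtain J where J: "J division_of \<Union>J" "\<Union>J \<subseteq> U"
    "\<And>K. K \<in> J \<Longrightarrow> \<exists>u v. u < v \<and> K = {u..v} \<and> f v - f u < p * (v - u)"
    "measure lebesgue E - \<eta> < measure lebesgue (E \<inter> (\<Union>K\<in>J. interior K))"
    "(\<Sum>K\<in>J. Sup K - Inf K) \<le> measure lebesgue U"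
    by (rule Vitali_finite_intervals[OF E(1) U \<eta>, of "\<lambda>u v. f v - f u < p * (v - u)", OF lo]) blast+
  have finJ: "finite J" using J(1) by blast
  define U' where "U' = (\<Union>K\<in>J. interior K)"
  define E' where "E' = E \<inter> U'"
  have U'sub: "U' \<subseteq> U" using J(2) interior_subset unfolding U'_def by blast
  have U'o: "open U'" "E' \<subseteq> U'" by (auto simp: U'_def E'_def)
  have U': "open U'" "E' \<subseteq> U'" "U' \<in> lmeasurable"
    using U'o fmeasurableI2[OF U(3) U'sub] by auto
  have E': "E' \<in> lmeasurable" using E U' unfolding E'_def by (auto intro: fmeasurable_Int_fmeasurable)
  obtain I where I: "I division_of \<Union>I" "\<Union>I \<subseteq> U'"
    "\<And>K. K \<in> I \<Longrightarrow> \<exists>u v. u < v \<and> K = {u..v} \<and> (q * (v - u) < f v - f u \<and> (\<exists>L\<in>J. {u..v} \<subseteq> L))"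
    "measure lebesgue E' - \<eta> < (\<Sum>K\<in>I. Sup K - Inf K)"
  proof (rule Vitali_finite_intervals[OF E' U' \<eta>, of "\<lambda>u v. q * (v - u) < f v - f u \<and> (\<exists>L\<in>J. {u..v} \<subseteq> L)"])
    fix t d :: real assume t: "t \<in> E'" "0 < d"
    then obtain L where L: "L \<in> J" "t \<in> interior L" by (auto simp: E'_def U'_def)
    then obtain e where e: "e > 0" "ball t e \<subseteq> interior L" using openE[OF open_interior] by blast
    obtain u v where uv: "u < t" "t < v" "v - u < min d e" "q * (v - u) < f v - f u"
      using up[of t "min d e"] t e by (auto simp: E'_def)
    have "{u..v} \<subseteq> ball t e" using uv by (auto simp: dist_real_def)
    then have "{u..v} \<subseteq> L" using e interior_subset by blast
    then show "\<exists>u v. u < t \<and> t < v \<and> v - u < d \<and> q * (v - u) < f v - f u \<and> (\<exists>L\<in>J. {u..v} \<subseteq> L)"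
      using uv L by auto
  qed blast
  obtain G where G: "G division_of \<Union>G" "\<Union>G \<subseteq> \<Union>J"
    "\<And>g :: real \<Rightarrow> real. (\<Sum>K\<in>J. g (Sup K) - g (Inf K)) =
       (\<Sum>K\<in>I. g (Sup K) - g (Inf K)) + (\<Sum>K\<in>G. g (Sup K) - g (Inf K))"
  proof (rule nested_division_gaps[OF J(1) I(1)])
    fix K assume "K \<in> I"
    then obtain u v L where uv: "u < v" "K = {u..v}" "L \<in> J" "{u..v} \<subseteq> L" using I(3) by metis
    have "interior K \<noteq> {}" using uv by (simp add: interior_atLeastAtMost_real)
    then show "\<exists>L\<in>J. K \<subseteq> L \<and> interior K \<noteq> {}" using uv by auto
  qed blast
  define SJ where "SJ = (\<Sum>K\<in>J. Sup K - Inf K)"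
  define SI where "SI = (\<Sum>K\<in>I. Sup K - Inf K)"
  define SG where "SG = (\<Sum>K\<in>G. Sup K - Inf K)"
  have S: "SJ = SI + SG" using G(3)[of "\<lambda>x. x"] by (simp add: SJ_def SI_def SG_def)
  \<comment> \<open>Each of the two coverings loses \<eta>; as \<open>J\<close> has total length
    below m + \<eta>, at most 3 \<eta> is left for the gaps.\<close>
  have SI: "SI > m - 2 * \<eta>" using I(4) J(4) by (simp add: SI_def E'_def U'_def m_def)
  have SG: "SG < 3 * \<eta>" using S SI J(5) mU by (simp add: SJ_def)
  have SG0: "0 \<le> SG" unfolding SG_def
  proof (rule sum_nonneg)
    fix K assume K: "K \<in> G"
    then obtain c d where "K = cbox c d" "K \<noteq> {}" using division_ofD(3,4)[OF G(1)] by metis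
    then show "0 \<le> Sup K - Inf K" by auto
  qed
  have Gf: "(\<Sum>K\<in>G. norm (f (Sup K) - f (Inf K))) < \<epsilon>"
  proof (rule small[OF G(1)])
    show "\<Union>G \<subseteq> {a..b}" using G(2) J(2) by (force simp: U_def)
    have "3 * \<eta> < \<delta>" using \<delta> by (auto simp: \<eta>_def min_def)
    then show "(\<Sum>K\<in>G. Sup K - Inf K) < \<delta>" using SG by (simp add: SG_def)
  qed
  have Gf': "- \<epsilon> < (\<Sum>K\<in>G. f (Sup K) - f (Inf K))"
    using Gf sum_norm_le[of G "\<lambda>K. f (Sup K) - f (Inf K)", OF order_refl] by (simp add: abs_le_iff)
  have "(\<Sum>K\<in>J. f (Sup K) - f (Inf K)) \<le> (\<Sum>K\<in>J. p * (Sup K - Inf K))"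
  proof (rule sum_mono)
    fix K assume "K \<in> J"
    then obtain u v where "u < v" "K = {u..v}" "f v - f u < p * (v - u)" using J(3) by blast
    then show "f (Sup K) - f (Inf K) \<le> p * (Sup K - Inf K)" by auto
  qed
  then have Jf: "(\<Sum>K\<in>J. f (Sup K) - f (Inf K)) \<le> p * SJ" by (simp add: SJ_def sum_distrib_left)
  have "(\<Sum>K\<in>I. q * (Sup K - Inf K)) \<le> (\<Sum>K\<in>I. f (Sup K) - f (Inf K))"
  proof (rule sum_mono)
    fix K assume "K \<in> I"
    then obtain u v where "u < v" "K = {u..v}" "q * (v - u) < f v - f u" using I(3) by blast
    then show "q * (Sup K - Inf K) \<le> f (Sup K) - f (Inf K)" by auto
  qed
  then have If: "q * SI \<le> (\<Sum>K\<in>I. f (Sup K) - f (Inf K))" by (simp add: SI_def sum_distrib_left)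
  have "q * SI - \<epsilon> < p * SJ" using G(3)[of f] Gf' Jf If by linarith
  then have 1: "(q - p) * SI < (q - p) * m / 4 + p * SG" using S by (simp add: algebra_simps \<epsilon>_def)
  have "(q - p) * (m - 2 * \<eta>) \<le> (q - p) * SI" using SI \<open>p < q\<close> by (intro mult_left_mono) auto
  then have 2: "(q - p) * m - 2 * ((q - p) * \<eta>) \<le> (q - p) * SI" by (simp add: algebra_simps)
  have 3: "p * SG \<le> 3 * (\<bar>p\<bar> * \<eta>)"
    by (rule order_trans[OF _ order_trans[OF mult_mono[of "\<bar>p\<bar>" "\<bar>p\<bar>" SG "3 * \<eta>"]]])
      (use SG SG0 in \<open>auto intro: mult_right_mono\<close>)
  have 4: "0 \<le> (q - p) * \<eta>" "0 \<le> \<bar>p\<bar> * \<eta>" "0 < (q - p) * m" using \<eta> m \<open>p < q\<close> by auto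
  show False using 1 2 3 4 \<eta>1 by linarith
qed

text \<open>On a window shorter than \<delta> the variation of f is below 1, while slopes above 2 /
  m on intervals of total length above m / 2 would force an increment above 1.\<close>

lemma abs_continuous_infinite_slope_null:
  fixes f :: "real \<Rightarrow> real"
  assumes ac: "abs_continuous_on_interval a b f"
    and E: "E \<in> lmeasurable" "E \<subseteq> {a<..<b}"
    and up: "\<And>q t d. t \<in> E \<Longrightarrow> 0 < d \<Longrightarrow> \<exists>u v. u < t \<and> t < v \<and> v - u < d \<and> q * (v - u) < f v - f u"
  shows "negligible E"
proof -
  obtain \<delta> where \<delta>: "\<delta> > 0" and small:
    "\<And>D. D division_of \<Union>D \<Longrightarrow> \<Union>D \<subseteq> {a..b} \<Longrightarrow> (\<Sum>K\<in>D. Sup K - Inf K) < \<delta> \<Longrightarrow>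
       (\<Sum>K\<in>D. norm (f (Sup K) - f (Inf K))) < 1"
    using abs_continuous_division[OF ac zero_less_one] by blast
  \<comment> \<open>Windows of length 3 \<delta> / 4, overlapping so that every point lies inside
    one of them.\<close>
  define V where "V k = {(real_of_int k - 1) * (\<delta> / 4)<..<(real_of_int k + 2) * (\<delta> / 4)}" for k
  have neg: "negligible (E \<inter> V k)" for k
  proof (rule ccontr)
    define m where "m = measure lebesgue (E \<inter> V k)"
    have EV: "E \<inter> V k \<in> lmeasurable" using E(1) by (auto simp: V_def intro: fmeasurable_Int_fmeasurable)
    assume "\<not> negligible (E \<inter> V k)"
    then have m: "m > 0" using EV by (simp add: m_def negligible_iff_measure zero_less_measure_iff)
    define U where "U = {a<..<b} \<inter> V k"
    have U: "open U" "E \<inter> V k \<subseteq> U" "U \<in> lmeasurable" using E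
      by (auto simp: U_def V_def)
    have "measure lebesgue U \<le> measure lebesgue (V k)"
      using U by (intro measure_mono_fmeasurable) (auto simp: U_def V_def)
    also have "\<dots> < \<delta>" using \<delta> by (simp add: V_def field_simps)
    finally have mU: "measure lebesgue U < \<delta>" .
    obtain I where I: "I division_of \<Union>I" "\<Union>I \<subseteq> U"
      "\<And>K. K \<in> I \<Longrightarrow> \<exists>u v. u < v \<and> K = {u..v} \<and> 2 / m * (v - u) < f v - f u"
      "measure lebesgue (E \<inter> V k) - m / 2 < (\<Sum>K\<in>I. Sup K - Inf K)"
      "(\<Sum>K\<in>I. Sup K - Inf K) \<le> measure lebesgue U"
    proof (rule Vitali_finite_intervals[OF EV U, of "m / 2" "\<lambda>u v. 2 / m * (v - u) < f v - f u"])
      show "0 < m / 2" using m by simp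
      show "\<exists>u v. u < t \<and> t < v \<and> v - u < d \<and> 2 / m * (v - u) < f v - f u"
        if "t \<in> E \<inter> V k" "0 < d" for t d using up[of t d "2 / m"] that by blast
    qed blast
    have "1 < 2 / m * (\<Sum>K\<in>I. Sup K - Inf K)" using I(4) m by (simp add: field_simps m_def)
    also have "\<dots> = (\<Sum>K\<in>I. 2 / m * (Sup K - Inf K))" by (simp add: sum_distrib_left)
    also have "\<dots> \<le> (\<Sum>K\<in>I. norm (f (Sup K) - f (Inf K)))"
    proof (rule sum_mono)
      fix K assume "K \<in> I"
      then obtain u v where "u < v" "K = {u..v}" "2 / m * (v - u) < f v - f u" using I(3) by blast
      then show "2 / m * (Sup K - Inf K) \<le> norm (f (Sup K) - f (Inf K))" by auto
    qed
    also have "\<dots> < 1" using I mU by (intro small) (auto simp: U_def)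
    finally show False .
  qed
  have "E \<subseteq> (\<Union>k. E \<inter> V k)"
  proof
    fix t assume t: "t \<in> E"
    define k where "k = \<lfloor>t / (\<delta> / 4)\<rfloor>"
    have "of_int k \<le> t / (\<delta> / 4)" "t / (\<delta> / 4) < of_int k + 1" unfolding k_def by linarith+
    then have "of_int k * (\<delta> / 4) \<le> t" "t < (of_int k + 1) * (\<delta> / 4)"
      using \<delta> by (simp_all add: field_simps)
    then have "t \<in> V k" using \<delta> by (auto simp: V_def algebra_simps)
    then show "t \<in> (\<Union>k. E \<inter> V k)" using t by blast
  qed
  moreover have "negligible (\<Union>k. E \<inter> V k)"
    by (rule negligible_countable_Union) (use neg in auto)
  ultimately show ?thesis using negligible_subset by blast
qed

lemma abs_continuous_uminus:
  "abs_continuous_on_interval a b f \<Longrightarrow> abs_continuous_on_interval a b (\<lambda>t. - f t)"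
  unfolding abs_continuous_on_interval_def by (simp add: norm_minus_commute)

lemma abs_continuous_imp_continuous_on:
  assumes "abs_continuous_on_interval a b f"
  shows "continuous_on {a..b} f"
  unfolding continuous_on_iff
proof (intro ballI allI impI)
  fix t e :: real assume t: "t \<in> {a..b}" and e: "0 < e"
  obtain d where d: "d > 0" and *:
    "\<And>(N::nat) u v. \<forall>k<N. a \<le> u k \<and> u k \<le> v k \<and> v k \<le> b \<Longrightarrow>
        disjoint_family_on (\<lambda>k. {u k<..<v k}) {..<N} \<Longrightarrow>
        (\<Sum>k<N. v k - u k) < d \<Longrightarrow> (\<Sum>k<N. norm (f (v k) - f (u k))) < e"
    using assms[unfolded abs_continuous_on_interval_def, THEN spec, THEN mp, OF e] by auto
  have **: "norm (f v - f u) < e" if "a \<le> u" "u \<le> v" "v \<le> b" "v - u < d" for u v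
    using *[of "Suc 0" "\<lambda>_. u" "\<lambda>_. v"] that by (auto simp: disjoint_family_on_def)
  have "norm (f s - f t) < e" if s: "s \<in> {a..b}" "dist s t < d" for s
    using **[of s t] **[of t s] s t
    by (cases "s \<le> t") (auto simp: dist_real_def norm_minus_commute)
  then show "\<exists>d>0. \<forall>s\<in>{a..b}. dist s t < d \<longrightarrow> dist (f s) (f t) < e"
    using d by (auto simp: dist_norm)
qed

text \<open>The covering arguments only see intervals with t strictly inside. Continuity at t allows
  one end to tend to t, which recovers the one-sided difference quotients.\<close>

lemma has_real_derivative_if_straddling:
  fixes f :: "real \<Rightarrow> real"
  assumes cont: "isCont f t"
    and *: "\<And>e. e > 0 \<Longrightarrow> \<exists>d>0. \<forall>u v. u < t \<longrightarrow> t < v \<longrightarrow> v - u < d \<longrightarrow> \<bar>f v - f u - L * (v - u)\<bar> \<le> e * (v - u)"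
  shows "(f has_real_derivative L) (at t)"
  unfolding has_field_derivative_def has_derivative_at_alt
proof (intro conjI allI impI)
  show "bounded_linear ((*) L)" by (rule bounded_linear_mult_right)
  fix e :: real assume "0 < e"
  then obtain d where d: "d > 0" and
    D: "\<And>u v. u < t \<Longrightarrow> t < v \<Longrightarrow> v - u < d \<Longrightarrow> \<bar>f v - f u - L * (v - u)\<bar> \<le> e * (v - u)"
    using * by blast
  have R: "\<bar>f v - f t - L * (v - t)\<bar> \<le> e * (v - t)" if v: "t < v" "v - t < d" for v
  proof (rule tendsto_le[OF trivial_limit_at_left_real])
    show "((\<lambda>u. e * (v - u)) \<longlongrightarrow> e * (v - t)) (at_left t)" by (intro tendsto_intros)
    have "(f \<longlongrightarrow> f t) (at_left t)" using cont by (simp add: continuous_at filterlim_at_split)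
    then show "((\<lambda>u. \<bar>f v - f u - L * (v - u)\<bar>) \<longlongrightarrow> \<bar>f v - f t - L * (v - t)\<bar>) (at_left t)"
      by (intro tendsto_intros)
    show "\<forall>\<^sub>F u in at_left t. \<bar>f v - f u - L * (v - u)\<bar> \<le> e * (v - u)"
      using eventually_at_left_real[of "v - d" t] v by (auto elim!: eventually_mono intro!: D)
  qed
  have Lf: "\<bar>f t - f u - L * (t - u)\<bar> \<le> e * (t - u)" if u: "u < t" "t - u < d" for u
  proof (rule tendsto_le[OF trivial_limit_at_right_real])
    show "((\<lambda>v. e * (v - u)) \<longlongrightarrow> e * (t - u)) (at_right t)" by (intro tendsto_intros)
    have "(f \<longlongrightarrow> f t) (at_right t)" using cont by (simp add: continuous_at filterlim_at_split)
    then show "((\<lambda>v. \<bar>f v - f u - L * (v - u)\<bar>) \<longlongrightarrow> \<bar>f t - f u - L * (t - u)\<bar>) (at_right t)"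
      by (intro tendsto_intros)
    show "\<forall>\<^sub>F v in at_right t. \<bar>f v - f u - L * (v - u)\<bar> \<le> e * (v - u)"
      using eventually_at_right_real[of t "u + d"] u by (auto elim!: eventually_mono intro!: D)
  qed
  show "\<exists>d>0. \<forall>y. norm (y - t) < d \<longrightarrow> norm (f y - f t - L * (y - t)) \<le> e * norm (y - t)"
  proof (intro exI[of _ d] conjI allI impI d)
    fix y assume y: "norm (y - t) < d"
    consider "y < t" | "y = t" | "t < y" by linarith
    then show "norm (f y - f t - L * (y - t)) \<le> e * norm (y - t)"
    proof cases
      case 1
      then have "norm (f y - f t - L * (y - t)) = \<bar>f t - f y - L * (t - y)\<bar>" by (simp add: algebra_simps abs_if)
      also have "\<dots> \<le> e * (t - y)" using Lf 1 y by auto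
      finally show ?thesis using 1 by simp
    qed (use R[of y] y in auto)
  qed
qed

text \<open>For the slopes of short intervals straddling t, a derivative can fail to exist in three
  ways only: the limsup exceeds the liminf, with two rationals in between, or the limsup is plus
  infinity, or the liminf is minus infinity. The two null-set lemmas on slopes dispose of these
  cases.\<close>

theorem abs_continuous_imp_differentiable_AE:
  fixes f :: "real \<Rightarrow> real"
  assumes ac: "abs_continuous_on_interval a b f"
  shows "negligible {t \<in> {a<..<b}. \<not> f differentiable (at t)}"
proof -
  define Up where "Up g q = {t \<in> {a<..<b}. \<forall>d>0. \<exists>u v. u < t \<and> t < v \<and> v - u < d \<and> q * (v - u) < g v - g u}"
    for g :: "real \<Rightarrow> real" and q
  have Up_meas: "Up g q \<in> lmeasurable" for g q
  proof -
    \<comment> \<open>Measurability holds for arbitrary \<open>g\<close>, since at each scale the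
      straddled points form a union of open intervals.\<close>
    define O' where "O' n = (\<Union>{{u<..<v} | u v. v - u < inverse (Suc n) \<and> q * (v - u) < g v - g u})" for n
    have "Up g q = {a<..<b} \<inter> (\<Inter>n. O' n)"
    proof (intro equalityI subsetI)
      fix t assume "t \<in> Up g q"
      then have t: "t \<in> {a<..<b}" "\<And>d. d > 0 \<Longrightarrow> \<exists>u v. u < t \<and> t < v \<and> v - u < d \<and> q * (v - u) < g v - g u"
        by (auto simp: Up_def)
      have "t \<in> O' n" for n
      proof -
        obtain u v where uv: "u < t" "t < v" "v - u < inverse (Suc n)" "q * (v - u) < g v - g u"
          using t(2)[of "inverse (Suc n)"] by auto
        then have "{u<..<v} \<in> {{u<..<v} | u v. v - u < inverse (Suc n) \<and> q * (v - u) < g v - g u}" by blast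
        moreover have "t \<in> {u<..<v}" using uv by simp
        ultimately show ?thesis unfolding O'_def by (rule UnionI)
      qed
      then show "t \<in> {a<..<b} \<inter> (\<Inter>n. O' n)" using t by auto
    next
      fix t assume t: "t \<in> {a<..<b} \<inter> (\<Inter>n. O' n)"
      have "\<exists>u v. u < t \<and> t < v \<and> v - u < d \<and> q * (v - u) < g v - g u" if "0 < d" for d
      proof -
        obtain n where n: "inverse (Suc n) < d" using reals_Archimedean[OF \<open>0 < d\<close>] by auto
        have "t \<in> O' n" using t by auto
        then obtain u v where "u < t" "t < v" "v - u < inverse (Suc n)" "q * (v - u) < g v - g u"
          by (auto simp: O'_def)
        with n show ?thesis by (intro exI[of _ u] exI[of _ v]) auto
      qed
      then show "t \<in> Up g q" using t by (auto simp: Up_def)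
    qed
    moreover have "open (O' n)" for n unfolding O'_def by (rule open_Union) auto
    then have "(\<Inter>n. O' n) \<in> sets lebesgue"
      by (intro sets.countable_INT) auto
    ultimately show ?thesis by (simp add: Int_commute fmeasurable_Int_fmeasurable)
  qed
  \<comment> \<open>Small slopes of f are large slopes of -f, so the single family \<open>Up\<close>
    serves both sides.\<close>
  let ?nf = "\<lambda>t. - f t"
  define N1 where "N1 = (\<Union>(p, q)\<in>{(p, q). p \<in> \<rat> \<and> q \<in> \<rat> \<and> p < q}. Up f q \<inter> Up ?nf (- p))"
  define N2 where "N2 = (\<Inter>k::nat. Up f (real k))"
  define N3 where "N3 = (\<Inter>k::nat. Up ?nf (real k))"
  have mono: "t \<in> Up g q \<Longrightarrow> q' \<le> q \<Longrightarrow> t \<in> Up g q'" for t g q q'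
  proof -
    assume t: "t \<in> Up g q" and q: "q' \<le> q"
    have "\<exists>u v. u < t \<and> t < v \<and> v - u < d \<and> q' * (v - u) < g v - g u" if d: "d > 0" for d
    proof -
      obtain u v where uv: "u < t" "t < v" "v - u < d" "q * (v - u) < g v - g u"
        using t d by (auto simp: Up_def)
      have "q' * (v - u) \<le> q * (v - u)" using uv q by (intro mult_right_mono) auto
      then have "q' * (v - u) < g v - g u" using uv by linarith
      with uv show ?thesis by blast
    qed
    then show "t \<in> Up g q'" using t by (auto simp: Up_def)
  qed
  have "negligible N1"
    unfolding N1_def
  proof (rule negligible_countable_Union)
    have "countable ((\<rat> :: real set) \<times> (\<rat> :: real set))" by (intro countable_SIGMA countable_rat)
    then have "countable {(p, q). p \<in> \<rat> \<and> q \<in> \<rat> \<and> p < (q :: real)}" by (rule countable_subset[rotated]) auto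
    then show "countable ((\<lambda>(p, q). Up f q \<inter> Up ?nf (- p)) ` {(p, q). p \<in> \<rat> \<and> q \<in> \<rat> \<and> p < q})"
      by (rule countable_image)
    fix S assume "S \<in> (\<lambda>(p, q). Up f q \<inter> Up ?nf (- p)) ` {(p, q). p \<in> \<rat> \<and> q \<in> \<rat> \<and> p < q}"
    then obtain p q where pq: "p < q" "S = Up f q \<inter> Up ?nf (- p)" by auto
    show "negligible S"
    proof (rule abs_continuous_conflicting_slopes_null[OF ac pq(1)])
      show "S \<in> lmeasurable" unfolding pq by (intro fmeasurable.Int Up_meas)
      show "S \<subseteq> {a<..<b}" unfolding pq by (auto simp: Up_def)
      fix t d :: real assume td: "t \<in> S" "0 < d"
      show "\<exists>u v. u < t \<and> t < v \<and> v - u < d \<and> q * (v - u) < f v - f u"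
        using td by (simp add: pq Up_def)
      have "\<exists>u v. u < t \<and> t < v \<and> v - u < d \<and> (- p) * (v - u) < ?nf v - ?nf u"
        using td by (simp add: pq Up_def)
      then show "\<exists>u v. u < t \<and> t < v \<and> v - u < d \<and> f v - f u < p * (v - u)" by fastforce
    qed
  qed
  have inf_null: "negligible (\<Inter>k::nat. Up g (real k))" if g: "abs_continuous_on_interval a b g" for g
  proof (rule abs_continuous_infinite_slope_null[OF g])
    have "(\<Inter>k::nat. Up g (real k)) \<in> sets lebesgue" using Up_meas by (intro sets.countable_INT) auto
    then show "(\<Inter>k::nat. Up g (real k)) \<in> lmeasurable"
      by (rule fmeasurableI2[OF lmeasurable_interval(2)[of a b], rotated]) (auto simp: Up_def)
    show "(\<Inter>k::nat. Up g (real k)) \<subseteq> {a<..<b}" by (auto simp: Up_def)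
    fix q t d :: real assume t: "t \<in> (\<Inter>k::nat. Up g (real k))" "0 < d"
    obtain k :: nat where "q \<le> real k" using real_arch_simple by blast
    then have "t \<in> Up g q" using t mono by blast
    then show "\<exists>u v. u < t \<and> t < v \<and> v - u < d \<and> q * (v - u) < g v - g u" using t by (simp add: Up_def)
  qed
  have N23: "negligible N2" "negligible N3"
    unfolding N2_def N3_def by (intro inf_null abs_continuous_uminus ac)+
  have "f differentiable (at t)" if t: "t \<in> {a<..<b}" "t \<notin> N1" "t \<notin> N2" "t \<notin> N3" for t
  proof -
    have straddle: "\<exists>u v. u < t \<and> t < v \<and> v - u < d" if "d > 0" for d
      by (rule exI[of _ "t - d/3"], rule exI[of _ "t + d/3"]) (use that in auto)
    have notUp: "\<exists>d>0. \<forall>u v. u < t \<longrightarrow> t < v \<longrightarrow> v - u < d \<longrightarrow> f v - f u \<le> q * (v - u)" if "t \<notin> Up f q" for q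
      using that t(1) by (force simp: Up_def not_less)
    have notDn: "\<exists>d>0. \<forall>u v. u < t \<longrightarrow> t < v \<longrightarrow> v - u < d \<longrightarrow> - q * (v - u) \<le> f v - f u" if q: "t \<notin> Up ?nf q" for q
    proof -
      obtain d where "d > 0" "\<And>u v. u < t \<Longrightarrow> t < v \<Longrightarrow> v - u < d \<Longrightarrow> \<not> q * (v - u) < ?nf v - ?nf u"
        using q t(1) by (auto simp: Up_def)
      then show ?thesis by (intro exI[of _ d]) (force simp: not_less)
    qed
    \<comment> \<open>The infimum of \<open>C\<close> is the limsup of the straddling slopes; t
      outside \<open>N2\<close> makes \<open>C\<close> nonempty, and t outside \<open>N3\<close>
      bounds it below.\<close>
    define C where "C = {c. t \<notin> Up f c}"
    have "C \<noteq> {}" using t(3) by (auto simp: C_def N2_def)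
    obtain k :: nat where k: "t \<notin> Up ?nf (real k)" using t(4) by (auto simp: N3_def)
    have "- real k \<le> c" if c: "c \<in> C" for c
    proof -
      obtain d where d: "d > 0" "\<And>u v. u < t \<Longrightarrow> t < v \<Longrightarrow> v - u < d \<Longrightarrow> f v - f u \<le> c * (v - u)"
        using notUp[of c] c by (auto simp: C_def)
      obtain d' where d': "d' > 0" "\<And>u v. u < t \<Longrightarrow> t < v \<Longrightarrow> v - u < d' \<Longrightarrow> - real k * (v - u) \<le> f v - f u"
        using notDn[OF k] by auto
      obtain u v where uv: "u < t" "t < v" "v - u < min d d'" using straddle[of "min d d'"] d d' by auto
      then have "- real k * (v - u) \<le> c * (v - u)" using d(2)[of u v] d'(2)[of u v] by linarith
      then show ?thesis using uv by (subst (asm) mult_le_cancel_right_pos) auto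
    qed
    then have bdd: "bdd_below C" by (intro bdd_belowI)
    define L where "L = Inf C"
    have "(f has_real_derivative L) (at t)"
    proof (rule has_real_derivative_if_straddling)
      show "isCont f t" using abs_continuous_imp_continuous_on[OF ac] t(1)
        by (simp add: continuous_on_interior interior_atLeastAtMost_real)
      fix e :: real assume e: "e > 0"
      obtain c where c: "c \<in> C" "c < L + e"
        using cInf_lessD[OF \<open>C \<noteq> {}\<close>, of "L + e"] e by (auto simp: L_def)
      \<comment> \<open>A rational q just below the infimum is still exceeded by slopes at every
        scale. As t lies outside \<open>N1\<close>, slopes below the smaller rational p then cannot
        persist, so all slopes at small scale are within e of L.\<close>
      obtain q where q: "q \<in> \<rat>" "L - e < q" "q < L" using Rats_dense_in_real[of "L - e" L] e by auto
      obtain p where p: "p \<in> \<rat>" "L - e < p" "p < q" using Rats_dense_in_real[of "L - e" q] q by auto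
      have "q \<notin> C" using cInf_lower[OF _ bdd, of q] q by (auto simp: L_def)
      then have "t \<in> Up f q" by (simp add: C_def)
      then have "t \<notin> Up ?nf (- p)" using t(2) p q unfolding N1_def by blast
      then obtain d' where d': "d' > 0" "\<And>u v. u < t \<Longrightarrow> t < v \<Longrightarrow> v - u < d' \<Longrightarrow> p * (v - u) \<le> f v - f u"
        using notDn[of "- p"] by auto
      obtain d where d: "d > 0" "\<And>u v. u < t \<Longrightarrow> t < v \<Longrightarrow> v - u < d \<Longrightarrow> f v - f u \<le> c * (v - u)"
        using notUp[of c] c by (auto simp: C_def)
      show "\<exists>d>0. \<forall>u v. u < t \<longrightarrow> t < v \<longrightarrow> v - u < d \<longrightarrow> \<bar>f v - f u - L * (v - u)\<bar> \<le> e * (v - u)"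
      proof (intro exI[of _ "min d d'"] conjI allI impI)
        fix u v assume uv: "u < t" "t < v" "v - u < min d d'"
        have "f v - f u \<le> c * (v - u)" using d uv by auto
        also have "\<dots> \<le> (L + e) * (v - u)" using c uv by (intro mult_right_mono) auto
        finally have 1: "f v - f u \<le> (L + e) * (v - u)" .
        have "(L - e) * (v - u) \<le> p * (v - u)" using p uv by (intro mult_right_mono) auto
        also have "\<dots> \<le> f v - f u" using d' uv by auto
        finally show "\<bar>f v - f u - L * (v - u)\<bar> \<le> e * (v - u)" using 1 by (simp add: algebra_simps abs_le_iff)
      qed (use d d' in auto)
    qed
    then show ?thesis using real_differentiable_def by blast
  qed
  then have "{t \<in> {a<..<b}. \<not> f differentiable (at t)} \<subseteq> N1 \<union> N2 \<union> N3" by blast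
  moreover have "negligible (N1 \<union> N2 \<union> N3)" using \<open>negligible N1\<close> N23 by simp
  ultimately show ?thesis using negligible_subset by blast
qed

section \<open>The fundamental theorem for absolutely continuous functions\<close>

text \<open>Members of a division may share end points; passing to interiors makes them disjoint
  without changing their lengths.\<close>

lemma division_length_le_measure:
  fixes U :: "real set"
  assumes D: "D division_of \<Union>D" "\<Union>D \<subseteq> U" "U \<in> lmeasurable"
  shows "(\<Sum>K\<in>D. Sup K - Inf K) \<le> measure lebesgue U"
proof -
  have fin: "finite D" using D(1) by blast
  have int: "\<exists>c d. K = {c..d} \<and> c \<le> d" if "K \<in> D" for K
    using division_ofD(3,4)[OF D(1) that] by (metis atLeastatMost_empty_iff box_real(2) not_le)
  have "(\<Sum>K\<in>D. Sup K - Inf K) = (\<Sum>K\<in>D. measure lebesgue (interior K))"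
  proof (rule sum.cong[OF refl])
    fix K assume "K \<in> D"
    then obtain c d where "K = {c..d}" "c \<le> d" using int by blast
    then show "Sup K - Inf K = measure lebesgue (interior K)" by (simp add: interior_atLeastAtMost_real)
  qed
  also have "\<dots> = measure lebesgue (\<Union>K\<in>D. interior K)"
  proof (rule measure_UNION'[symmetric, OF fin])
    show "interior K \<in> lmeasurable" if K: "K \<in> D" for K
      using int[OF K] by (auto simp: interior_atLeastAtMost_real)
    show "pairwise (\<lambda>i j. disjnt (interior i) (interior j)) D"
      using division_ofD(5)[OF D(1)] by (auto simp: pairwise_def disjnt_def)
  qed
  also have "\<dots> \<le> measure lebesgue U"
  proof (rule measure_mono_fmeasurable[OF _ _ D(3)])
    show "(\<Union>K\<in>D. interior K) \<subseteq> U" using D(2) interior_subset by blast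
    show "(\<Union>K\<in>D. interior K) \<in> sets lebesgue"
      by (rule sets_completionI_sets) (auto intro!: borel_open)
  qed
  finally show ?thesis .
qed

text \<open>The gauge has two regimes. At points of differentiability it is so fine that the tangent
  approximates f up to \<open>e'\<close> times the length. At tags in \<open>N\<close> it confines
  the interval to an open set of measure below \<delta>, so absolute continuity bounds the total
  increment there. Integrability of the derivative comes out as a result.\<close>

lemma has_integral_derivative_of_abs_continuous:
  fixes f :: "real \<Rightarrow> real"
  assumes ac: "abs_continuous_on_interval a b f" and "a \<le> b" and N: "negligible N"
    and f': "\<And>t. t \<in> {a..b} - N \<Longrightarrow> (f has_real_derivative f' t) (at t)"
  shows "(f' has_integral f b - f a) {a..b}"
proof -
  \<comment> \<open>With the value 0 on \<open>N\<close>, tags in \<open>N\<close> contribute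
    nothing but increments of f; the change on a null set is undone at the end.\<close>
  define g where "g t = (if t \<in> N \<inter> {a..b} then 0 else f' t)" for t
  have "(g has_integral f b - f a) (cbox a b)"
    unfolding has_integral
  proof (intro allI impI)
    fix e :: real assume e: "e > 0"
    then have e2: "e / 2 > 0" by simp
    obtain \<delta> where \<delta>: "\<delta> > 0" and small:
      "\<And>D. D division_of \<Union>D \<Longrightarrow> \<Union>D \<subseteq> {a..b} \<Longrightarrow> (\<Sum>K\<in>D. Sup K - Inf K) < \<delta> \<Longrightarrow>
         (\<Sum>K\<in>D. norm (f (Sup K) - f (Inf K))) < e / 2"
      using abs_continuous_division[OF ac e2] by blast
    have N': "negligible (N \<inter> {a..b})" using N negligible_subset by blast
    then obtain U where U: "open U" "N \<inter> {a..b} \<subseteq> U" "U - (N \<inter> {a..b}) \<in> lmeasurable"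
      "emeasure lebesgue (U - (N \<inter> {a..b})) < ennreal \<delta>"
      using sets_lebesgue_outer_open[of "N \<inter> {a..b}" \<delta>] \<delta> negligible_imp_sets by blast
    have UN: "U = (U - (N \<inter> {a..b})) \<union> (N \<inter> {a..b})" using U(2) by blast
    have Um: "U \<in> lmeasurable"
      using fmeasurable.Un[OF U(3) negligible_imp_measurable[OF N']] UN by simp
    have "measure lebesgue (U - (N \<inter> {a..b})) = measure lebesgue U"
      by (rule measure_negligible_symdiff[OF Um]) (rule negligible_subset[OF N'], auto)
    moreover have "measure lebesgue (U - (N \<inter> {a..b})) < \<delta>"
      using U(3,4) \<delta> by (simp add: emeasure_eq_measure2 ennreal_less_iff)
    ultimately have mU: "measure lebesgue U < \<delta>" by simp
    \<comment> \<open>The summand 1 covers the case a = b.\<close>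
    define e' where "e' = e / (2 * (b - a) + 1)"
    have e': "e' > 0" "e' * (b - a) \<le> e / 2" using e \<open>a \<le> b\<close> by (auto simp: e'_def field_simps)
    have "\<exists>d>0. t \<in> {a..b} - N \<longrightarrow> (\<forall>y. norm (y - t) < d \<longrightarrow> norm (f y - f t - f' t * (y - t)) \<le> e' * norm (y - t))" for t
    proof (cases "t \<in> {a..b} - N")
      case True
      from f'[OF this] have "\<exists>d>0. \<forall>y. norm (y - t) < d \<longrightarrow> norm (f y - f t - f' t * (y - t)) \<le> e' * norm (y - t)"
        unfolding has_field_derivative_def has_derivative_at_alt using e' by blast
      then show ?thesis by blast
    qed (auto intro: exI[of _ 1])
    then obtain d where d: "\<And>t. d t > 0"
      "\<And>t y. t \<in> {a..b} - N \<Longrightarrow> norm (y - t) < d t \<Longrightarrow> norm (f y - f t - f' t * (y - t)) \<le> e' * norm (y - t)"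
      by metis
    define \<gamma> where "\<gamma> t = (if t \<in> N \<inter> {a..b} then U else ball t (d t))" for t
    have gau: "gauge \<gamma>" unfolding gauge_def \<gamma>_def using U d(1) by auto
    have fine_le: "norm ((\<Sum>(x, k)\<in>p. measure lborel k *\<^sub>R g x) - (f b - f a)) < e"
      if p: "p tagged_division_of cbox a b" "\<gamma> fine p" for p
    proof -
      have fin: "finite p" using p(1) by blast
      have p': "p tagged_division_of {a..b}" using p(1) by simp
      note pD = tagged_division_ofD[OF p']
      have int: "\<exists>u v. K = {u..v} \<and> u \<le> x \<and> x \<le> v" if "(x, K) \<in> p" for x K
        using pD(2,4)[OF that] by (metis atLeastAtMost_iff box_real(2))
      define \<Phi> where "\<Phi> = (\<lambda>(x, K). measure lborel K *\<^sub>R g x - (f (Sup K) - f (Inf K)))"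
      define A where "A = {z \<in> p. fst z \<in> N}"
      have Ap: "A \<subseteq> p" by (auto simp: A_def)
      have "(\<Sum>(x, k)\<in>p. measure lborel k *\<^sub>R g x) - (f b - f a) = (\<Sum>z\<in>p. \<Phi> z)"
        using additive_tagged_division_1[OF \<open>a \<le> b\<close> p', of f]
        by (simp add: \<Phi>_def split_beta sum_subtractf)
      also have "\<dots> = (\<Sum>z\<in>p - A. \<Phi> z) + (\<Sum>z\<in>A. \<Phi> z)" by (rule sum.subset_diff[OF Ap fin])
      also have "norm \<dots> \<le> norm (\<Sum>z\<in>p - A. \<Phi> z) + norm (\<Sum>z\<in>A. \<Phi> z)" by (rule norm_triangle_ineq)
      also have "norm (\<Sum>z\<in>p - A. \<Phi> z) \<le> (\<Sum>z\<in>p - A. e' * (Sup (snd z) - Inf (snd z)))"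
      proof (rule sum_norm_le)
        fix z assume z: "z \<in> p - A"
        obtain x K where xK: "z = (x, K)" by (cases z)
        then have K: "(x, K) \<in> p" "x \<notin> N" using z by (auto simp: A_def)
        obtain u v where uv: "K = {u..v}" "u \<le> x" "x \<le> v" using int[OF K(1)] by blast
        have xab: "x \<in> {a..b}" using pD(2,3)[OF K(1)] by blast
        have "K \<subseteq> ball x (d x)" using p(2) K by (force simp: fine_def \<gamma>_def)
        moreover have "u \<in> K" "v \<in> K" using uv by auto
        ultimately have "u \<in> ball x (d x)" "v \<in> ball x (d x)" by blast+
        then have "norm (u - x) < d x" "norm (v - x) < d x"
          by (simp_all only: mem_ball dist_norm norm_minus_commute)
        then have "norm (f u - f x - f' x * (u - x)) \<le> e' * norm (u - x)"
          "norm (f v - f x - f' x * (v - x)) \<le> e' * norm (v - x)"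
          using d(2)[of x] xab K(2) by auto
        then have "\<bar>(v - u) * f' x - (f v - f u)\<bar> \<le> e' * (v - u)"
          using uv by (simp add: algebra_simps abs_if split: if_splits)
        then show "norm (\<Phi> z) \<le> e' * (Sup (snd z) - Inf (snd z))"
          using uv K by (simp add: xK \<Phi>_def g_def)
      qed
      also have "\<dots> \<le> (\<Sum>z\<in>p. e' * (Sup (snd z) - Inf (snd z)))"
      proof (rule sum_mono2[OF fin])
        fix z assume z: "z \<in> p - (p - A)"
        obtain x K where xK: "z = (x, K)" by (cases z)
        then obtain u v where "K = {u..v}" "u \<le> x" "x \<le> v" using int[of x K] z by auto
        then show "0 \<le> e' * (Sup (snd z) - Inf (snd z))" using e' xK by simp
      qed auto
      also have "\<dots> = e' * (b - a)"
        using additive_tagged_division_1[OF \<open>a \<le> b\<close> p', of "\<lambda>x. x"]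
        by (simp add: split_beta flip: sum_distrib_left)
      also have "\<dots> \<le> e / 2" by (rule e')
      also have "norm (\<Sum>z\<in>A. \<Phi> z) \<le> (\<Sum>z\<in>A. norm (f (Sup (snd z)) - f (Inf (snd z))))"
      proof (rule sum_norm_le)
        fix z assume z: "z \<in> A"
        obtain x K where xK: "z = (x, K)" by (cases z)
        then have K: "(x, K) \<in> p" "x \<in> N" using z by (auto simp: A_def)
        have "x \<in> {a..b}" using pD(2,3)[OF K(1)] by blast
        then show "norm (\<Phi> z) \<le> norm (f (Sup (snd z)) - f (Inf (snd z)))"
          using K by (simp add: xK \<Phi>_def g_def abs_minus_commute)
      qed
      also have "(\<Sum>z\<in>A. norm (f (Sup (snd z)) - f (Inf (snd z)))) < e / 2"
      proof -
        have "A tagged_partial_division_of {a..b}"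
          using p' Ap tagged_partial_division_subset unfolding tagged_division_of_def by blast
        then have A: "A tagged_division_of \<Union>(snd ` A)" by (rule tagged_partial_division_of_Union_self)
        \<comment> \<open>Passing from tagged pairs to their intervals requires a function that
          vanishes on intervals with empty interior. \<open>Sup\<close> and \<open>Inf\<close> of
          the empty set are unspecified, hence the case distinction.\<close>
        define h where "h K = (if K = {} then 0 else norm (f (Sup K) - f (Inf K)))" for K
        have "(\<Sum>(x, K)\<in>A. norm (f (Sup K) - f (Inf K))) = (\<Sum>(x, K)\<in>A. h K)"
        proof (rule sum.cong[OF refl])
          fix z assume "z \<in> A"
          moreover obtain x K where xK: "z = (x, K)" by (cases z)
          ultimately have "K \<noteq> {}" using pD(2)[of x K] Ap by blast
          then show "(case z of (x, K) \<Rightarrow> norm (f (Sup K) - f (Inf K))) = (case z of (x, K) \<Rightarrow> h K)"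
            by (simp add: xK h_def)
        qed
        also have "\<dots> = (\<Sum>K\<in>snd ` A. h K)"
          by (rule sum.over_tagged_division_lemma[OF A]) (auto simp: h_def)
        also have "\<dots> \<le> (\<Sum>K\<in>snd ` A. norm (f (Sup K) - f (Inf K)))"
          by (rule sum_mono) (simp add: h_def)
        also have "\<dots> < e / 2"
        proof (rule small)
          show D: "snd ` A division_of \<Union>(snd ` A)" using division_of_tagged_division[OF A] .
          show "\<Union>(snd ` A) \<subseteq> {a..b}" using pD(3) Ap by force
          have "\<Union>(snd ` A) \<subseteq> U"
          proof
            fix t assume "t \<in> \<Union>(snd ` A)"
            then obtain x K where K: "(x, K) \<in> A" "t \<in> K" by auto
            then have "x \<in> N" "(x, K) \<in> p" by (auto simp: A_def)
            moreover from this have "x \<in> {a..b}" using pD(2,3) by blast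
            ultimately have "K \<subseteq> U" using p(2) by (force simp: fine_def \<gamma>_def)
            then show "t \<in> U" using K by blast
          qed
          then show "(\<Sum>K\<in>snd ` A. Sup K - Inf K) < \<delta>"
            using division_length_le_measure[OF D _ Um] mU by simp
        qed
        finally show ?thesis by (simp add: split_beta)
      qed
      finally show ?thesis by simp
    qed
    show "\<exists>\<gamma>. gauge \<gamma> \<and> (\<forall>\<D>. \<D> tagged_division_of cbox a b \<and> \<gamma> fine \<D> \<longrightarrow>
        norm ((\<Sum>(x, k)\<in>\<D>. measure lborel k *\<^sub>R g x) - (f b - f a)) < e)"
      by (intro exI[of _ \<gamma>] conjI allI impI gau, elim conjE) (rule fine_le)
  qed
  then have "(g has_integral f b - f a) {a..b}" by simp
  then show ?thesis
    by (rule has_integral_spike[OF N, rotated]) (auto simp: g_def)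
qed

lemma abs_continuous_vector_derivative_AE:
  fixes f :: "real \<Rightarrow> 'a::euclidean_space"
  assumes ac: "\<And>i. i \<in> Basis \<Longrightarrow> abs_continuous_on_interval a b (\<lambda>t. f t \<bullet> i)"
  shows "negligible {t \<in> {a..b}. \<not> (f has_vector_derivative vector_derivative f (at t)) (at t)}"
proof (rule negligible_subset)
  \<comment> \<open>The real-valued theorem covers the open interval only; the two end points join
    the exceptional set.\<close>
  show "negligible ((\<Union>i\<in>Basis. {t \<in> {a<..<b}. \<not> (\<lambda>t. f t \<bullet> i) differentiable (at t)}) \<union> {a, b})"
  proof (rule negligible_Un)
    show "negligible (\<Union>i\<in>Basis. {t \<in> {a<..<b}. \<not> (\<lambda>t. f t \<bullet> i) differentiable (at t)})"
    proof (rule negligible_Union)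
      fix S assume "S \<in> (\<lambda>i. {t \<in> {a<..<b}. \<not> (\<lambda>t. f t \<bullet> i) differentiable (at t)}) ` Basis"
      then obtain i where i: "i \<in> Basis" "S = {t \<in> {a<..<b}. \<not> (\<lambda>t. f t \<bullet> i) differentiable (at t)}" by blast
      show "negligible S" unfolding i(2) by (rule abs_continuous_imp_differentiable_AE[OF ac[OF i(1)]])
    qed simp
  qed simp
  show "{t \<in> {a..b}. \<not> (f has_vector_derivative vector_derivative f (at t)) (at t)}
     \<subseteq> (\<Union>i\<in>Basis. {t \<in> {a<..<b}. \<not> (\<lambda>t. f t \<bullet> i) differentiable (at t)}) \<union> {a, b}"
  proof
    fix t assume t: "t \<in> {t \<in> {a..b}. \<not> (f has_vector_derivative vector_derivative f (at t)) (at t)}"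
    then have "\<not> f differentiable (at t)" by (simp add: vector_derivative_works)
    then have "\<exists>i\<in>Basis. \<not> (\<lambda>t. f t \<bullet> i) differentiable (at t)"
      using differentiable_componentwise_within by blast
    then show "t \<in> (\<Union>i\<in>Basis. {t \<in> {a<..<b}. \<not> (\<lambda>t. f t \<bullet> i) differentiable (at t)}) \<union> {a, b}"
      using t by auto
  qed
qed

section \<open>Fractional integrals\<close>

text \<open>The substitution \<open>r = t s\<close> in the convolution puts the singularity of the kernel at a fixed
  place, so that continuity in \<open>t\<close> follows by dominated convergence.\<close>

definition RL_integral :: "real \<Rightarrow> (real \<Rightarrow> 'a::euclidean_space) \<Rightarrow> real \<Rightarrow> 'a" where
  "RL_integral a f t = (t powr a / Gamma a) *\<^sub>R (LINT s:{0..1}|lborel. (1 - s) powr (a - 1) *\<^sub>R f (t * s))"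

lemma Gamma_real_neq_0: "a > 0 \<Longrightarrow> Gamma (a :: real) \<noteq> 0"
  using Gamma_real_pos[of a] by linarith

lemma set_integrable_kernel_unit:
  assumes "a > (0::real)"
  shows "set_integrable lborel {0..1} (\<lambda>s. (1 - s) powr (a - 1))"
proof -
  have "set_integrable lborel {0..1} (\<lambda>s. s powr (1 - 1) * (1 - s) powr (a - 1))"
    using assms by (intro integrable_Beta) auto
  \<comment> \<open>\<open>0 powr 0\<close> is 0, so the factor \<open>s powr (1 - 1)\<close> equals
    1 except at s = 0.\<close>
  moreover have "AE s in lborel. s \<in> {0..1} \<longrightarrow> s powr (1 - 1) * (1 - s) powr (a - 1) = (1 - s) powr (a - 1)"
    using AE_lborel_singleton[of 0] by eventually_elim auto
  ultimately show ?thesis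
    by (subst (asm) set_integrable_cong_AE[where g = "\<lambda>s. (1 - s) powr (a - 1)"]) auto
qed

lemma set_lebesgue_integral_Beta:
  assumes "a > 0" "b > (0::real)"
  shows "(LINT s:{0..1}|lborel. s powr (a - 1) * (1 - s) powr (b - 1)) = Beta a b"
  using has_integral_Beta_real[OF assms] set_borel_integral_eq_integral(2)[OF integrable_Beta[OF assms]]
  by (simp add: has_integral_iff)

lemma continuous_on_scaled:
  assumes "continuous_on {0..t} f" "t \<ge> (0::real)"
  shows "continuous_on {0..1} (\<lambda>s. f (t * s))"
  by (rule continuous_on_compose2[OF assms(1)]) (use assms(2) in \<open>auto intro!: continuous_intros mult_left_le\<close>)

lemma set_integrable_kernel_mult:
  fixes h :: "real \<Rightarrow> 'a::euclidean_space"
  assumes "a > 0" and h: "continuous_on {0..1} h"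
  shows "set_integrable lborel {0..1} (\<lambda>s. (1 - s) powr (a - 1) *\<^sub>R h s)"
proof -
  have "bounded (h ` {0..1})" using compact_continuous_image[OF h] by (simp add: compact_imp_bounded)
  then obtain B where B: "\<And>s. s \<in> {0..1} \<Longrightarrow> norm (h s) \<le> B"
    unfolding bounded_iff ball_simps by blast
  have [measurable]: "set_borel_measurable lborel {0..1} h"
    using borel_measurable_continuous_on_indicator[OF _ h] by (simp add: set_borel_measurable_def)
  show ?thesis
    unfolding set_integrable_def
  proof (rule Bochner_Integration.integrable_bound)
    show "integrable lborel (\<lambda>s. B * (indicator {0..1} s *\<^sub>R (1 - s) powr (a - 1)))"
      using set_integrable_kernel_unit[OF \<open>a > 0\<close>] by (simp add: set_integrable_def)
    have "(\<lambda>s. (1 - s) powr (a - 1) *\<^sub>R (indicator {0..1} s *\<^sub>R h s)) \<in> borel_measurable lborel"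
      using \<open>set_borel_measurable lborel {0..1} h\<close> unfolding set_borel_measurable_def by measurable
    then show "(\<lambda>s. indicat_real {0..1} s *\<^sub>R (1 - s) powr (a - 1) *\<^sub>R h s) \<in> borel_measurable lborel"
      by (simp add: mult.commute)
    have "norm (indicat_real {0..1} s *\<^sub>R (1 - s) powr (a - 1) *\<^sub>R h s)
      \<le> norm (B * (indicator {0..1} s *\<^sub>R (1 - s) powr (a - 1)))" for s
      using mult_right_mono[OF order_trans[OF B abs_ge_self], of s "(1 - s) powr (a - 1)"]
      by (auto simp: indicator_def abs_mult mult.commute)
    then show "AE s in lborel. norm (indicat_real {0..1} s *\<^sub>R (1 - s) powr (a - 1) *\<^sub>R h s)
      \<le> norm (B * (indicator {0..1} s *\<^sub>R (1 - s) powr (a - 1)))" by simp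
  qed
qed

lemma RL_integral_integrable:
  fixes f :: "real \<Rightarrow> 'a::euclidean_space"
  assumes "a > 0" "t \<ge> 0" "continuous_on {0..t} f"
  shows "set_integrable lborel {0..1} (\<lambda>s. (1 - s) powr (a - 1) *\<^sub>R f (t * s))"
  using set_integrable_kernel_mult[OF assms(1) continuous_on_scaled[OF assms(3,2)]] .

lemma RL_integral_0 [simp]: "a > 0 \<Longrightarrow> RL_integral a f 0 = 0"
  by (simp add: RL_integral_def)

lemma RL_integral_diff:
  fixes f g :: "real \<Rightarrow> 'a::euclidean_space"
  assumes "a > 0" "t \<ge> 0" "continuous_on {0..t} f" "continuous_on {0..t} g"
  shows "RL_integral a (\<lambda>s. f s - g s) t = RL_integral a f t - RL_integral a g t"
  using RL_integral_integrable[OF assms(1,2,3)] RL_integral_integrable[OF assms(1,2,4)]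
  by (simp add: RL_integral_def scaleR_diff_right set_integral_diff)

lemma RL_integral_cmult:
  "RL_integral a (\<lambda>s. c *\<^sub>R f s) t = c *\<^sub>R RL_integral a f t"
proof -
  have "(\<lambda>s. (1 - s) powr (a - 1) *\<^sub>R c *\<^sub>R f (t * s)) = (\<lambda>s. c *\<^sub>R ((1 - s) powr (a - 1) *\<^sub>R f (t * s)))"
    by (simp add: mult.commute)
  then have "(LINT s:{0..1}|lborel. (1 - s) powr (a - 1) *\<^sub>R c *\<^sub>R f (t * s))
    = c *\<^sub>R (LINT s:{0..1}|lborel. (1 - s) powr (a - 1) *\<^sub>R f (t * s))"
    by (simp only: set_integral_scaleR_right)
  then show ?thesis by (simp add: RL_integral_def mult.commute)
qed

lemma RL_integral_inner:
  fixes f :: "real \<Rightarrow> 'a::euclidean_space"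
  assumes "a > 0" "t \<ge> 0" "continuous_on {0..t} f"
  shows "RL_integral a f t \<bullet> i = RL_integral a (\<lambda>s. f s \<bullet> i) t"
proof -
  have "(LINT s:{0..1}|lborel. (1 - s) powr (a - 1) *\<^sub>R f (t * s)) \<bullet> i =
    (LINT s:{0..1}|lborel. ((1 - s) powr (a - 1) *\<^sub>R f (t * s)) \<bullet> i)"
    using integral_inner_left[OF RL_integral_integrable[OF assms, unfolded set_integrable_def], of i]
    by (simp add: set_lebesgue_integral_def mult.assoc)
  then show ?thesis by (simp add: RL_integral_def)
qed

lemma RL_integral_mono:
  fixes f g :: "real \<Rightarrow> real"
  assumes "a > 0" "t \<ge> 0" "continuous_on {0..t} f" "continuous_on {0..t} g"
    and "\<And>s. 0 \<le> s \<Longrightarrow> s \<le> t \<Longrightarrow> f s \<le> g s"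
  shows "RL_integral a f t \<le> RL_integral a g t"
proof -
  have "(LINT s:{0..1}|lborel. (1 - s) powr (a - 1) *\<^sub>R f (t * s))
    \<le> (LINT s:{0..1}|lborel. (1 - s) powr (a - 1) *\<^sub>R g (t * s))"
    using assms by (intro set_integral_mono RL_integral_integrable)
      (auto intro!: mult_left_mono assms(5) mult_left_le)
  then show ?thesis using assms(1)
    unfolding RL_integral_def by (intro scaleR_left_mono) (auto intro: Gamma_real_nonneg)
qed

lemma RL_integral_norm_le:
  fixes f :: "real \<Rightarrow> 'a::euclidean_space"
  assumes "a > 0" "t \<ge> 0" "continuous_on {0..t} f" "continuous_on {0..t} g"
    and "\<And>s. 0 \<le> s \<Longrightarrow> s \<le> t \<Longrightarrow> norm (f s) \<le> g s"
  shows "norm (RL_integral a f t) \<le> RL_integral a g t"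
proof -
  have "norm (LINT s:{0..1}|lborel. (1 - s) powr (a - 1) *\<^sub>R f (t * s))
    \<le> (LINT s:{0..1}|lborel. norm ((1 - s) powr (a - 1) *\<^sub>R f (t * s)))"
    using RL_integral_integrable[OF assms(1-3)] by (intro set_integral_norm_bound)
  also have "\<dots> = (LINT s:{0..1}|lborel. (1 - s) powr (a - 1) *\<^sub>R norm (f (t * s)))" by simp
  finally have "norm (RL_integral a f t) \<le> RL_integral a (\<lambda>s. norm (f s)) t"
    using assms(1) Gamma_real_pos[of a]
    by (simp add: RL_integral_def divide_right_mono mult_left_mono)
  also have "\<dots> \<le> RL_integral a g t"
    by (rule RL_integral_mono) (use assms in \<open>auto intro: continuous_on_norm\<close>)
  finally show ?thesis .
qed

lemma RL_integral_powr:
  assumes "a > 0" "b \<ge> 0" "t \<ge> 0"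
  shows "RL_integral a (\<lambda>s. s powr b) t = Gamma (b + 1) / Gamma (a + b + 1) * t powr (a + b)"
proof -
  have "(LINT s:{0..1}|lborel. (1 - s) powr (a - 1) *\<^sub>R (t * s) powr b)
     = (LINT s:{0..1}|lborel. t powr b * (s powr (b + 1 - 1) * (1 - s) powr (a - 1)))"
    using assms by (intro set_lebesgue_integral_cong) (auto simp: powr_mult)
  also have "\<dots> = t powr b * Beta (b + 1) a"
    using set_lebesgue_integral_Beta[of "b + 1" a] assms by simp
  finally show ?thesis using assms Gamma_real_pos[OF assms(1)]
    by (simp add: RL_integral_def Beta_def powr_add add_ac less_imp_neq[symmetric])
qed

text \<open>Stated separately from the power rule because \<open>s powr 0\<close> is not the
  constant 1: it is 0 at s = 0.\<close>

lemma RL_integral_const: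
  assumes "a > 0" "t \<ge> 0"
  shows "RL_integral a (\<lambda>s. c :: real) t = c * t powr a / Gamma (a + 1)"
proof -
  have "(LINT s:{0..1}|lborel. (1 - s) powr (a - 1) *\<^sub>R c)
     = (LINT s:{0..1}|lborel. c * (s powr (1 - 1) * (1 - s) powr (a - 1)))"
  proof (rule set_lebesgue_integral_cong_AE)
    show "AE s\<in>{0..1} in lborel. (1 - s) powr (a - 1) *\<^sub>R c = c * (s powr (1 - 1) * (1 - s) powr (a - 1))"
      using AE_lborel_singleton[of "0::real"] by eventually_elim auto
  qed auto
  also have "\<dots> = c * Beta 1 a"
    using set_lebesgue_integral_Beta[of 1 a] assms by simp
  finally show ?thesis using assms Gamma_real_pos[OF assms(1)]
    by (simp add: RL_integral_def Beta_def add_ac less_imp_neq[symmetric])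
qed

lemma RL_integral_rescale:
  "\<kappa> > 0 \<Longrightarrow> t \<ge> 0 \<Longrightarrow> RL_integral a f (\<kappa> * t) = (\<kappa> powr a) *\<^sub>R RL_integral a (\<lambda>s. f (\<kappa> * s)) t"
  by (simp add: RL_integral_def powr_mult mult.assoc)

lemma continuous_on_RL_integral:
  fixes f :: "real \<Rightarrow> 'a::euclidean_space"
  assumes "a > 0" and f: "continuous_on {0..} f"
  shows "continuous_on {0..} (RL_integral a f)"
proof -
  have "continuous_on {0..} (\<lambda>t. LINT s:{0..1}|lborel. (1 - s) powr (a - 1) *\<^sub>R f (t * s))"
    unfolding continuous_on_sequentially
  proof (intro ballI allI impI, elim conjE)
    fix t :: real and X :: "nat \<Rightarrow> real"
    assume t: "t \<in> {0..}" and X: "\<forall>n. X n \<in> {0..}" "X \<longlonglongrightarrow> t"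
    obtain R where R: "R > 0" "\<And>n. X n \<le> R"
      using convergent_imp_Bseq[OF convergentI[OF X(2)]] by (auto simp: Bseq_def abs_le_iff)
    have tR: "t \<le> R" using LIMSEQ_le_const2[OF X(2)] R(2) by blast
    have "bounded (f ` {0..R})"
      using compact_continuous_image[OF continuous_on_subset[OF f]] by (simp add: compact_imp_bounded)
    then obtain B where B: "\<And>s. s \<in> {0..R} \<Longrightarrow> norm (f s) \<le> B"
      unfolding bounded_iff ball_simps by blast
    have in01: "r * s \<in> {0..R}" if "r \<in> {0..R}" "s \<in> {0..1}" for r s
      using that mult_left_le[of s r] by auto
    have meas: "(\<lambda>s. indicat_real {0..1} s *\<^sub>R ((1 - s) powr (a - 1) *\<^sub>R f (r * s))) \<in> borel_measurable lborel"
      if "r \<ge> 0" for r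
      using RL_integral_integrable[OF \<open>a > 0\<close> that continuous_on_subset[OF f]]
      by (simp add: set_integrable_def borel_measurable_integrable)
    show "(((\<lambda>t. LINT s:{0..1}|lborel. (1 - s) powr (a - 1) *\<^sub>R f (t * s)) \<circ> X) \<longlongrightarrow>
        (LINT s:{0..1}|lborel. (1 - s) powr (a - 1) *\<^sub>R f (t * s))) sequentially"
      unfolding comp_def set_lebesgue_integral_def
    proof (rule integral_dominated_convergence)
      show "integrable lborel (\<lambda>s. B * (indicator {0..1} s *\<^sub>R (1 - s) powr (a - 1)))"
        using set_integrable_kernel_unit[OF \<open>a > 0\<close>] by (simp add: set_integrable_def)
      show "AE s in lborel. (\<lambda>n. indicat_real {0..1} s *\<^sub>R (1 - s) powr (a - 1) *\<^sub>R f (X n * s))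
        \<longlonglongrightarrow> indicat_real {0..1} s *\<^sub>R (1 - s) powr (a - 1) *\<^sub>R f (t * s)"
      proof (rule AE_I2)
        fix s :: real
        show "(\<lambda>n. indicat_real {0..1} s *\<^sub>R (1 - s) powr (a - 1) *\<^sub>R f (X n * s))
          \<longlonglongrightarrow> indicat_real {0..1} s *\<^sub>R (1 - s) powr (a - 1) *\<^sub>R f (t * s)"
        proof (cases "s \<in> {0..1}")
          case True
          have "(\<lambda>n. f (X n * s)) \<longlonglongrightarrow> f (t * s)"
            using True X t by (intro continuous_on_tendsto_compose[OF f] tendsto_intros) auto
          then show ?thesis by (intro tendsto_intros)
        qed simp
      qed
      fix n
      have "norm (indicat_real {0..1} s *\<^sub>R (1 - s) powr (a - 1) *\<^sub>R f (X n * s))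
        \<le> B * (indicator {0..1} s *\<^sub>R (1 - s) powr (a - 1))" for s
        using mult_right_mono[OF B[OF in01[of "X n" s]], of "(1 - s) powr (a - 1)"] X R(2)
        by (auto simp: indicator_def mult.commute)
      then show "AE s in lborel. norm (indicat_real {0..1} s *\<^sub>R (1 - s) powr (a - 1) *\<^sub>R f (X n * s))
        \<le> B * (indicator {0..1} s *\<^sub>R (1 - s) powr (a - 1))" by simp
    qed (use meas t X in auto)
  qed
  then show ?thesis
    unfolding RL_integral_def using \<open>a > 0\<close> Gamma_real_neq_0[OF \<open>a > 0\<close>]
    by (intro continuous_on_scaleR continuous_on_divide continuous_on_powr' continuous_on_const continuous_on_id) auto
qed

lemma set_integrable_Gamma:
  assumes "a > (0::real)"
  shows "set_integrable lborel {0..} (\<lambda>u. u powr (a - 1) / exp u)"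
proof -
  have "set_integrable lebesgue {0..} (\<lambda>u. u powr (a - 1) / exp u)"
    using Gamma_integral_real[OF assms] by (intro nonnegative_absolutely_integrable_1) (auto simp: integrable_on_def)
  then show ?thesis
    unfolding set_integrable_def by (subst (asm) integrable_completion) auto
qed

text \<open>The bound behind the weighted norm \<open>sup e\<^bsup>-wt\<^esup> |x(t)|\<close>, in which the fractional integral
  is a contraction for large \<open>w\<close>.\<close>

lemma RL_integral_exp_le:
  assumes "a > 0" "w > 0" "t \<ge> 0"
  shows "RL_integral a (\<lambda>s. exp (w * s)) t \<le> w powr (- a) * exp (w * t)"
proof (cases "t = 0")
  case False
  then have t: "t > 0" using assms by simp
  define c where "c = w * t"
  have c: "c > 0" using assms t by (simp add: c_def)
  have "(LINT s:{0..1}|lborel. (1 - s) powr (a - 1) *\<^sub>R exp (c * s))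
      = (\<integral>s. indicat_real {0..1} s *\<^sub>R ((1 - s) powr (a - 1) *\<^sub>R exp (c * s)) \<partial>lborel)"
    by (simp add: set_lebesgue_integral_def)
  \<comment> \<open>The substitution s = 1 - u / c moves the singularity to u = 0 and produces the
    integrand of the Gamma integral, cut off at c.\<close>
  also have "\<dots> = \<bar>- (1 / c)\<bar> *\<^sub>R (\<integral>u. indicat_real {0..1} (1 + (- (1 / c)) * u) *\<^sub>R
      ((1 - (1 + (- (1 / c)) * u)) powr (a - 1) *\<^sub>R exp (c * (1 + (- (1 / c)) * u))) \<partial>lborel)"
    by (rule lborel_integral_real_affine) (use c in auto)
  also have "(\<integral>u. indicat_real {0..1} (1 + (- (1 / c)) * u) *\<^sub>R
      ((1 - (1 + (- (1 / c)) * u)) powr (a - 1) *\<^sub>R exp (c * (1 + (- (1 / c)) * u))) \<partial>lborel)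
    = (\<integral>u. (c powr (1 - a) * exp c) * (indicat_real {0..c} u * (u powr (a - 1) / exp u)) \<partial>lborel)"
  proof (rule Bochner_Integration.integral_cong[OF refl])
    fix u :: real
    have "1 + (- (1 / c)) * u \<in> {0..1} \<longleftrightarrow> u \<in> {0..c}" using c by (auto simp: field_simps)
    moreover have "(u / c) powr (a - 1) = c powr (1 - a) * u powr (a - 1)" if "u \<ge> 0"
      using that c by (simp add: powr_divide powr_diff)
    moreover have "c * (1 + (- (1 / c)) * u) = c - u" using c by (simp add: field_simps)
    ultimately show "indicat_real {0..1} (1 + (- (1 / c)) * u) *\<^sub>R
      ((1 - (1 + (- (1 / c)) * u)) powr (a - 1) *\<^sub>R exp (c * (1 + (- (1 / c)) * u)))
      = (c powr (1 - a) * exp c) * (indicat_real {0..c} u * (u powr (a - 1) / exp u))"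
      by (auto simp: indicator_def exp_diff)
  qed
  also have "\<dots> = (c powr (1 - a) * exp c) * (LINT u:{0..c}|lborel. u powr (a - 1) / exp u)"
    by (simp only: set_lebesgue_integral_def integral_mult_right_zero real_scaleR_def)
  also have "(LINT u:{0..c}|lborel. u powr (a - 1) / exp u) \<le> (LINT u:{0..}|lborel. u powr (a - 1) / exp u)"
    unfolding set_lebesgue_integral_def
    by (rule integral_mono)
      (use set_integrable_Gamma[OF \<open>a > 0\<close>] set_integrable_subset[OF set_integrable_Gamma[OF \<open>a > 0\<close>], of "{0..c}"]
       in \<open>auto simp: set_integrable_def indicator_def\<close>)
  also have "(LINT u:{0..}|lborel. u powr (a - 1) / exp u) = Gamma a"
    using Gamma_integral_real[OF \<open>a > 0\<close>] set_borel_integral_eq_integral(2)[OF set_integrable_Gamma[OF \<open>a > 0\<close>]]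
    by (simp add: has_integral_iff)
  finally have *: "(LINT s:{0..1}|lborel. (1 - s) powr (a - 1) *\<^sub>R exp (c * s))
      \<le> \<bar>- (1 / c)\<bar> * (c powr (1 - a) * exp c * Gamma a)"
    using c by (simp add: mult_left_mono divide_right_mono)
  have "\<bar>- (1 / c)\<bar> * (c powr (1 - a) * exp c * Gamma a) = c powr (- a) * exp c * Gamma a"
    using c by (simp add: powr_diff powr_minus field_simps)
  with * have "(LINT s:{0..1}|lborel. (1 - s) powr (a - 1) *\<^sub>R exp (c * s)) \<le> c powr (- a) * exp c * Gamma a"
    by simp
  then have "t powr a / Gamma a * (LINT s:{0..1}|lborel. (1 - s) powr (a - 1) *\<^sub>R exp (c * s))
      \<le> t powr a / Gamma a * (c powr (- a) * exp c * Gamma a)"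
    using Gamma_real_pos[OF \<open>a > 0\<close>] by (intro mult_left_mono) auto
  also have "\<dots> = (t powr a * t powr (- a)) * w powr (- a) * exp c"
    using Gamma_real_neq_0[OF \<open>a > 0\<close>] assms t by (simp add: c_def powr_mult)
  also have "t powr a * t powr (- a) = 1" using t by (simp add: powr_minus)
  finally show ?thesis by (simp add: RL_integral_def c_def mult.assoc)
qed (use assms in auto)

section \<open>Volterra equations\<close>

lemma RL_weight_exists:
  assumes "a > 0" "L \<ge> (0::real)"
  obtains w where "w > 0" "L * w powr (- a) \<le> 1 / 2"
proof
  \<comment> \<open>With this weight \<open>L * w powr (- a)\<close> is L / (2 L + 1); the summand 1
    keeps the weight positive when L = 0.\<close>
  show "(2 * L + 1) powr (1 / a) > 0" using assms by simp
  have *: "((2 * L + 1) powr (1 / a)) powr (- a) = 1 / (2 * L + 1)"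
    using assms by (simp add: powr_powr powr_minus_divide)
  then show "L * ((2 * L + 1) powr (1 / a)) powr (- a) \<le> 1 / 2"
    unfolding * using assms by (simp add: field_simps)
qed

lemma RL_integral_exp_bound:
  assumes "a > 0" "w > 0" "t \<ge> 0" "M \<ge> 0" and f: "continuous_on {0..t} f"
    and le: "\<And>s. 0 \<le> s \<Longrightarrow> s \<le> t \<Longrightarrow> norm (f s) \<le> M * exp (w * s)"
  shows "norm (RL_integral a f t :: 'a::euclidean_space) \<le> M * (w powr (- a) * exp (w * t))"
proof -
  have "norm (RL_integral a f t) \<le> RL_integral a (\<lambda>s. M * exp (w * s)) t"
    by (rule RL_integral_norm_le) (use assms in \<open>auto intro!: continuous_intros\<close>)
  also have "\<dots> = M * RL_integral a (\<lambda>s. exp (w * s)) t"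
    using RL_integral_cmult[of a M "\<lambda>s. exp (w * s)" t] by simp
  also have "\<dots> \<le> M * (w powr (- a) * exp (w * t))"
    using assms by (intro mult_left_mono RL_integral_exp_le) auto
  finally show ?thesis .
qed

text \<open>At the point where \<open>exp (- (w * s)) * d s\<close> is largest, the choice of w
  makes the integral term at most half of d, so it can be absorbed into the left-hand side.\<close>

lemma RL_integral_Gronwall:
  fixes d :: "real \<Rightarrow> real"
  assumes "a > 0" "L \<ge> 0" "A \<ge> 0" and w: "w > 0" "L * w powr (- a) \<le> 1 / 2"
    and d: "continuous_on {0..T} d" "\<And>t. 0 \<le> t \<Longrightarrow> t \<le> T \<Longrightarrow> 0 \<le> d t"
    and le: "\<And>t. 0 \<le> t \<Longrightarrow> t \<le> T \<Longrightarrow> d t \<le> A + L * RL_integral a d t"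
    and t: "0 \<le> t" "t \<le> T"
  shows "d t \<le> 2 * A * exp (w * T)"
proof -
  have "continuous_on {0..T} (\<lambda>s. exp (- (w * s)) * d s)" by (intro continuous_intros d)
  then obtain r where r: "r \<in> {0..T}" "\<And>s. s \<in> {0..T} \<Longrightarrow> exp (- (w * s)) * d s \<le> exp (- (w * r)) * d r"
    using continuous_attains_sup[of "{0..T}" "\<lambda>s. exp (- (w * s)) * d s"] t by (auto simp: Ball_def)
  define M where "M = exp (- (w * r)) * d r"
  have M0: "M \<ge> 0" using d(2) r(1) by (simp add: M_def)
  have dM: "d s \<le> M * exp (w * s)" if "0 \<le> s" "s \<le> T" for s
  proof -
    have "d s = exp (w * s) * (exp (- (w * s)) * d s)" by (simp add: exp_minus)
    also have "\<dots> \<le> exp (w * s) * M"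
      using r(2)[of s] that by (intro mult_left_mono) (auto simp: M_def)
    finally show ?thesis by (simp add: mult.commute)
  qed
  have r0: "0 \<le> r" "r \<le> T" using r(1) by auto
  have "RL_integral a d r \<le> norm (RL_integral a d r)" by simp
  also have "\<dots> \<le> M * (w powr (- a) * exp (w * r))"
  proof (rule RL_integral_exp_bound[OF \<open>a > 0\<close> w(1) r0(1) M0])
    show "continuous_on {0..r} d" using continuous_on_subset[OF d(1)] r0 by auto
  qed (use d(2) dM r0 in auto)
  finally have "L * RL_integral a d r \<le> L * (M * (w powr (- a) * exp (w * r)))"
    using \<open>L \<ge> 0\<close> by (rule mult_left_mono)
  also have "\<dots> = (L * w powr (- a)) * (M * exp (w * r))" by simp
  also have "\<dots> \<le> (1 / 2) * (M * exp (w * r))" using w(2) M0 by (intro mult_right_mono) auto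
  finally have "d r \<le> A + (1 / 2) * (M * exp (w * r))" using le[OF r0] by linarith
  also have "M * exp (w * r) = d r" by (simp add: M_def exp_minus)
  finally have "d r \<le> 2 * A" by simp
  moreover have "M \<le> d r" unfolding M_def using d(2)[OF r0] w(1) r0 by (intro mult_left_le_one_le) auto
  ultimately have "M \<le> 2 * A" by simp
  have "d t \<le> M * exp (w * t)" by (rule dM[OF t])
  also have "\<dots> \<le> 2 * A * exp (w * T)"
    using \<open>M \<le> 2 * A\<close> M0 w t by (intro mult_mono) auto
  finally show ?thesis .
qed

theorem Volterra_solution_exists:
  fixes F :: "'a::euclidean_space \<Rightarrow> 'a"
  assumes "a > 0" and F: "L-lipschitz_on UNIV F"
  obtains x where "continuous_on {0..} x" "\<And>t. t \<ge> 0 \<Longrightarrow> x t = x0 + RL_integral a (\<lambda>s. F (x s)) t"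
proof -
  have L: "L \<ge> 0" using F by (rule lipschitz_on_nonneg)
  obtain w where w: "w > 0" "L * w powr (- a) \<le> 1 / 2" using RL_weight_exists[OF \<open>a > 0\<close> L] by blast
  have Fc: "continuous_on UNIV F" using F by (rule lipschitz_on_continuous_on)
  have FL: "norm (F u - F v) \<le> L * norm (u - v)" for u v
    using lipschitz_onD[OF F, of u v] by (simp add: dist_norm)
  \<comment> \<open>A bounded continuous v encodes the function e^(wt) v(t), so that the supremum
    norm of v is the weighted norm of that function.\<close>
  define f where "f v = (\<lambda>s. F (exp (w * s) *\<^sub>R apply_bcontfun v s))" for v
  have vc: "continuous_on A (apply_bcontfun v)" for v :: "real \<Rightarrow>\<^sub>C 'a" and A
    by (rule continuous_on_apply_bcontfun)
  have fc: "continuous_on A (f v)" for v A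
    unfolding f_def by (intro continuous_on_compose2[OF Fc] continuous_intros vc) auto
  \<comment> \<open>Bounded continuous functions live on the whole line here; \<open>max 0 t\<close>
    extends the image constantly to negative times.\<close>
  define \<Phi> where "\<Phi> v t = exp (- (w * max 0 t)) *\<^sub>R (x0 + RL_integral a (f v) (max 0 t))" for v t
  have \<Phi>: "\<Phi> v \<in> bcontfun" for v
  proof -
    have "continuous_on UNIV (\<Phi> v)"
      unfolding \<Phi>_def
      by (intro continuous_intros continuous_on_compose2[OF continuous_on_RL_integral[OF \<open>a > 0\<close> fc]]) auto
    moreover have "norm (\<Phi> v t) \<le> norm x0 + (norm (F 0) + L * norm v) * w powr (- a)" for t
    proof -
      define \<tau> where "\<tau> = max 0 t"
      have \<tau>: "\<tau> \<ge> 0" by (simp add: \<tau>_def)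
      have "norm (RL_integral a (f v) \<tau>) \<le> (norm (F 0) + L * norm v) * (w powr (- a) * exp (w * \<tau>))"
      proof (rule RL_integral_exp_bound[OF \<open>a > 0\<close> w(1) \<tau> _ fc])
        fix s :: real assume s: "0 \<le> s" "s \<le> \<tau>"
        have "norm (f v s) \<le> norm (F 0) + norm (F (exp (w * s) *\<^sub>R v s) - F 0)"
          unfolding f_def using norm_triangle_sub[of "F (exp (w * s) *\<^sub>R v s)" "F 0"] by simp
        also have "\<dots> \<le> norm (F 0) + L * (exp (w * s) * norm (v s))"
          using FL[of "exp (w * s) *\<^sub>R v s" 0] by simp
        also have "\<dots> \<le> norm (F 0) * exp (w * s) + L * (exp (w * s) * norm v)"
          using s w L norm_bounded[of v s]
          by (intro add_mono mult_left_mono) (auto simp: mult_le_cancel_left1)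
        finally show "norm (f v s) \<le> (norm (F 0) + L * norm v) * exp (w * s)" by (simp add: algebra_simps)
      qed (use L in simp)
      then have "norm x0 + norm (RL_integral a (f v) \<tau>)
        \<le> exp (w * \<tau>) * norm x0 + (norm (F 0) + L * norm v) * (w powr (- a) * exp (w * \<tau>))"
        using \<tau> w by (intro add_mono) (auto simp: mult_le_cancel_right1)
      then have "norm (x0 + RL_integral a (f v) \<tau>)
        \<le> exp (w * \<tau>) * (norm x0 + (norm (F 0) + L * norm v) * w powr (- a))"
        using norm_triangle_ineq[of x0 "RL_integral a (f v) \<tau>"] by (simp add: algebra_simps)
      then have "exp (- (w * \<tau>)) * norm (x0 + RL_integral a (f v) \<tau>)
        \<le> exp (- (w * \<tau>)) * (exp (w * \<tau>) * (norm x0 + (norm (F 0) + L * norm v) * w powr (- a)))"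
        by (rule mult_left_mono) simp
      also have "\<dots> = norm x0 + (norm (F 0) + L * norm v) * w powr (- a)" by (simp add: exp_minus)
      finally show ?thesis by (simp add: \<Phi>_def \<tau>_def[symmetric])
    qed
    ultimately show ?thesis by (auto simp: bcontfun_def bounded_iff)
  qed
  define \<Psi> where "\<Psi> v = Bcontfun (\<Phi> v)" for v
  have \<Psi>: "apply_bcontfun (\<Psi> v) = \<Phi> v" for v using \<Phi> by (simp add: \<Psi>_def Bcontfun_inverse)
  have "dist (\<Psi> u) (\<Psi> v) \<le> 1 / 2 * dist u v" for u v
  proof (rule dist_bound)
    fix t :: real
    define \<tau> where "\<tau> = max 0 t"
    have \<tau>: "\<tau> \<ge> 0" by (simp add: \<tau>_def)
    have "norm (RL_integral a (\<lambda>s. f u s - f v s) \<tau>) \<le> (L * dist u v) * (w powr (- a) * exp (w * \<tau>))"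
    proof (rule RL_integral_exp_bound[OF \<open>a > 0\<close> w(1) \<tau>])
      fix s :: real assume s: "0 \<le> s" "s \<le> \<tau>"
      have "norm (f u s - f v s) \<le> L * (exp (w * s) * norm (u s - v s))"
        unfolding f_def using FL[of "exp (w * s) *\<^sub>R u s" "exp (w * s) *\<^sub>R v s"]
        by (simp add: scaleR_diff_right[symmetric])
      also have "\<dots> \<le> L * (exp (w * s) * dist u v)"
        using dist_bounded[of u s v] L by (intro mult_left_mono) (auto simp: dist_norm)
      finally show "norm (f u s - f v s) \<le> L * dist u v * exp (w * s)" by (simp add: mult_ac)
    qed (use L in \<open>auto intro!: continuous_intros fc\<close>)
    also have "\<dots> = (L * w powr (- a)) * dist u v * exp (w * \<tau>)" by simp
    also have "\<dots> \<le> 1 / 2 * dist u v * exp (w * \<tau>)" using w by (intro mult_right_mono) auto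
    finally have *: "norm (RL_integral a (f u) \<tau> - RL_integral a (f v) \<tau>) \<le> 1 / 2 * dist u v * exp (w * \<tau>)"
      using RL_integral_diff[OF \<open>a > 0\<close> \<tau> fc fc] by simp
    have "dist (\<Psi> u t) (\<Psi> v t) = exp (- (w * \<tau>)) * norm (RL_integral a (f u) \<tau> - RL_integral a (f v) \<tau>)"
      by (simp add: \<Psi> \<Phi>_def \<tau>_def[symmetric] dist_norm scaleR_diff_right[symmetric])
    also have "\<dots> \<le> exp (- (w * \<tau>)) * (1 / 2 * dist u v * exp (w * \<tau>))" by (intro mult_left_mono *) auto
    also have "\<dots> = 1 / 2 * dist u v" by (simp add: exp_minus)
    finally show "dist (\<Psi> u t) (\<Psi> v t) \<le> 1 / 2 * dist u v" .
  qed
  then obtain v where v: "\<Psi> v = v" using banach_fix_type[of "1 / 2" \<Psi>] by auto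
  show thesis
  proof
    show "continuous_on {0..} (\<lambda>t. exp (w * t) *\<^sub>R v t)" by (intro continuous_intros vc)
    fix t :: real assume t: "t \<ge> 0"
    have "v t = exp (- (w * t)) *\<^sub>R (x0 + RL_integral a (f v) t)"
      using \<Psi>[of v] v t by (simp add: \<Phi>_def)
    then show "exp (w * t) *\<^sub>R v t = x0 + RL_integral a (\<lambda>s. F (exp (w * s) *\<^sub>R v s)) t"
      by (simp add: f_def exp_minus)
  qed
qed

text \<open>Comparing the solution with its own time dilation \<open>t \<mapsto> x (\<kappa> t)\<close>, instead of a
  translate, turns the regularity estimate into an application of Gronwall's inequality.\<close>

theorem Volterra_solution_increment:
  fixes F :: "'a::euclidean_space \<Rightarrow> 'a"
  assumes "a > 0" and F: "L-lipschitz_on UNIV F" and x: "continuous_on {0..} x"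
    and sol: "\<And>t. t \<ge> 0 \<Longrightarrow> x t = x0 + RL_integral a (\<lambda>s. F (x s)) t"
  obtains C where "C \<ge> 0" "\<And>u v. 0 \<le> u \<Longrightarrow> u \<le> v \<Longrightarrow> v \<le> T \<Longrightarrow> norm (x v - x u) \<le> C * (v powr a - u powr a)"
proof (cases "T \<ge> 0")
  case T: True
  have L: "L \<ge> 0" using F by (rule lipschitz_on_nonneg)
  obtain w where w: "w > 0" "L * w powr (- a) \<le> 1 / 2" using RL_weight_exists[OF \<open>a > 0\<close> L] by blast
  have Fc: "continuous_on UNIV F" using F by (rule lipschitz_on_continuous_on)
  have FL: "norm (F u - F v) \<le> L * norm (u - v)" for u v
    using lipschitz_onD[OF F, of u v] by (simp add: dist_norm)
  have Fx: "continuous_on {0..} (\<lambda>s. F (x s))" by (intro continuous_on_compose2[OF Fc x]) auto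
  have "bounded ((\<lambda>s. F (x s)) ` {0..T})"
    using compact_continuous_image[OF continuous_on_subset[OF Fx]] by (simp add: compact_imp_bounded)
  then obtain S0 where S0: "\<And>s. s \<in> {0..T} \<Longrightarrow> norm (F (x s)) \<le> S0"
    unfolding bounded_iff ball_simps by blast
  have S00: "S0 \<ge> 0" using order_trans[OF norm_ge_zero S0, of 0] T by auto
  define G where "G = Gamma (a + 1)"
  have G: "G > 0" using \<open>a > 0\<close> by (simp add: G_def)
  \<comment> \<open>The Gronwall bound for the difference between the solution and its dilation,
    with the small factor \<open>K\<close> taken out; it does not depend on u and v.\<close>
  define C2 where "C2 = 2 * (S0 * T powr a / G) * exp (w * T)"
  have C2: "C2 \<ge> 0" using S00 G by (simp add: C2_def)
  define C where "C = (S0 + L * C2) / G"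
  have C: "C \<ge> 0" using S00 G L C2 by (simp add: C_def)
  have "norm (x v - x u) \<le> C * (v powr a - u powr a)" if uv: "0 \<le> u" "u \<le> v" "v \<le> T" for u v
  proof (cases "u = 0")
    case True
    have "norm (x v - x u) = norm (RL_integral a (\<lambda>s. F (x s)) v)"
      using sol[of v] sol[of u] uv True \<open>a > 0\<close> by simp
    also have "\<dots> \<le> RL_integral a (\<lambda>s. S0) v"
      using uv S0 by (intro RL_integral_norm_le[OF \<open>a > 0\<close>] continuous_on_subset[OF Fx]) auto
    also have "\<dots> = S0 / G * v powr a" using RL_integral_const[OF \<open>a > 0\<close>, of v S0] uv by (simp add: G_def)
    also have "\<dots> \<le> C * v powr a" using L C2 G by (intro mult_right_mono) (auto simp: C_def divide_right_mono)
    finally show ?thesis using True by simp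
  next
    case False
    then have u: "u > 0" using uv by simp
    define \<kappa> where "\<kappa> = v / u"
    have \<kappa>: "\<kappa> \<ge> 1" "\<kappa> * u = v" using u uv by (auto simp: \<kappa>_def)
    \<comment> \<open>Up to this time the dilated argument stays in [0, T], where \<open>S0\<close>
      bounds F(x).\<close>
    define T' where "T' = T / \<kappa>"
    have T': "T' \<le> T" "0 \<le> T'" "u \<le> T'" using \<kappa> T uv u by (auto simp: T'_def field_simps mult_le_cancel_left1)
    have \<kappa>T: "0 \<le> \<kappa> * t \<and> \<kappa> * t \<le> T" if "0 \<le> t" "t \<le> T'" for t
      using that \<kappa> by (auto simp: T'_def field_simps)
    \<comment> \<open>\<open>K\<close> measures the dilation; since
      \<open>K * u powr a = v powr a - u powr a\<close>, a bound proportional to it is the desired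
      increment.\<close>
    define K where "K = \<kappa> powr a - 1"
    have K: "K \<ge> 0" using \<kappa> \<open>a > 0\<close> by (simp add: K_def ge_one_powr_ge_zero)
    have x\<kappa>: "continuous_on {0..} (\<lambda>s. x (\<kappa> * s))"
      by (rule continuous_on_compose2[OF x]) (use \<kappa> in \<open>auto intro!: continuous_intros\<close>)
    have Fx\<kappa>: "continuous_on {0..} (\<lambda>s. F (x (\<kappa> * s)))" by (intro continuous_on_compose2[OF Fc x\<kappa>]) auto
    define d where "d t = norm (x (\<kappa> * t) - x t)" for t
    have d: "continuous_on {0..} d" unfolding d_def by (intro continuous_intros x\<kappa> x)
    have le: "d t \<le> K * (S0 * t powr a / G) + L * RL_integral a d t" if t: "0 \<le> t" "t \<le> T'" for t
    proof -
      have sub: "continuous_on {0..t} g" if "continuous_on {0..} g" for g :: "real \<Rightarrow> 'b::topological_space"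
        by (rule continuous_on_subset[OF that]) auto
      have "x (\<kappa> * t) - x t = \<kappa> powr a *\<^sub>R RL_integral a (\<lambda>s. F (x (\<kappa> * s))) t - RL_integral a (\<lambda>s. F (x s)) t"
        using sol[of "\<kappa> * t"] sol[of t] \<kappa>T[OF t] t \<kappa> by (simp add: RL_integral_rescale)
      also have "\<dots> = K *\<^sub>R RL_integral a (\<lambda>s. F (x (\<kappa> * s))) t + RL_integral a (\<lambda>s. F (x (\<kappa> * s)) - F (x s)) t"
        using RL_integral_diff[OF \<open>a > 0\<close> t(1) sub[OF Fx\<kappa>] sub[OF Fx]] by (simp add: K_def algebra_simps)
      finally have "d t \<le> K * norm (RL_integral a (\<lambda>s. F (x (\<kappa> * s))) t)
          + norm (RL_integral a (\<lambda>s. F (x (\<kappa> * s)) - F (x s)) t)"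
        unfolding d_def using K norm_triangle_ineq by (metis abs_of_nonneg norm_scaleR)
      moreover have "norm (RL_integral a (\<lambda>s. F (x (\<kappa> * s))) t) \<le> RL_integral a (\<lambda>s. S0) t"
      proof (rule RL_integral_norm_le[OF \<open>a > 0\<close> t(1) sub[OF Fx\<kappa>]])
        fix s assume "0 \<le> s" "s \<le> t"
        then show "norm (F (x (\<kappa> * s))) \<le> S0" using \<kappa>T[of s] t by (intro S0) auto
      qed auto
      moreover have "norm (RL_integral a (\<lambda>s. F (x (\<kappa> * s)) - F (x s)) t) \<le> RL_integral a (\<lambda>s. L *\<^sub>R d s) t"
        by (rule RL_integral_norm_le[OF \<open>a > 0\<close> t(1)])
          (use FL in \<open>auto simp: d_def[symmetric] intro!: continuous_intros sub[OF d] sub[OF Fx\<kappa>] sub[OF Fx] d_def\<close>,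
           simp add: d_def FL)
      ultimately have "d t \<le> K * (S0 * t powr a / G) + L * RL_integral a d t"
        using mult_left_mono[OF _ K, of "norm (RL_integral a (\<lambda>s. F (x (\<kappa> * s))) t)" "RL_integral a (\<lambda>s. S0) t"]
          RL_integral_const[OF \<open>a > 0\<close> t(1), of S0] RL_integral_cmult[of a L d t]
        by (simp add: G_def)
      then show ?thesis .
    qed
    have dK: "d t \<le> K * C2" if t: "0 \<le> t" "t \<le> T'" for t
    proof -
      have "d t \<le> 2 * (K * (S0 * T powr a / G)) * exp (w * T')"
      proof (rule RL_integral_Gronwall[OF \<open>a > 0\<close> L _ w _ _ _ t])
        show "continuous_on {0..T'} d" by (rule continuous_on_subset[OF d]) auto
        fix t assume t: "0 \<le> t" "t \<le> T'"
        show "0 \<le> d t" by (simp add: d_def)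
        have "S0 * t powr a / G \<le> S0 * T powr a / G"
          using S00 G t T' \<open>a > 0\<close> by (intro divide_right_mono mult_left_mono powr_mono2) auto
        then show "d t \<le> K * (S0 * T powr a / G) + L * RL_integral a d t"
          using le[OF t] mult_left_mono[OF _ K] by fastforce
      qed (use K S00 G in auto)
      also have "\<dots> \<le> 2 * (K * (S0 * T powr a / G)) * exp (w * T)"
        using K S00 G T' w by (intro mult_left_mono) auto
      finally show ?thesis by (simp add: C2_def mult_ac)
    qed
    \<comment> \<open>Gronwall yields \<open>K * C2\<close> without a factor u^a; one more pass
      through the integral inequality supplies that factor.\<close>
    have "RL_integral a d u \<le> RL_integral a (\<lambda>s. K * C2) u"
      by (rule RL_integral_mono[OF \<open>a > 0\<close> uv(1) continuous_on_subset[OF d]]) (use dK T' in auto)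
    then have "d u \<le> K * (S0 * u powr a / G) + L * (K * C2 * u powr a / G)"
      using le[OF uv(1) T'(3)] RL_integral_const[OF \<open>a > 0\<close> uv(1), of "K * C2"] mult_left_mono[OF _ L]
      by (fastforce simp: G_def)
    also have "\<dots> = C * (K * u powr a)" by (simp add: C_def add_divide_distrib algebra_simps)
    also have "K * u powr a = v powr a - u powr a"
      using \<kappa> u by (simp add: K_def algebra_simps powr_mult[symmetric])
    finally show ?thesis by (simp add: d_def \<kappa>)
  qed
  with C that show thesis by blast
next
  case False
  then show thesis by (intro that[of 0]) auto
qed

section \<open>Caputo derivatives and fractional integrals\<close>

lemma set_lebesgue_integral_rescale:
  fixes h :: "real \<Rightarrow> real"
  assumes "t > 0"
  shows "(LINT r:{0..t}|lborel. h r) = t * (LINT s:{0..1}|lborel. h (t * s))"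
proof -
  have "indicat_real {0..t} (t * s) = indicat_real {0..1} s" for s
    using assms by (auto simp: indicator_def zero_le_mult_iff)
  then show ?thesis
    using lborel_integral_real_affine[of t "\<lambda>r. indicat_real {0..t} r *\<^sub>R h r" 0] assms
    by (simp add: set_lebesgue_integral_def)
qed

lemma set_integrable_rescale:
  fixes h :: "real \<Rightarrow> real"
  assumes "t > 0"
  shows "set_integrable lborel {0..1} (\<lambda>s. h (t * s)) \<longleftrightarrow> set_integrable lborel {0..t} h"
proof -
  have "indicat_real {0..t} (t * s) = indicat_real {0..1} s" for s
    using assms by (auto simp: indicator_def zero_le_mult_iff)
  then show ?thesis
    using lborel_integrable_real_affine_iff[of t "\<lambda>r. indicat_real {0..t} r *\<^sub>R h r" 0] assms
    by (simp add: set_integrable_def)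
qed

lemma RL_integral_convolution:
  fixes f :: "real \<Rightarrow> real"
  assumes "t > 0"
  shows "RL_integral a f t = (LINT r:{0..t}|lborel. (t - r) powr (a - 1) * f r) / Gamma a"
proof -
  have "(LINT r:{0..t}|lborel. (t - r) powr (a - 1) * f r)
      = t * (LINT s:{0..1}|lborel. t powr (a - 1) * ((1 - s) powr (a - 1) * f (t * s)))"
    unfolding set_lebesgue_integral_rescale[OF assms]
  proof (intro arg_cong[where f = "\<lambda>z. t * z"] set_lebesgue_integral_cong allI impI)
    fix s :: real assume "s \<in> {0..1}"
    then have "(t * (1 - s)) powr (a - 1) = t powr (a - 1) * (1 - s) powr (a - 1)"
      by (simp add: powr_mult)
    then show "(t - t * s) powr (a - 1) * f (t * s) = t powr (a - 1) * ((1 - s) powr (a - 1) * f (t * s))"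
      by (simp add: right_diff_distrib)
  qed simp
  also have "\<dots> = (t * t powr (a - 1)) * (LINT s:{0..1}|lborel. (1 - s) powr (a - 1) * f (t * s))" by simp
  also have "t * t powr (a - 1) = t powr a" using assms by (simp add: powr_diff)
  finally show ?thesis by (simp add: RL_integral_def)
qed

lemma set_integrable_Beta_kernel:
  fixes t :: real
  assumes "a > 0" "b > 0" "t > 0"
  shows "set_integrable lborel {0..t} (\<lambda>r. (t - r) powr (a - 1) * r powr (b - 1))" (is ?I)
    and "(LINT r:{0..t}|lborel. (t - r) powr (a - 1) * r powr (b - 1)) = Beta a b * t powr (a + b - 1)" (is ?E)
proof -
  have eq: "(t - t * s) powr (a - 1) * (t * s) powr (b - 1)
      = t powr (a + b - 2) * (s powr (b - 1) * (1 - s) powr (a - 1))" if "s \<in> {0..1}" for s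
  proof -
    have "(t * (1 - s)) powr (a - 1) = t powr (a - 1) * (1 - s) powr (a - 1)"
      by (simp add: powr_mult)
    moreover have "(t * s) powr (b - 1) = t powr (b - 1) * s powr (b - 1)"
      by (simp add: powr_mult)
    moreover have "t powr (a + b - 2) = t powr (a - 1) * t powr (b - 1)"
      by (simp add: powr_add[symmetric])
    ultimately show ?thesis by (simp add: right_diff_distrib)
  qed
  have "set_integrable lborel {0..1} (\<lambda>s. t powr (a + b - 2) * (s powr (b - 1) * (1 - s) powr (a - 1)))"
    using integrable_Beta[of b a] assms by (intro set_integrable_mult_right) auto
  then have "set_integrable lborel {0..1} (\<lambda>s. (t - t * s) powr (a - 1) * (t * s) powr (b - 1))"
    by (subst set_integrable_cong[OF refl refl eq]) auto
  then show ?I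
    using set_integrable_rescale[OF \<open>t > 0\<close>, of "\<lambda>r. (t - r) powr (a - 1) * r powr (b - 1)"] by simp
  have "(LINT r:{0..t}|lborel. (t - r) powr (a - 1) * r powr (b - 1))
      = t * (LINT s:{0..1}|lborel. t powr (a + b - 2) * (s powr (b - 1) * (1 - s) powr (a - 1)))"
    unfolding set_lebesgue_integral_rescale[OF \<open>t > 0\<close>]
    by (intro arg_cong[where f = "\<lambda>z. t * z"] set_lebesgue_integral_cong allI impI eq) auto
  also have "\<dots> = (t * t powr (a + b - 2)) * Beta a b"
    using set_lebesgue_integral_Beta[of b a] assms by (simp add: Beta_commute)
  also have "t * t powr (a + b - 2) = t powr (a + b - 1)"
    using assms powr_mult_base[of t "a + b - 2"] by simp
  finally show ?E by simp
qed

lemma kernel_convolution: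
  fixes t :: real
  assumes "a > 0" "b > 0" "s \<le> t"
  shows "set_integrable lborel {s..t} (\<lambda>r. (t - r) powr (a - 1) * (r - s) powr (b - 1))" (is ?I)
    and "(LINT r:{s..t}|lborel. (t - r) powr (a - 1) * (r - s) powr (b - 1)) = Beta a b * (t - s) powr (a + b - 1)" (is ?E)
proof -
  have "?I \<and> ?E"
  proof (cases "s = t")
    case True
    have z: "indicat_real {t} r * ((t - r) powr (a - 1) * (r - t) powr (b - 1)) = 0" for r
      by (auto simp: indicator_def)
    show ?thesis using True unfolding set_integrable_def set_lebesgue_integral_def by (simp add: z)
  next
    case False
    then have t: "t - s > 0" using assms by simp
    have ind: "indicat_real {s..t} (s + r) = indicat_real {0..t - s} r" for r
      by (auto simp: indicator_def)
    have ar: "t - (s + r) = t - s - r" for r by simp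
    show ?thesis
      using set_integrable_Beta_kernel[OF assms(1,2) t]
        lborel_integral_real_affine[of 1 "\<lambda>r. indicat_real {s..t} r *\<^sub>R ((t - r) powr (a - 1) * (r - s) powr (b - 1))" s]
        lborel_integrable_real_affine_iff[of 1 "\<lambda>r. indicat_real {s..t} r *\<^sub>R ((t - r) powr (a - 1) * (r - s) powr (b - 1))" s]
      by (simp add: set_lebesgue_integral_def set_integrable_def ind ar)
  qed
  then show ?I ?E by auto
qed

text \<open>Up to Gamma factors this is \<open>I\<^sup>a I\<^sup>b f = I\<^bsup>a+b\<^esup> f\<close>.\<close>

lemma fractional_integral_semigroup:
  fixes f :: "real \<Rightarrow> real"
  assumes "a > 0" "b > 0" and f[measurable]: "f \<in> borel_measurable borel"
    and int: "set_integrable lborel {0..t} (\<lambda>s. (t - s) powr (a + b - 1) * f s)"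
  shows "set_integrable lborel {0..t} (\<lambda>r. (t - r) powr (a - 1) * (LINT s:{0..r}|lborel. (r - s) powr (b - 1) * f s))"
    and "(LINT r:{0..t}|lborel. (t - r) powr (a - 1) * (LINT s:{0..r}|lborel. (r - s) powr (b - 1) * f s))
      = Beta a b * (LINT s:{0..t}|lborel. (t - s) powr (a + b - 1) * f s)"
proof -
  define H where "H s r = (if 0 \<le> s \<and> s \<le> r \<and> r \<le> t then (t - r) powr (a - 1) * (r - s) powr (b - 1) * f s else 0)"
    for s r
  have Hm[measurable]: "case_prod H \<in> borel_measurable (lborel \<Otimes>\<^sub>M lborel)"
    unfolding H_def by measurable
  have Hs: "H s r = indicator {0..t} s * f s * (indicat_real {s..t} r *\<^sub>R ((t - r) powr (a - 1) * (r - s) powr (b - 1)))" for s r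
    by (auto simp: H_def indicator_def)
  have Hr: "H s r = indicator {0..t} r * (t - r) powr (a - 1) * (indicat_real {0..r} s *\<^sub>R ((r - s) powr (b - 1) * f s))" for s r
    by (auto simp: H_def indicator_def)
  have k: "integrable lborel (\<lambda>r. indicat_real {s..t} r *\<^sub>R ((t - r) powr (a - 1) * (r - s) powr (b - 1)))"
    "(\<integral>r. indicat_real {s..t} r *\<^sub>R ((t - r) powr (a - 1) * (r - s) powr (b - 1)) \<partial>lborel) = Beta a b * (t - s) powr (a + b - 1)"
    if "s \<le> t" for s
    using kernel_convolution[OF assms(1,2) that] by (simp_all add: set_integrable_def set_lebesgue_integral_def)
  have int1: "integrable lborel (\<lambda>r. H s r)" for s
  proof (cases "s \<in> {0..t}")
    case True
    then show ?thesis unfolding Hs using k(1)[of s] by (intro integrable_mult_right) auto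
  qed (simp add: Hs)
  have val1: "(\<integral>r. H s r \<partial>lborel) = Beta a b * (indicat_real {0..t} s *\<^sub>R ((t - s) powr (a + b - 1) * f s))" for s
  proof (cases "s \<in> {0..t}")
    case True
    then show ?thesis unfolding Hs using k(2)[of s] by simp
  qed (simp add: Hs)
  \<comment> \<open>The kernel is nonnegative, so the modulus of \<open>H\<close> integrates to the
    same Beta factor times |f|; this is the integrability that Fubini's theorem requires.\<close>
  have nval1: "(\<integral>r. norm (H s r) \<partial>lborel) = norm (Beta a b * (indicat_real {0..t} s *\<^sub>R ((t - s) powr (a + b - 1) * f s)))" for s
  proof (cases "s \<in> {0..t}")
    case True
    have "norm (H s r) = \<bar>f s\<bar> * (indicat_real {s..t} r *\<^sub>R ((t - r) powr (a - 1) * (r - s) powr (b - 1)))" for r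
      using True unfolding Hs by (auto simp: abs_mult indicator_def)
    moreover have "Beta a b \<ge> 0" using assms by (simp add: Beta_def Gamma_real_nonneg)
    ultimately show ?thesis using k(2)[of s] True by (simp add: abs_mult)
  qed (simp add: Hs)
  have iH: "integrable (lborel \<Otimes>\<^sub>M lborel) (case_prod H)"
  proof (rule lborel_pair.Fubini_integrable[OF Hm])
    show "integrable lborel (\<lambda>x. \<integral> y. norm (case_prod H (x, y)) \<partial>lborel)"
      using int by (simp only: prod.case nval1 set_integrable_def)
        (intro integrable_norm integrable_mult_right, auto)
    show "AE x in lborel. integrable lborel (\<lambda>y. case_prod H (x, y))" using int1 by simp
  qed
  have val2: "(\<integral>s. H s r \<partial>lborel) = indicat_real {0..t} r *\<^sub>R ((t - r) powr (a - 1) * (LINT s:{0..r}|lborel. (r - s) powr (b - 1) * f s))" for r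
    unfolding Hr set_lebesgue_integral_def by simp
  show "set_integrable lborel {0..t} (\<lambda>r. (t - r) powr (a - 1) * (LINT s:{0..r}|lborel. (r - s) powr (b - 1) * f s))"
    using lborel_pair.integrable_snd[OF iH] unfolding val2 set_integrable_def .
  have "(\<integral>r. (\<integral>s. H s r \<partial>lborel) \<partial>lborel) = (\<integral>s. (\<integral>r. H s r \<partial>lborel) \<partial>lborel)"
    by (rule lborel_pair.Fubini_integral[OF iH])
  then show "(LINT r:{0..t}|lborel. (t - r) powr (a - 1) * (LINT s:{0..r}|lborel. (r - s) powr (b - 1) * f s))
      = Beta a b * (LINT s:{0..t}|lborel. (t - s) powr (a + b - 1) * f s)"
    unfolding val1 val2 by (simp add: set_lebesgue_integral_def)
qed

text \<open>On [0, t) the weight (t - s)^(-\<alpha>) is at least t^(-\<alpha>), so it can be removed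
  at the cost of a constant.\<close>

lemma integrable_of_weighted:
  fixes g :: "real \<Rightarrow> real"
  assumes "0 < \<alpha>" "t > 0" and g[measurable]: "g \<in> borel_measurable borel"
    and int: "set_integrable lborel {0..t} (\<lambda>s. (t - s) powr (- \<alpha>) * g s)"
  shows "set_integrable lborel {0..t} g"
  unfolding set_integrable_def
proof (rule Bochner_Integration.integrable_bound)
  show "integrable lborel (\<lambda>s. t powr \<alpha> * (indicat_real {0..t} s *\<^sub>R ((t - s) powr (- \<alpha>) * g s)))"
    using int by (simp add: set_integrable_def)
  show "AE s in lborel. norm (indicat_real {0..t} s *\<^sub>R g s)
    \<le> norm (t powr \<alpha> * (indicat_real {0..t} s *\<^sub>R ((t - s) powr (- \<alpha>) * g s)))"
    using AE_lborel_singleton[of t]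
  proof eventually_elim
    case (elim s)
    show ?case
    proof (cases "s \<in> {0..t}")
      case True
      then have "(t - s) powr \<alpha> \<le> t powr \<alpha>" using assms by (intro powr_mono2) auto
      then have "1 \<le> t powr \<alpha> * (t - s) powr (- \<alpha>)"
        using True elim by (simp add: powr_minus field_simps)
      then have "1 * \<bar>g s\<bar> \<le> (t powr \<alpha> * (t - s) powr (- \<alpha>)) * \<bar>g s\<bar>" by (intro mult_right_mono) auto
      then show ?thesis using True by (simp add: abs_mult mult.assoc)
    qed simp
  qed
qed simp

text \<open>Integration by parts for the Caputo integral, proved by Fubini's theorem from
  \<open>(t - s)\<^bsup>-\<alpha>\<^esup> - t\<^bsup>-\<alpha>\<^esup> = \<integral>\<^sub>0\<^sup>s \<alpha> (t - r)\<^bsup>-\<alpha>-1\<^esup> dr\<close>.\<close>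

lemma Caputo_integral_by_parts:
  fixes g :: "real \<Rightarrow> real"
  assumes \<alpha>: "0 < \<alpha>" and "t > 0" and g[measurable]: "g \<in> borel_measurable borel"
    and int: "set_integrable lborel {0..t} (\<lambda>s. (t - s) powr (- \<alpha>) * g s)"
  shows "(LINT s:{0..t}|lborel. (t - s) powr (- \<alpha>) * g s) =
    t powr (- \<alpha>) * (LINT s:{0..t}|lborel. g s) +
    (LINT r:{0..t}|lborel. \<alpha> * (t - r) powr (- \<alpha> - 1) * ((LINT s:{0..t}|lborel. g s) - (LINT s:{0..r}|lborel. g s)))"
proof -
  have gi: "set_integrable lborel {0..t} g" by (rule integrable_of_weighted[OF assms])
  \<comment> \<open>The strict \<open>s < t\<close> keeps the kernel integrable in r, because for s
    = t the singularity r = t would be included. The omitted line is a null set.\<close>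
  define H where "H s r = (if 0 \<le> r \<and> r \<le> s \<and> s < t then \<alpha> * (t - r) powr (- \<alpha> - 1) * g s else 0)" for s r
  have Hm[measurable]: "case_prod H \<in> borel_measurable (lborel \<Otimes>\<^sub>M lborel)"
    unfolding H_def by measurable
  define k where "k s = (t - s) powr (- \<alpha>) - t powr (- \<alpha>)" for s
  have ker: "integrable lborel (\<lambda>r. indicat_real {0..s} r *\<^sub>R (\<alpha> * (t - r) powr (- \<alpha> - 1)))" (is ?A)
    "(\<integral>r. indicat_real {0..s} r *\<^sub>R (\<alpha> * (t - r) powr (- \<alpha> - 1)) \<partial>lborel) = k s" (is ?B)
    if s: "0 \<le> s" "s < t" for s
  proof -
    have si: "set_integrable lborel {0..s} (\<lambda>r. \<alpha> * (t - r) powr (- \<alpha> - 1))"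
      by (intro borel_integrable_atLeastAtMost' continuous_intros) (use s in auto)
    moreover have "((\<lambda>r. \<alpha> * (t - r) powr (- \<alpha> - 1)) has_integral (t - s) powr (- \<alpha>) - (t - 0) powr (- \<alpha>)) {0..s}"
    proof (rule fundamental_theorem_of_calculus[OF s(1)])
      fix r assume "r \<in> {0..s}"
      then show "((\<lambda>r. (t - r) powr (- \<alpha>)) has_vector_derivative \<alpha> * (t - r) powr (- \<alpha> - 1)) (at r within {0..s})"
        using s by (auto intro!: derivative_eq_intros simp: has_real_derivative_iff_has_vector_derivative[symmetric])
    qed
    ultimately have "(LINT r:{0..s}|lborel. \<alpha> * (t - r) powr (- \<alpha> - 1)) = k s"
      using set_borel_integral_eq_integral(2)[of "{0..s}" "\<lambda>r. \<alpha> * (t - r) powr (- \<alpha> - 1)"]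
      unfolding k_def by (simp only: has_integral_iff diff_zero)
    then show ?B by (simp only: set_lebesgue_integral_def)
    show ?A using si by (simp only: set_integrable_def)
  qed
  have k0: "k s \<ge> 0" if "0 \<le> s" "s < t" for s
    using that \<alpha> powr_mono2'[of "- \<alpha>" "t - s" t] by (simp add: k_def)
  have Hs: "H s r = (if 0 \<le> s \<and> s < t then g s else 0) * (indicat_real {0..s} r *\<^sub>R (\<alpha> * (t - r) powr (- \<alpha> - 1)))" for s r
    by (auto simp: H_def indicator_def)
  have int1: "integrable lborel (\<lambda>r. H s r)" for s
  proof (cases "0 \<le> s \<and> s < t")
    case True
    then show ?thesis unfolding Hs using ker(1)[of s] by (intro integrable_mult_right) auto
  next
    case False
    then have "H s = (\<lambda>r. 0)" by (auto simp: H_def fun_eq_iff)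
    then show ?thesis using False by (simp del: not_less de_Morgan_conj)
  qed
  have val1: "(\<integral>r. H s r \<partial>lborel) = (if 0 \<le> s \<and> s < t then g s else 0) * k s" for s
  proof (cases "0 \<le> s \<and> s < t")
    case True
    then show ?thesis unfolding Hs using ker(2)[of s] by simp
  next
    case False
    then have "H s = (\<lambda>r. 0)" by (auto simp: H_def fun_eq_iff)
    then show ?thesis using False by (simp del: not_less de_Morgan_conj)
  qed
  have nval1: "(\<integral>r. norm (H s r) \<partial>lborel) = norm ((if 0 \<le> s \<and> s < t then g s else 0) * k s)" for s
  proof (cases "0 \<le> s \<and> s < t")
    case True
    have "norm (H s r) = \<bar>g s\<bar> * (indicat_real {0..s} r *\<^sub>R (\<alpha> * (t - r) powr (- \<alpha> - 1)))" for r
      using True \<alpha> unfolding Hs by (auto simp: abs_mult indicator_def)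
    then show ?thesis using ker(2)[of s] True k0[of s] by (simp add: abs_mult)
  next
    case False
    then have "H s = (\<lambda>r. 0)" by (auto simp: H_def fun_eq_iff)
    then show ?thesis using False by (simp del: not_less de_Morgan_conj)
  qed
  have AEeq: "AE s in lborel. (if 0 \<le> s \<and> s < t then g s else 0) * k s
      = indicat_real {0..t} s *\<^sub>R ((t - s) powr (- \<alpha>) * g s) - t powr (- \<alpha>) * (indicat_real {0..t} s *\<^sub>R g s)"
    using AE_lborel_singleton[of t] by eventually_elim (auto simp: indicator_def k_def algebra_simps)
  have i2: "integrable lborel (\<lambda>s. indicat_real {0..t} s *\<^sub>R ((t - s) powr (- \<alpha>) * g s) - t powr (- \<alpha>) * (indicat_real {0..t} s *\<^sub>R g s))"
    using int gi by (intro Bochner_Integration.integrable_diff integrable_mult_right) (auto simp: set_integrable_def)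
  have km[measurable]: "k \<in> borel_measurable borel" unfolding k_def by measurable
  have i1: "integrable lborel (\<lambda>s. (if 0 \<le> s \<and> s < t then g s else 0) * k s)"
    using i2 by (subst integrable_cong_AE[OF _ _ AEeq]) simp_all
  have iH: "integrable (lborel \<Otimes>\<^sub>M lborel) (case_prod H)"
  proof (rule lborel_pair.Fubini_integrable[OF Hm])
    show "integrable lborel (\<lambda>x. \<integral> y. norm (case_prod H (x, y)) \<partial>lborel)"
      unfolding prod.case nval1 by (rule integrable_norm[OF i1])
    show "AE x in lborel. integrable lborel (\<lambda>y. case_prod H (x, y))" using int1 by simp
  qed
  have val2: "(\<integral>s. H s r \<partial>lborel) = indicat_real {0..t} r *\<^sub>R
    (\<alpha> * (t - r) powr (- \<alpha> - 1) * ((LINT s:{0..t}|lborel. g s) - (LINT s:{0..r}|lborel. g s)))" for r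
  proof (cases "r \<in> {0..t}")
    case True
    have gr: "set_integrable lborel {0..r} g" by (rule set_integrable_subset[OF gi]) (use True in auto)
    have "(\<integral>s. H s r \<partial>lborel) = (\<integral>s. \<alpha> * (t - r) powr (- \<alpha> - 1) * (indicat_real {0..t} s *\<^sub>R g s - indicat_real {0..r} s *\<^sub>R g s) \<partial>lborel)"
    proof (rule integral_cong_AE)
      show "AE s in lborel. H s r = \<alpha> * (t - r) powr (- \<alpha> - 1) * (indicat_real {0..t} s *\<^sub>R g s - indicat_real {0..r} s *\<^sub>R g s)"
        using AE_lborel_singleton[of t] AE_lborel_singleton[of r]
        by eventually_elim (use True in \<open>auto simp: H_def indicator_def\<close>)
    qed (auto simp: H_def)
    also have "\<dots> = \<alpha> * (t - r) powr (- \<alpha> - 1) * ((LINT s:{0..t}|lborel. g s) - (LINT s:{0..r}|lborel. g s))"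
      using gi gr by (simp add: set_integrable_def set_lebesgue_integral_def)
    finally show ?thesis using True by simp
  next
    case False
    then have "(\<lambda>s. H s r) = (\<lambda>s. 0)" by (auto simp: H_def fun_eq_iff)
    then show ?thesis using False by (simp del: not_le de_Morgan_conj atLeastAtMost_iff)
  qed
  have "(LINT r:{0..t}|lborel. \<alpha> * (t - r) powr (- \<alpha> - 1) * ((LINT s:{0..t}|lborel. g s) - (LINT s:{0..r}|lborel. g s)))
      = (\<integral>r. (\<integral>s. H s r \<partial>lborel) \<partial>lborel)"
    unfolding val2 by (simp add: set_lebesgue_integral_def)
  also have "\<dots> = (\<integral>s. (\<integral>r. H s r \<partial>lborel) \<partial>lborel)"
    by (rule lborel_pair.Fubini_integral[OF iH])
  also have "\<dots> = (\<integral>s. indicat_real {0..t} s *\<^sub>R ((t - s) powr (- \<alpha>) * g s) - t powr (- \<alpha>) * (indicat_real {0..t} s *\<^sub>R g s) \<partial>lborel)"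
    unfolding val1 by (rule integral_cong_AE[OF _ _ AEeq]) auto
  also have "\<dots> = (LINT s:{0..t}|lborel. (t - s) powr (- \<alpha>) * g s) - t powr (- \<alpha>) * (LINT s:{0..t}|lborel. g s)"
    using int gi by (simp add: set_integrable_def set_lebesgue_integral_def)
  finally show ?thesis by simp
qed

section \<open>Permanence properties of absolute continuity, and powers of t\<close>

lemma abs_continuous_comparison:
  fixes f :: "real \<Rightarrow> 'a::real_normed_vector" and g :: "real \<Rightarrow> 'b::real_normed_vector"
  assumes g: "abs_continuous_on_interval a b g" and "K \<ge> 0"
    and le: "\<And>u v. a \<le> u \<Longrightarrow> u \<le> v \<Longrightarrow> v \<le> b \<Longrightarrow> norm (f v - f u) \<le> K * norm (g v - g u)"
  shows "abs_continuous_on_interval a b f"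
  unfolding abs_continuous_on_interval_def
proof (intro allI impI)
  fix \<epsilon> :: real assume "\<epsilon> > 0"
  then have "\<epsilon> / (K + 1) > 0" using \<open>K \<ge> 0\<close> by simp
  from g[unfolded abs_continuous_on_interval_def, THEN spec, THEN mp, OF this]
  obtain \<delta> where \<delta>: "\<delta> > 0" and *:
    "\<And>(N::nat) u v. \<forall>k<N. a \<le> u k \<and> u k \<le> v k \<and> v k \<le> b \<Longrightarrow>
        disjoint_family_on (\<lambda>k. {u k<..<v k}) {..<N} \<Longrightarrow>
        (\<Sum>k<N. v k - u k) < \<delta> \<Longrightarrow> (\<Sum>k<N. norm (g (v k) - g (u k))) < \<epsilon> / (K + 1)" by auto
  show "\<exists>\<delta>>0. \<forall>(N::nat) u v. (\<forall>k<N. a \<le> u k \<and> u k \<le> v k \<and> v k \<le> b) \<and>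
        disjoint_family_on (\<lambda>k. {u k<..<v k}) {..<N} \<and> (\<Sum>k<N. v k - u k) < \<delta> \<longrightarrow>
        (\<Sum>k<N. norm (f (v k) - f (u k))) < \<epsilon>"
  proof (intro exI[of _ \<delta>] conjI allI impI \<delta>, elim conjE)
    fix N :: nat and u v :: "nat \<Rightarrow> real"
    assume uv: "\<forall>k<N. a \<le> u k \<and> u k \<le> v k \<and> v k \<le> b"
      and dj: "disjoint_family_on (\<lambda>k. {u k<..<v k}) {..<N}" "(\<Sum>k<N. v k - u k) < \<delta>"
    have "(\<Sum>k<N. norm (f (v k) - f (u k))) \<le> (\<Sum>k<N. (K + 1) * norm (g (v k) - g (u k)))"
    proof (rule sum_mono)
      fix k assume "k \<in> {..<N}"
      then have "norm (f (v k) - f (u k)) \<le> K * norm (g (v k) - g (u k))" using uv by (intro le) auto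
      also have "\<dots> \<le> (K + 1) * norm (g (v k) - g (u k))" by (intro mult_right_mono) auto
      finally show "norm (f (v k) - f (u k)) \<le> (K + 1) * norm (g (v k) - g (u k))" .
    qed
    also have "\<dots> = (K + 1) * (\<Sum>k<N. norm (g (v k) - g (u k)))" by (simp add: sum_distrib_left)
    also have "\<dots> < (K + 1) * (\<epsilon> / (K + 1))"
      using *[OF uv dj] \<open>K \<ge> 0\<close> by (intro mult_strict_left_mono) auto
    finally show "(\<Sum>k<N. norm (f (v k) - f (u k))) < \<epsilon>" using \<open>K \<ge> 0\<close> by simp
  qed
qed

lemma abs_continuous_add:
  assumes f: "abs_continuous_on_interval a b f" and g: "abs_continuous_on_interval a b g"
  shows "abs_continuous_on_interval a b (\<lambda>t. f t + g t)"
  unfolding abs_continuous_on_interval_def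
proof (intro allI impI)
  fix \<epsilon> :: real assume "\<epsilon> > 0"
  then have e2: "\<epsilon> / 2 > 0" by simp
  from f[unfolded abs_continuous_on_interval_def, THEN spec, THEN mp, OF e2]
  obtain \<delta> where \<delta>: "\<delta> > 0" and *:
    "\<And>(N::nat) u v. \<forall>k<N. a \<le> u k \<and> u k \<le> v k \<and> v k \<le> b \<Longrightarrow>
        disjoint_family_on (\<lambda>k. {u k<..<v k}) {..<N} \<Longrightarrow>
        (\<Sum>k<N. v k - u k) < \<delta> \<Longrightarrow> (\<Sum>k<N. norm (f (v k) - f (u k))) < \<epsilon> / 2" by auto
  from g[unfolded abs_continuous_on_interval_def, THEN spec, THEN mp, OF e2]
  obtain \<delta>' where \<delta>': "\<delta>' > 0" and **:
    "\<And>(N::nat) u v. \<forall>k<N. a \<le> u k \<and> u k \<le> v k \<and> v k \<le> b \<Longrightarrow>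
        disjoint_family_on (\<lambda>k. {u k<..<v k}) {..<N} \<Longrightarrow>
        (\<Sum>k<N. v k - u k) < \<delta>' \<Longrightarrow> (\<Sum>k<N. norm (g (v k) - g (u k))) < \<epsilon> / 2" by auto
  have pos: "0 < min \<delta> \<delta>'" using \<delta> \<delta>' by simp
  show "\<exists>\<delta>>0. \<forall>(N::nat) u v. (\<forall>k<N. a \<le> u k \<and> u k \<le> v k \<and> v k \<le> b) \<and>
        disjoint_family_on (\<lambda>k. {u k<..<v k}) {..<N} \<and> (\<Sum>k<N. v k - u k) < \<delta> \<longrightarrow>
        (\<Sum>k<N. norm (f (v k) + g (v k) - (f (u k) + g (u k)))) < \<epsilon>"
  proof (intro exI[of _ "min \<delta> \<delta>'"] conjI allI impI pos, elim conjE)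
    fix N :: nat and u v :: "nat \<Rightarrow> real"
    assume uv: "\<forall>k<N. a \<le> u k \<and> u k \<le> v k \<and> v k \<le> b"
      and dj: "disjoint_family_on (\<lambda>k. {u k<..<v k}) {..<N}" and less: "(\<Sum>k<N. v k - u k) < min \<delta> \<delta>'"
    have "(\<Sum>k<N. norm (f (v k) + g (v k) - (f (u k) + g (u k))))
      \<le> (\<Sum>k<N. norm (f (v k) - f (u k)) + norm (g (v k) - g (u k)))"
      by (intro sum_mono norm_diff_triangle_ineq)
    also have "\<dots> = (\<Sum>k<N. norm (f (v k) - f (u k))) + (\<Sum>k<N. norm (g (v k) - g (u k)))"
      by (rule sum.distrib)
    also have "\<dots> < \<epsilon> / 2 + \<epsilon> / 2"
      using less by (intro add_strict_mono *[OF uv dj] **[OF uv dj]) auto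
    finally show "(\<Sum>k<N. norm (f (v k) + g (v k) - (f (u k) + g (u k)))) < \<epsilon>" by simp
  qed
qed

lemma abs_continuous_subinterval:
  assumes f: "abs_continuous_on_interval a b f" and sub: "a \<le> a'" "b' \<le> b"
  shows "abs_continuous_on_interval a' b' f"
  unfolding abs_continuous_on_interval_def
proof (intro allI impI)
  fix \<epsilon> :: real assume "\<epsilon> > 0"
  from f[unfolded abs_continuous_on_interval_def, THEN spec, THEN mp, OF this]
  obtain \<delta> where \<delta>: "\<delta> > 0" and *:
    "\<And>(N::nat) u v. \<forall>k<N. a \<le> u k \<and> u k \<le> v k \<and> v k \<le> b \<Longrightarrow>
        disjoint_family_on (\<lambda>k. {u k<..<v k}) {..<N} \<Longrightarrow>
        (\<Sum>k<N. v k - u k) < \<delta> \<Longrightarrow> (\<Sum>k<N. norm (f (v k) - f (u k))) < \<epsilon>" by auto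
  show "\<exists>\<delta>>0. \<forall>(N::nat) u v. (\<forall>k<N. a' \<le> u k \<and> u k \<le> v k \<and> v k \<le> b') \<and>
        disjoint_family_on (\<lambda>k. {u k<..<v k}) {..<N} \<and> (\<Sum>k<N. v k - u k) < \<delta> \<longrightarrow>
        (\<Sum>k<N. norm (f (v k) - f (u k))) < \<epsilon>"
  proof (intro exI[of _ \<delta>] conjI allI impI \<delta>, elim conjE)
    fix N :: nat and u v :: "nat \<Rightarrow> real"
    assume uv: "\<forall>k<N. a' \<le> u k \<and> u k \<le> v k \<and> v k \<le> b'"
    have "\<forall>k<N. a \<le> u k \<and> u k \<le> v k \<and> v k \<le> b" using uv sub by force
    then show "disjoint_family_on (\<lambda>k. {u k<..<v k}) {..<N} \<Longrightarrow> (\<Sum>k<N. v k - u k) < \<delta> \<Longrightarrow>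
        (\<Sum>k<N. norm (f (v k) - f (u k))) < \<epsilon>" by (rule *)
  qed
qed

lemma abs_continuous_inner:
  fixes f :: "real \<Rightarrow> 'a::euclidean_space"
  shows "abs_continuous_on_interval a b f \<Longrightarrow> abs_continuous_on_interval a b (\<lambda>t. f t \<bullet> v)"
  by (rule abs_continuous_comparison[where K = "norm v"])
    (auto simp: inner_diff_left[symmetric] mult.commute[of "norm v"] Cauchy_Schwarz_ineq2)

lemma abs_continuous_diff:
  assumes "abs_continuous_on_interval a b f" "abs_continuous_on_interval a b g"
  shows "abs_continuous_on_interval a b (\<lambda>t. f t - g t)"
proof -
  have "abs_continuous_on_interval a b (\<lambda>t. - g t)"
    by (rule abs_continuous_comparison[OF assms(2), where K = 1]) (auto simp: norm_minus_commute)
  from abs_continuous_add[OF assms(1) this] show ?thesis by simp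
qed

text \<open>A monotone \<phi> sends disjoint intervals to disjoint, possibly empty, intervals inside
  [\<phi> a, \<phi> b], so additivity of Lebesgue measure bounds the sum without ordering the
  intervals.\<close>

lemma sum_mono_increments_le:
  fixes \<phi> :: "real \<Rightarrow> real" and u v :: "nat \<Rightarrow> real"
  assumes mono: "\<And>s t. a \<le> s \<Longrightarrow> s \<le> t \<Longrightarrow> t \<le> b \<Longrightarrow> \<phi> s \<le> \<phi> t"
    and "a \<le> b" and uv: "\<forall>k<N. a \<le> u k \<and> u k \<le> v k \<and> v k \<le> b"
    and dj: "disjoint_family_on (\<lambda>k. {u k<..<v k}) {..<N}"
  shows "(\<Sum>k<N. \<phi> (v k) - \<phi> (u k)) \<le> \<phi> b - \<phi> a"
proof -
  have "(\<Sum>k<N. \<phi> (v k) - \<phi> (u k)) = (\<Sum>k<N. measure lebesgue {\<phi> (u k)<..<\<phi> (v k)})"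
    by (rule sum.cong) (use uv mono in auto)
  also have "\<dots> = measure lebesgue (\<Union>k\<in>{..<N}. {\<phi> (u k)<..<\<phi> (v k)})"
  proof (rule measure_UNION'[symmetric])
    show "pairwise (\<lambda>i j. disjnt {\<phi> (u i)<..<\<phi> (v i)} {\<phi> (u j)<..<\<phi> (v j)}) {..<N}"
      unfolding pairwise_def
    proof (intro ballI impI)
      fix i j assume ij: "i \<in> {..<N}" "j \<in> {..<N}" "i \<noteq> j"
      have "{u i<..<v i} \<inter> {u j<..<v j} = {}" using dj ij by (auto simp: disjoint_family_on_def)
      then have "v i \<le> u i \<or> v j \<le> u j \<or> v i \<le> u j \<or> v j \<le> u i"
        using dense[of "max (u i) (u j)" "min (v i) (v j)"] by (auto simp: set_eq_iff not_less) (metis not_le)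
      then have "\<phi> (v i) \<le> \<phi> (u i) \<or> \<phi> (v j) \<le> \<phi> (u j) \<or> \<phi> (v i) \<le> \<phi> (u j) \<or> \<phi> (v j) \<le> \<phi> (u i)"
        using uv ij mono by (meson lessThan_iff order_trans)
      then show "disjnt {\<phi> (u i)<..<\<phi> (v i)} {\<phi> (u j)<..<\<phi> (v j)}" by (auto simp: disjnt_def)
    qed
  qed auto
  also have "\<dots> \<le> measure lebesgue {\<phi> a..\<phi> b}"
  proof (rule measure_mono_fmeasurable)
    show "(\<Union>k\<in>{..<N}. {\<phi> (u k)<..<\<phi> (v k)}) \<subseteq> {\<phi> a..\<phi> b}"
    proof
      fix y assume "y \<in> (\<Union>k\<in>{..<N}. {\<phi> (u k)<..<\<phi> (v k)})"
      then obtain k where k: "k < N" "\<phi> (u k) < y" "y < \<phi> (v k)" by auto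
      have "\<phi> a \<le> \<phi> (u k)" "\<phi> (v k) \<le> \<phi> b" using uv k mono by (meson order_refl order_trans)+
      then show "y \<in> {\<phi> a..\<phi> b}" using k by auto
    qed
  qed auto
  also have "\<dots> = \<phi> b - \<phi> a" using mono \<open>a \<le> b\<close> by simp
  finally show ?thesis .
qed

text \<open>Below \<open>\<eta>\<close> the total increment of \<open>t\<^sup>\<alpha>\<close> is at most \<open>\<eta>\<^sup>\<alpha>\<close>; above it \<open>t\<^sup>\<alpha>\<close> is Lipschitz.\<close>

lemma abs_continuous_powr:
  fixes \<alpha> :: real
  assumes "0 < \<alpha>" "\<alpha> < 1" "0 \<le> a"
  shows "abs_continuous_on_interval a b (\<lambda>t. t powr \<alpha>)"
  unfolding abs_continuous_on_interval_def
proof (intro allI impI)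
  fix \<epsilon> :: real assume e: "\<epsilon> > 0"
  \<comment> \<open>Chosen so that \<eta>^\<alpha> = \<epsilon> / 2. \<open>Lc\<close> is the
    derivative of t^\<alpha> at \<eta>, the largest slope from \<eta> onwards because \<alpha> <
    1.\<close>
  define \<eta> where "\<eta> = (\<epsilon> / 2) powr (1 / \<alpha>)"
  have \<eta>: "\<eta> > 0" "\<eta> powr \<alpha> = \<epsilon> / 2" using e assms by (auto simp: \<eta>_def powr_powr)
  define Lc where "Lc = \<alpha> * \<eta> powr (\<alpha> - 1)"
  have Lc: "Lc > 0" using assms \<eta> by (simp add: Lc_def)
  have split: "v powr \<alpha> - u powr \<alpha> \<le> (min v \<eta> powr \<alpha> - min u \<eta> powr \<alpha>) + Lc * (v - u)"
    if uv: "0 \<le> u" "u \<le> v" for u v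
  proof (cases "v \<le> \<eta>")
    case True
    then show ?thesis using uv Lc by (simp add: min_def)
  next
    case False
    define w where "w = max u \<eta>"
    have w: "\<eta> \<le> w" "w \<le> v" "u \<le> w" using False uv by (auto simp: w_def)
    have "v powr \<alpha> - w powr \<alpha> \<le> Lc * (v - w)"
    proof (cases "w = v")
      case False
      then have "w < v" using w by simp
      then obtain z where z: "z > w" "z < v" "v powr \<alpha> - w powr \<alpha> = (v - w) * (\<alpha> * z powr (\<alpha> - 1))"
        using MVT2[of w v "\<lambda>t. t powr \<alpha>" "\<lambda>t. \<alpha> * t powr (\<alpha> - 1)"] w \<eta>
        by (auto intro!: derivative_eq_intros simp: has_real_derivative_powr)
      have "z powr (\<alpha> - 1) \<le> \<eta> powr (\<alpha> - 1)" using z w \<eta> assms by (intro powr_mono2') auto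
      then have "(v - w) * (\<alpha> * z powr (\<alpha> - 1)) \<le> (v - w) * (\<alpha> * \<eta> powr (\<alpha> - 1))"
        using \<open>w < v\<close> assms by (intro mult_left_mono) auto
      then show ?thesis unfolding z(3) by (simp add: Lc_def mult_ac)
    qed simp
    also have "\<dots> \<le> Lc * (v - u)" using Lc w by (intro mult_left_mono) auto
    finally show ?thesis using False by (cases "u \<le> \<eta>") (auto simp: min_def w_def max_def)
  qed
  show "\<exists>\<delta>>0. \<forall>(N::nat) u v. (\<forall>k<N. a \<le> u k \<and> u k \<le> v k \<and> v k \<le> b) \<and>
        disjoint_family_on (\<lambda>k. {u k<..<v k}) {..<N} \<and> (\<Sum>k<N. v k - u k) < \<delta> \<longrightarrow>
        (\<Sum>k<N. norm (v k powr \<alpha> - u k powr \<alpha>)) < \<epsilon>"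
  proof (intro exI[of _ "\<epsilon> / (2 * Lc)"] conjI allI impI, goal_cases)
    case 1
    then show ?case using e Lc by simp
  next
    case (2 N u v)
    then have uv: "\<forall>k<N. a \<le> u k \<and> u k \<le> v k \<and> v k \<le> b"
      and dj: "disjoint_family_on (\<lambda>k. {u k<..<v k}) {..<N}" and less: "(\<Sum>k<N. v k - u k) < \<epsilon> / (2 * Lc)"
      by auto
    show ?case
    proof (cases "a \<le> b")
      case True
      have "(\<Sum>k<N. norm (v k powr \<alpha> - u k powr \<alpha>))
        \<le> (\<Sum>k<N. (min (v k) \<eta> powr \<alpha> - min (u k) \<eta> powr \<alpha>) + Lc * (v k - u k))"
      proof (rule sum_mono)
        fix k assume "k \<in> {..<N}"
        then have k: "0 \<le> u k" "u k \<le> v k" using uv assms(3) by force+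
        then have "u k powr \<alpha> \<le> v k powr \<alpha>" using assms by (intro powr_mono2) auto
        then show "norm (v k powr \<alpha> - u k powr \<alpha>) \<le> (min (v k) \<eta> powr \<alpha> - min (u k) \<eta> powr \<alpha>) + Lc * (v k - u k)"
          using split[OF k] by simp
      qed
      also have "\<dots> = (\<Sum>k<N. min (v k) \<eta> powr \<alpha> - min (u k) \<eta> powr \<alpha>) + Lc * (\<Sum>k<N. v k - u k)"
        by (simp add: sum.distrib sum_distrib_left)
      also have "(\<Sum>k<N. min (v k) \<eta> powr \<alpha> - min (u k) \<eta> powr \<alpha>) \<le> min b \<eta> powr \<alpha> - min a \<eta> powr \<alpha>"
        by (rule sum_mono_increments_le[OF _ True uv dj]) (use assms \<eta> in \<open>auto intro!: powr_mono2 simp: min_le_iff_disj\<close>)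
      also have "\<dots> \<le> \<eta> powr \<alpha>"
      proof -
        have "min b \<eta> powr \<alpha> \<le> \<eta> powr \<alpha>" using assms True \<eta> by (intro powr_mono2) auto
        then show ?thesis by (smt (verit) powr_ge_zero)
      qed
      also have "Lc * (\<Sum>k<N. v k - u k) < Lc * (\<epsilon> / (2 * Lc))" using less Lc by (intro mult_strict_left_mono)
      also have "Lc * (\<epsilon> / (2 * Lc)) = \<epsilon> / 2" using Lc by simp
      finally show ?thesis using \<eta> by simp
    next
      case False
      then have "N = 0" using uv by (metis gr0I order_trans)
      then show ?thesis using e by simp
    qed
  qed
qed

section \<open>Borel representatives and linearity of the Caputo derivative\<close>

lemma AE_lborel_negligible:
  assumes "negligible N" "\<And>s. s \<notin> N \<Longrightarrow> P s"
  shows "AE s in lborel. P s"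
proof -
  have "AE s in lebesgue. s \<notin> N"
    using assms(1) by (simp add: negligible_iff_null_sets AE_not_in)
  then have "AE s in lborel. s \<notin> N" by (simp add: AE_completion_iff)
  then show ?thesis by eventually_elim (rule assms(2))
qed

text \<open>The derivative is only Lebesgue measurable on [0, T], whereas the Fubini arguments are
  set on a product of Borel measures; hence a Borel function agreeing with it almost everywhere. The
  last property is conditional on integrability, which its users derive from integrability against
  the Caputo kernel.\<close>

lemma abs_continuous_borel_derivative:
  fixes p :: "real \<Rightarrow> real"
  assumes ac: "abs_continuous_on_interval 0 T p"
  obtains g where "g \<in> borel_measurable borel"
    "AE s in lborel. s \<in> {0..T} \<longrightarrow> (p has_real_derivative g s) (at s) \<and> vector_derivative p (at s) = g s"
    "\<And>r. 0 \<le> r \<Longrightarrow> r \<le> T \<Longrightarrow> set_integrable lborel {0..r} g \<Longrightarrow> (LINT s:{0..r}|lborel. g s) = p r - p 0"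
proof (cases "0 \<le> T")
  case T: True
  define N where "N = {t \<in> {0..T}. \<not> (p has_vector_derivative vector_derivative p (at t)) (at t)}"
  have N: "negligible N"
    unfolding N_def by (rule abs_continuous_vector_derivative_AE) (intro abs_continuous_inner ac)
  define p' where "p' t = vector_derivative p (at t)" for t
  have der: "(p has_real_derivative p' t) (at t)" if "t \<in> {0..T} - N" for t
    using that by (simp add: N_def p'_def has_real_derivative_iff_has_vector_derivative)
  have hi: "(p' has_integral p r - p 0) {0..r}" if "0 \<le> r" "r \<le> T" for r
    by (rule has_integral_derivative_of_abs_continuous[OF abs_continuous_subinterval[OF ac] _ N])
      (use that der in auto)
  have "(\<lambda>x. indicator {0..T} x *\<^sub>R p' x) \<in> borel_measurable lebesgue"
    by (rule has_integral_implies_lebesgue_measurable[OF hi[OF T order_refl]])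
  then obtain g where g: "g \<in> borel_measurable lborel" "AE x in lborel. indicator {0..T} x *\<^sub>R p' x = g x"
    using completion_ex_borel_measurable_real by blast
  have ae: "AE s in lborel. s \<in> {0..T} \<longrightarrow> (p has_real_derivative g s) (at s) \<and> vector_derivative p (at s) = g s"
  proof -
    have "AE s in lborel. s \<notin> N" by (rule AE_lborel_negligible[OF N])
    with g(2) show ?thesis
    proof eventually_elim
      case (elim s)
      then show ?case using der[of s] by (auto simp: p'_def)
    qed
  qed
  show thesis
  proof
    show "g \<in> borel_measurable borel" using g(1) by simp
    fix r assume r: "0 \<le> r" "r \<le> T" and gi: "set_integrable lborel {0..r} g"
    have "(g has_integral p r - p 0) {0..r}"
    proof -
      have "AE x in lborel. x \<in> {0..r} \<longrightarrow> p' x = g x"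
        using g(2) by eventually_elim (use r in \<open>auto simp: indicator_def\<close>)
      then show ?thesis using hi[OF r] has_integral_AE by blast
    qed
    then show "(LINT s:{0..r}|lborel. g s) = p r - p 0"
      using set_borel_integral_eq_integral(2)[OF gi] by (simp add: has_integral_iff)
  qed (rule ae)
qed (auto intro: that[of "\<lambda>_. 0"])

text \<open>Trades the completed measure in the definition for \<open>lborel\<close>, on which
  convolutions and integration by parts have been established.\<close>

lemma has_caputo_derivative_iff:
  fixes p g :: "real \<Rightarrow> 'a::euclidean_space"
  assumes g[measurable]: "g \<in> borel_measurable borel"
    and ae: "AE s in lborel. s \<in> {0..t} \<longrightarrow> vector_derivative p (at s) = g s"
  shows "has_caputo_derivative \<alpha> p D t \<longleftrightarrow>
    set_integrable lborel {0..t} (\<lambda>s. (t - s) powr (- \<alpha>) *\<^sub>R g s) \<and>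
    D = (1 / Gamma (1 - \<alpha>)) *\<^sub>R (LINT s:{0..t}|lborel. (t - s) powr (- \<alpha>) *\<^sub>R g s)"
proof -
  let ?p = "\<lambda>s. indicat_real {0..t} s *\<^sub>R (t - s) powr (- \<alpha>) *\<^sub>R vector_derivative p (at s)"
  let ?g = "\<lambda>s. indicat_real {0..t} s *\<^sub>R (t - s) powr (- \<alpha>) *\<^sub>R g s"
  have m: "?g \<in> borel_measurable lborel" by measurable
  have ml: "?g \<in> borel_measurable lebesgue" by (rule measurable_completion[OF m])
  have eq: "AE s in lebesgue. ?g s = ?p s"
    by (rule AE_completion) (use ae in eventually_elim, auto simp: indicator_def)
  have mp: "?p \<in> borel_measurable lebesgue"
    by (rule borel_measurable_AE[OF ml eq])
  have 1: "integrable lebesgue ?p \<longleftrightarrow> integrable lborel ?g"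
    using integrable_cong_AE[OF ml mp eq] integrable_completion[OF m] by simp
  have 2: "integral\<^sup>L lebesgue ?p = integral\<^sup>L lborel ?g"
    using integral_cong_AE[OF ml mp eq] integral_completion[OF m] by simp
  show ?thesis
    unfolding has_caputo_derivative_def set_integrable_def set_lebesgue_integral_def using 1 2 by simp
qed

text \<open>Completeness of the measure transports measurability across a null set, so neither
  function has to be assumed measurable.\<close>

lemma integrable_lebesgue_cong_AE:
  fixes f g :: "real \<Rightarrow> 'a::euclidean_space"
  assumes ae: "AE s in lborel. f s = g s"
  shows "integrable lebesgue f \<longleftrightarrow> integrable lebesgue g" "integral\<^sup>L lebesgue f = integral\<^sup>L lebesgue g"
proof -
  have 1: "AE s in lebesgue. f s = g s" using ae by (rule AE_completion)
  then have 2: "AE s in lebesgue. g s = f s" by (auto elim: eventually_mono)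
  show i: "integrable lebesgue f \<longleftrightarrow> integrable lebesgue g"
    using integrable_cong_AE_imp[OF _ _ 1] integrable_cong_AE_imp[OF _ _ 2]
      borel_measurable_AE[OF _ 1] borel_measurable_AE[OF _ 2] borel_measurable_integrable by metis
  show "integral\<^sup>L lebesgue f = integral\<^sup>L lebesgue g"
  proof (cases "integrable lebesgue f")
    case True
    then show ?thesis using i 1 by (intro integral_cong_AE) (auto intro: borel_measurable_integrable)
  qed (use i in \<open>simp add: not_integrable_integral_eq\<close>)
qed

lemma has_caputo_derivative_cong_AE:
  fixes p h :: "real \<Rightarrow> 'a::euclidean_space"
  assumes ae: "AE s in lborel. s \<in> {0..t} \<longrightarrow> vector_derivative p (at s) = h s"
  shows "has_caputo_derivative \<alpha> p D t \<longleftrightarrow>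
    set_integrable lebesgue {0..t} (\<lambda>s. (t - s) powr (- \<alpha>) *\<^sub>R h s) \<and>
    D = (1 / Gamma (1 - \<alpha>)) *\<^sub>R (LINT s:{0..t}|lebesgue. (t - s) powr (- \<alpha>) *\<^sub>R h s)"
proof -
  have eq: "AE s in lborel. indicat_real {0..t} s *\<^sub>R (t - s) powr (- \<alpha>) *\<^sub>R vector_derivative p (at s)
      = indicat_real {0..t} s *\<^sub>R (t - s) powr (- \<alpha>) *\<^sub>R h s"
    using ae by eventually_elim (auto simp: indicator_def)
  show ?thesis
    unfolding has_caputo_derivative_def set_integrable_def set_lebesgue_integral_def
    using integrable_lebesgue_cong_AE[OF eq] by simp
qed

lemma abs_continuous_differentiable_AE:
  fixes x :: "real \<Rightarrow> 'a::euclidean_space"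
  assumes "abs_continuous_on_interval 0 t x"
  shows "AE s in lborel. s \<in> {0..t} \<longrightarrow> (x has_vector_derivative vector_derivative x (at s)) (at s)"
  by (rule AE_lborel_negligible[OF abs_continuous_vector_derivative_AE[OF abs_continuous_inner[OF assms]]]) auto

lemma has_caputo_derivative_inner:
  fixes x :: "real \<Rightarrow> 'a::euclidean_space"
  assumes ac: "abs_continuous_on_interval 0 t x" and x: "has_caputo_derivative \<alpha> x D t"
  shows "has_caputo_derivative \<alpha> (\<lambda>s. x s \<bullet> v) (D \<bullet> v) t"
proof -
  have ae: "AE s in lborel. s \<in> {0..t} \<longrightarrow> vector_derivative (\<lambda>s. x s \<bullet> v) (at s) = vector_derivative x (at s) \<bullet> v"
    using abs_continuous_differentiable_AE[OF ac]
    by eventually_elim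
      (auto intro!: vector_derivative_at bounded_linear.has_vector_derivative[OF bounded_linear_inner_left])
  let ?h = "\<lambda>s. indicat_real {0..t} s *\<^sub>R (t - s) powr (- \<alpha>) *\<^sub>R vector_derivative x (at s)"
  have int: "integrable lebesgue ?h" using x by (simp only: has_caputo_derivative_def set_integrable_def)
  have "integrable lebesgue (\<lambda>s. ?h s \<bullet> v)" "(\<integral>s. ?h s \<bullet> v \<partial>lebesgue) = (\<integral>s. ?h s \<partial>lebesgue) \<bullet> v"
    by (rule integrable_inner_left integral_inner_left, rule int)+
  then show ?thesis
    using x unfolding has_caputo_derivative_cong_AE[OF ae]
    by (simp add: has_caputo_derivative_def set_integrable_def set_lebesgue_integral_def mult.assoc)
qed

lemma has_caputo_derivative_diff:
  fixes x y :: "real \<Rightarrow> 'a::euclidean_space"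
  assumes ac: "abs_continuous_on_interval 0 t x" "abs_continuous_on_interval 0 t y"
    and x: "has_caputo_derivative \<alpha> x D t" and y: "has_caputo_derivative \<alpha> y E t"
  shows "has_caputo_derivative \<alpha> (\<lambda>s. x s - y s) (D - E) t"
proof -
  have ae: "AE s in lborel. s \<in> {0..t} \<longrightarrow> vector_derivative (\<lambda>s. x s - y s) (at s)
      = vector_derivative x (at s) - vector_derivative y (at s)"
    using abs_continuous_differentiable_AE[OF ac(1)] abs_continuous_differentiable_AE[OF ac(2)]
    by eventually_elim (auto intro!: vector_derivative_at has_vector_derivative_diff)
  show ?thesis
    unfolding has_caputo_derivative_cong_AE[OF ae] scaleR_diff_right
    using x y by (simp add: has_caputo_derivative_def set_integral_diff scaleR_diff_right)
qed

lemma has_caputo_derivative_componentwise: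
  fixes x :: "real \<Rightarrow> 'a::euclidean_space"
  assumes ac: "\<And>i. i \<in> Basis \<Longrightarrow> abs_continuous_on_interval 0 t (\<lambda>s. x s \<bullet> i)"
    and x: "\<And>i. i \<in> Basis \<Longrightarrow> has_caputo_derivative \<alpha> (\<lambda>s. x s \<bullet> i) (D \<bullet> i) t"
  shows "has_caputo_derivative \<alpha> x D t"
proof -
  have "AE s in lborel. s \<in> {0..t} \<longrightarrow> (x has_vector_derivative vector_derivative x (at s)) (at s)"
    by (rule AE_lborel_negligible[OF abs_continuous_vector_derivative_AE[OF ac]]) auto
  then have ae: "AE s in lborel. s \<in> {0..t} \<longrightarrow> vector_derivative (\<lambda>s. x s \<bullet> i) (at s) = vector_derivative x (at s) \<bullet> i" for i
    by eventually_elim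
      (auto intro!: vector_derivative_at bounded_linear.has_vector_derivative[OF bounded_linear_inner_left])
  let ?h = "\<lambda>s. indicat_real {0..t} s *\<^sub>R (t - s) powr (- \<alpha>) *\<^sub>R vector_derivative x (at s)"
  have i: "integrable lebesgue (\<lambda>s. ?h s \<bullet> i)" "D \<bullet> i = 1 / Gamma (1 - \<alpha>) * (\<integral>s. ?h s \<bullet> i \<partial>lebesgue)"
    if "i \<in> Basis" for i
    using x[OF that] unfolding has_caputo_derivative_cong_AE[OF ae]
    by (simp_all add: set_integrable_def set_lebesgue_integral_def mult.assoc)
  have "integrable lebesgue (\<lambda>s. \<Sum>i\<in>Basis. (?h s \<bullet> i) *\<^sub>R i)"
    by (intro Bochner_Integration.integrable_sum integrable_scaleR_left i)
  then have int: "integrable lebesgue ?h" by (simp only: euclidean_representation)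
  moreover have "D = (1 / Gamma (1 - \<alpha>)) *\<^sub>R (\<integral>s. ?h s \<partial>lebesgue)"
  proof (rule euclidean_eqI)
    fix b :: 'a assume "b \<in> Basis"
    from i(2)[OF this] show "D \<bullet> b = ((1 / Gamma (1 - \<alpha>)) *\<^sub>R (\<integral>s. ?h s \<partial>lebesgue)) \<bullet> b"
      using integral_inner_left[OF int, of b] by simp
  qed
  ultimately show ?thesis
    by (simp add: has_caputo_derivative_def set_integrable_def set_lebesgue_integral_def)
qed

section \<open>Caputo derivatives at maxima and along Volterra solutions\<close>

text \<open>After integration by parts, \<Gamma>(1 - \<alpha>) D is t^(-\<alpha>) (p(t) - p(0)) plus
  the integral of \<alpha> (t - r)^(-\<alpha>-1) (p(t) - p(r)): the first term is positive and the
  second integrand nonnegative.\<close>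

lemma Caputo_derivative_pos_at_maximum:
  fixes p :: "real \<Rightarrow> real"
  assumes \<alpha>: "0 < \<alpha>" "\<alpha> < 1" and "t > 0" and ac: "abs_continuous_on_interval 0 t p"
    and cap: "has_caputo_derivative \<alpha> p D t"
    and max: "\<And>s. 0 \<le> s \<Longrightarrow> s \<le> t \<Longrightarrow> p s \<le> p t" and less: "p 0 < p t"
  shows "D > 0"
proof -
  obtain g where g[measurable]: "g \<in> borel_measurable borel" and
    ae: "AE s in lborel. s \<in> {0..t} \<longrightarrow> (p has_real_derivative g s) (at s) \<and> vector_derivative p (at s) = g s"
    and ftc: "\<And>r. 0 \<le> r \<Longrightarrow> r \<le> t \<Longrightarrow> set_integrable lborel {0..r} g \<Longrightarrow> (LINT s:{0..r}|lborel. g s) = p r - p 0"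
    using abs_continuous_borel_derivative[OF ac] by blast
  have "AE s in lborel. s \<in> {0..t} \<longrightarrow> vector_derivative p (at s) = g s" using ae by (auto elim: eventually_mono)
  from cap[unfolded has_caputo_derivative_iff[OF g this]]
  have int: "set_integrable lborel {0..t} (\<lambda>s. (t - s) powr (- \<alpha>) * g s)"
    and D: "D = (LINT s:{0..t}|lborel. (t - s) powr (- \<alpha>) * g s) / Gamma (1 - \<alpha>)" by simp_all
  have gi: "set_integrable lborel {0..t} g" by (rule integrable_of_weighted[OF \<alpha>(1) \<open>t > 0\<close> g int])
  have gP: "(LINT s:{0..r}|lborel. g s) = p r - p 0" if "0 \<le> r" "r \<le> t" for r
    by (rule ftc[OF that set_integrable_subset[OF gi]]) (use that in auto)
  have "0 \<le> (LINT r:{0..t}|lborel. \<alpha> * (t - r) powr (- \<alpha> - 1) * ((LINT s:{0..t}|lborel. g s) - (LINT s:{0..r}|lborel. g s)))"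
    unfolding set_lebesgue_integral_def[of lborel "{0..t}" "\<lambda>r. \<alpha> * _ r * _ r"]
  proof (rule Bochner_Integration.integral_nonneg)
    fix r
    show "0 \<le> indicat_real {0..t} r *\<^sub>R (\<alpha> * (t - r) powr (- \<alpha> - 1) * ((LINT s:{0..t}|lborel. g s) - (LINT s:{0..r}|lborel. g s)))"
      using gP[of r] gP[of t] max[of r] \<alpha> \<open>t > 0\<close> by (auto simp: indicator_def)
  qed
  moreover have "0 < t powr (- \<alpha>) * (LINT s:{0..t}|lborel. g s)"
    using gP[of t] less \<open>t > 0\<close> by simp
  ultimately have "0 < (LINT s:{0..t}|lborel. (t - s) powr (- \<alpha>) * g s)"
    unfolding Caputo_integral_by_parts[OF \<alpha>(1) \<open>t > 0\<close> g int] by linarith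
  then show ?thesis unfolding D using \<alpha> by (simp add: Gamma_real_pos)
qed

text \<open>Fubini's theorem only gives the Caputo equation in integrated form: the Caputo integral
  \<open>I\<close> and \<Gamma>(1 - \<alpha>) f have the same integral over every [0, r]. Continuity
  of \<open>I\<close> away from 0 then allows differentiation at the given t.\<close>

theorem Volterra_imp_Caputo:
  fixes x f :: "real \<Rightarrow> real"
  assumes \<alpha>: "0 < \<alpha>" "\<alpha> < 1" and f: "continuous_on {0..} f"
    and sol: "\<And>t. t \<ge> 0 \<Longrightarrow> x t = x0 + RL_integral \<alpha> f t"
    and inc: "\<And>T. \<exists>C\<ge>0. \<forall>u v. 0 \<le> u \<longrightarrow> u \<le> v \<longrightarrow> v \<le> T \<longrightarrow> \<bar>x v - x u\<bar> \<le> C * (v powr \<alpha> - u powr \<alpha>)"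
  shows "0 \<le> a \<Longrightarrow> abs_continuous_on_interval a b x"
    and "0 < t \<Longrightarrow> has_caputo_derivative \<alpha> x (f t) t"
proof -
  have AC: "abs_continuous_on_interval a b x" if "0 \<le> a" for a b
  proof -
    obtain C where "C \<ge> 0" "\<And>u v. 0 \<le> u \<Longrightarrow> u \<le> v \<Longrightarrow> v \<le> b \<Longrightarrow> \<bar>x v - x u\<bar> \<le> C * (v powr \<alpha> - u powr \<alpha>)"
      using inc[of b] by blast
    then show ?thesis
      using that by (intro abs_continuous_comparison[OF abs_continuous_powr[OF \<alpha> that], where K = C])
        (fastforce intro: order_trans[OF _ mult_left_mono[OF abs_ge_self]])+
  qed
  then show "0 \<le> a \<Longrightarrow> abs_continuous_on_interval a b x" .
  assume "0 < t"
  \<comment> \<open>Leaves t in the interior, so that the final derivative at t is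
    two-sided.\<close>
  define T where "T = t + 1"
  have T: "0 < T" "t < T" using \<open>0 < t\<close> by (auto simp: T_def)
  obtain C where C: "C \<ge> 0" "\<And>u v. 0 \<le> u \<Longrightarrow> u \<le> v \<Longrightarrow> v \<le> T \<Longrightarrow> \<bar>x v - x u\<bar> \<le> C * (v powr \<alpha> - u powr \<alpha>)"
    using inc[of T] by blast
  have x0: "x 0 = x0" using sol[of 0] \<alpha> by simp
  have xcont: "continuous_on {0..} x"
    using continuous_on_RL_integral[OF \<alpha>(1) f] sol
    by (subst continuous_on_cong[OF refl, of _ _ "\<lambda>t. x0 + RL_integral \<alpha> f t"]) (auto intro!: continuous_intros)
  obtain g0 where g0[measurable]: "g0 \<in> borel_measurable borel" and
    ae: "AE s in lborel. s \<in> {0..T} \<longrightarrow> (x has_real_derivative g0 s) (at s) \<and> vector_derivative x (at s) = g0 s"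
    and ftc: "\<And>r. 0 \<le> r \<Longrightarrow> r \<le> T \<Longrightarrow> set_integrable lborel {0..r} g0 \<Longrightarrow> (LINT s:{0..r}|lborel. g0 s) = x r - x 0"
    by (rule abs_continuous_borel_derivative[OF AC[OF order_refl, of T]]) blast
  \<comment> \<open>Truncation makes the bound by C \<alpha> s^(\<alpha>-1) hold everywhere instead
    of almost everywhere, and keeps \<open>g\<close> Borel; almost everywhere on [0, T] nothing
    changes.\<close>
  define g where "g s = (if 0 < s \<and> s < T \<and> \<bar>g0 s\<bar> \<le> C * (\<alpha> * s powr (\<alpha> - 1)) then g0 s else 0)" for s
  have g[measurable]: "g \<in> borel_measurable borel" unfolding g_def by measurable
  \<comment> \<open>The increment bound compares the difference quotients of x with those of
    t^\<alpha>; the inequality survives in the limit from the right.\<close>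
  have bound: "\<bar>D\<bar> \<le> C * (\<alpha> * s powr (\<alpha> - 1))" if s: "0 < s" "s < T" and D: "(x has_real_derivative D) (at s)" for s D
  proof (rule tendsto_le[OF trivial_limit_at_right_real])
    have "((\<lambda>h. (x (s + h) - x s) / h) \<longlongrightarrow> D) (at 0)" using D by (simp add: DERIV_def)
    then show "((\<lambda>h. \<bar>(x (s + h) - x s) / h\<bar>) \<longlongrightarrow> \<bar>D\<bar>) (at_right 0)"
      by (intro tendsto_intros) (rule filterlim_at_split[THEN iffD1, THEN conjunct2])
    have "((\<lambda>t. t powr \<alpha>) has_real_derivative \<alpha> * s powr (\<alpha> - 1)) (at s)"
      using has_real_derivative_powr[of s \<alpha>] s by simp
    then have "((\<lambda>h. ((s + h) powr \<alpha> - s powr \<alpha>) / h) \<longlongrightarrow> \<alpha> * s powr (\<alpha> - 1)) (at 0)" by (simp add: DERIV_def)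
    then have "((\<lambda>h. ((s + h) powr \<alpha> - s powr \<alpha>) / h) \<longlongrightarrow> \<alpha> * s powr (\<alpha> - 1)) (at_right 0)"
      by (rule filterlim_at_split[THEN iffD1, THEN conjunct2])
    then show "((\<lambda>h. C * (((s + h) powr \<alpha> - s powr \<alpha>) / h)) \<longlongrightarrow> C * (\<alpha> * s powr (\<alpha> - 1))) (at_right 0)"
      by (intro tendsto_intros)
    have "\<forall>\<^sub>F h in at_right 0. h \<in> {0<..<T - s}" using s by (intro eventually_at_right_real) auto
    then show "\<forall>\<^sub>F h in at_right 0. \<bar>(x (s + h) - x s) / h\<bar> \<le> C * (((s + h) powr \<alpha> - s powr \<alpha>) / h)"
    proof eventually_elim
      case (elim h)
      then have "\<bar>x (s + h) - x s\<bar> / h \<le> C * ((s + h) powr \<alpha> - s powr \<alpha>) / h"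
        using C(2)[of s "s + h"] s by (intro divide_right_mono) auto
      then show ?case using elim by (simp add: abs_divide)
    qed
  qed
  have aeg: "AE s in lborel. s \<in> {0..T} \<longrightarrow> vector_derivative x (at s) = g s \<and> g s = g0 s"
    using ae AE_lborel_singleton[of 0] AE_lborel_singleton[of T]
    by eventually_elim (use bound in \<open>auto simp: g_def\<close>)
  have gle: "\<bar>g s\<bar> \<le> C * (\<alpha> * s powr (\<alpha> - 1))" for s using C(1) \<alpha> by (auto simp: g_def)
  \<comment> \<open>The integrand is dominated by a multiple of a Beta kernel, the singularity of
    \<open>g\<close> at 0 being of order \<alpha> - 1.\<close>
  have wint: "set_integrable lborel {0..r} (\<lambda>s. (r - s) powr (c - 1) * g s)" if r: "0 < r" and c: "c > 0" for r c
    unfolding set_integrable_def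
  proof (rule Bochner_Integration.integrable_bound)
    show "integrable lborel (\<lambda>s. C * \<alpha> * (indicat_real {0..r} s *\<^sub>R ((r - s) powr (c - 1) * s powr (\<alpha> - 1))))"
      using set_integrable_Beta_kernel(1)[OF c \<alpha>(1) r] by (simp add: set_integrable_def)
    have "norm (indicat_real {0..r} s *\<^sub>R ((r - s) powr (c - 1) * g s))
      \<le> norm (C * \<alpha> * (indicat_real {0..r} s *\<^sub>R ((r - s) powr (c - 1) * s powr (\<alpha> - 1))))" for s
      using mult_left_mono[OF gle[of s], of "(r - s) powr (c - 1)"] C(1) \<alpha>
      by (auto simp: indicator_def abs_mult mult_ac)
    then show "AE s in lborel. norm (indicat_real {0..r} s *\<^sub>R ((r - s) powr (c - 1) * g s))
      \<le> norm (C * \<alpha> * (indicat_real {0..r} s *\<^sub>R ((r - s) powr (c - 1) * s powr (\<alpha> - 1))))" by simp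
  qed simp
  have \<alpha>1: "1 - \<alpha> > 0" using \<alpha> by simp
  have wint\<alpha>: "set_integrable lborel {0..r} (\<lambda>s. (r - s) powr (- \<alpha>) * g s)" if "0 < r" for r
    using wint[OF that \<alpha>1] by simp
  have gP: "(LINT s:{0..r}|lborel. g s) = x r - x0" if r: "0 \<le> r" "r \<le> T" for r
  proof (cases "r = 0")
    case True
    have "(LINT s:{0..0}|lborel. g s) = 0"
      by (rule trans[OF set_lebesgue_integral_cong[of _ _ _ "\<lambda>s. 0"]]) (auto simp: g_def)
    then show ?thesis using True x0 by simp
  next
    case False
    then have r0: "0 < r" using r by simp
    have gi: "set_integrable lborel {0..r} g"
      by (rule integrable_of_weighted[OF \<alpha>(1) r0 g wint\<alpha>[OF r0]])
    have eq: "AE s\<in>{0..r} in lborel. g s = g0 s"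
      using aeg by eventually_elim (use r in auto)
    have "set_integrable lborel {0..r} g0"
      using gi set_integrable_cong_AE[OF _ _ eq] g g0 by simp
    moreover have "(LINT s:{0..r}|lborel. g s) = (LINT s:{0..r}|lborel. g0 s)"
      by (rule set_lebesgue_integral_cong_AE) (use g g0 eq in auto)
    ultimately show ?thesis using ftc[OF r] x0 by simp
  qed
  define I where "I r = (LINT s:{0..r}|lborel. (r - s) powr (- \<alpha>) * g s)" for r
  \<comment> \<open>The integral left by integration by parts, rescaled to [0, 1] so that its
    singularity stays at s = 1 while r varies; this prepares the proof that \<open>I\<close> is
    continuous.\<close>
  define Kf where "Kf r = (LINT s:{0..1}|lborel. (1 - s) powr (- \<alpha> - 1) * (x r - x (r * s)))" for r
  have I_eq: "I r = r powr (- \<alpha>) * (x r - x0) + \<alpha> * (r powr (- \<alpha>) * Kf r)" if r: "0 < r" "r \<le> T" for r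
  proof -
    have "I r = r powr (- \<alpha>) * (LINT s:{0..r}|lborel. g s) +
      (LINT s:{0..r}|lborel. \<alpha> * (r - s) powr (- \<alpha> - 1) * ((LINT s:{0..r}|lborel. g s) - (LINT s:{0..s}|lborel. g s)))"
      unfolding I_def by (rule Caputo_integral_by_parts[OF \<alpha>(1) r(1) g wint\<alpha>[OF r(1)]])
    also have "(LINT s:{0..r}|lborel. \<alpha> * (r - s) powr (- \<alpha> - 1) * ((LINT s:{0..r}|lborel. g s) - (LINT s:{0..s}|lborel. g s)))
      = (LINT s:{0..r}|lborel. \<alpha> * (r - s) powr (- \<alpha> - 1) * (x r - x s))"
      by (rule set_lebesgue_integral_cong) (use gP r in auto)
    also have "\<dots> = r * (LINT s:{0..1}|lborel. \<alpha> * (r - r * s) powr (- \<alpha> - 1) * (x r - x (r * s)))"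
      by (rule set_lebesgue_integral_rescale[OF r(1)])
    also have "(LINT s:{0..1}|lborel. \<alpha> * (r - r * s) powr (- \<alpha> - 1) * (x r - x (r * s)))
      = (LINT s:{0..1}|lborel. (\<alpha> * r powr (- \<alpha> - 1)) * ((1 - s) powr (- \<alpha> - 1) * (x r - x (r * s))))"
    proof (intro set_lebesgue_integral_cong allI impI)
      fix s :: real
      have "(r * (1 - s)) powr (- \<alpha> - 1) = r powr (- \<alpha> - 1) * (1 - s) powr (- \<alpha> - 1)" by (simp add: powr_mult)
      then show "\<alpha> * (r - r * s) powr (- \<alpha> - 1) * (x r - x (r * s))
        = (\<alpha> * r powr (- \<alpha> - 1)) * ((1 - s) powr (- \<alpha> - 1) * (x r - x (r * s)))"
        by (simp add: right_diff_distrib[of r])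
    qed simp
    also have "\<dots> = (\<alpha> * r powr (- \<alpha> - 1)) * Kf r" by (simp add: Kf_def)
    also have "r * ((\<alpha> * r powr (- \<alpha> - 1)) * Kf r) = \<alpha> * ((r * r powr (- \<alpha> - 1)) * Kf r)" by simp
    also have "r * r powr (- \<alpha> - 1) = r powr (- \<alpha>)"
      using r powr_mult_base[of r "- \<alpha> - 1"] by simp
    finally show ?thesis using gP[of r] r by simp
  qed
  have Kc: "continuous_on {0..T} Kf"
    unfolding continuous_on_sequentially
  proof (intro ballI allI impI, elim conjE)
    fix r :: real and X :: "nat \<Rightarrow> real"
    assume r: "r \<in> {0..T}" and X: "\<forall>n. X n \<in> {0..T}" "X \<longlonglongrightarrow> r"
    have xm: "(\<lambda>s. indicat_real {0..1} s *\<^sub>R ((1 - s) powr (- \<alpha> - 1) * (x q - x (q * s)))) \<in> borel_measurable lborel"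
      if q: "0 \<le> q" for q
    proof -
      have "continuous_on {0..1} (\<lambda>s. x q - x (q * s))"
        by (intro continuous_intros continuous_on_compose2[OF xcont]) (use q in auto)
      then have [measurable]: "(\<lambda>s. indicat_real {0..1} s *\<^sub>R (x q - x (q * s))) \<in> borel_measurable borel"
        by (intro borel_measurable_continuous_on_indicator) auto
      have "(\<lambda>s. (1 - s) powr (- \<alpha> - 1) * (indicat_real {0..1} s *\<^sub>R (x q - x (q * s)))) \<in> borel_measurable lborel"
        by measurable
      then show ?thesis by (simp add: mult.left_commute)
    qed
    show "((Kf \<circ> X) \<longlongrightarrow> Kf r) sequentially"
      unfolding comp_def Kf_def set_lebesgue_integral_def
    proof (rule integral_dominated_convergence)
      show "integrable lborel (\<lambda>s. (C * T powr \<alpha>) * (indicat_real {0..1} s *\<^sub>R (1 - s) powr (1 - \<alpha> - 1)))"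
        using set_integrable_kernel_unit[OF \<alpha>1] by (simp add: set_integrable_def)
      show "AE s in lborel. (\<lambda>n. indicat_real {0..1} s *\<^sub>R ((1 - s) powr (- \<alpha> - 1) * (x (X n) - x (X n * s))))
        \<longlonglongrightarrow> indicat_real {0..1} s *\<^sub>R ((1 - s) powr (- \<alpha> - 1) * (x r - x (r * s)))"
      proof (rule AE_I2)
        fix s :: real
        show "(\<lambda>n. indicat_real {0..1} s *\<^sub>R ((1 - s) powr (- \<alpha> - 1) * (x (X n) - x (X n * s))))
          \<longlonglongrightarrow> indicat_real {0..1} s *\<^sub>R ((1 - s) powr (- \<alpha> - 1) * (x r - x (r * s)))"
        proof (cases "s \<in> {0..1}")
          case True
          have "(\<lambda>n. x (X n)) \<longlonglongrightarrow> x r" using X r by (intro continuous_on_tendsto_compose[OF xcont]) auto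
          moreover have "(\<lambda>n. x (X n * s)) \<longlonglongrightarrow> x (r * s)"
            using True X r by (intro continuous_on_tendsto_compose[OF xcont] tendsto_intros) auto
          ultimately show ?thesis by (intro tendsto_intros)
        qed simp
      qed
      fix n
      have "norm (indicat_real {0..1} s *\<^sub>R ((1 - s) powr (- \<alpha> - 1) * (x (X n) - x (X n * s))))
        \<le> (C * T powr \<alpha>) * (indicat_real {0..1} s *\<^sub>R (1 - s) powr (1 - \<alpha> - 1))" for s
      proof (cases "0 \<le> s \<and> s < 1")
        case True
        have Xn: "0 \<le> X n" "X n \<le> T" using X by auto
        \<comment> \<open>The kernel (1 - s)^(-\<alpha>-1) alone is not integrable. The increment
          bound and s \<le> s^\<alpha> on [0, 1] contribute a factor 1 - s, which leaves the
          integrable (1 - s)^(-\<alpha>).\<close>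
        have "\<bar>x (X n) - x (X n * s)\<bar> \<le> C * (X n powr \<alpha> - (X n * s) powr \<alpha>)"
          using True Xn by (intro C(2)) (auto intro: mult_left_le)
        also have "(X n * s) powr \<alpha> = X n powr \<alpha> * s powr \<alpha>" by (simp add: powr_mult)
        also have "C * (X n powr \<alpha> - X n powr \<alpha> * s powr \<alpha>) = C * (X n powr \<alpha> * (1 - s powr \<alpha>))"
          by (simp add: algebra_simps)
        also have "\<dots> \<le> C * (T powr \<alpha> * (1 - s))"
        proof (intro mult_left_mono mult_mono C(1))
          show "X n powr \<alpha> \<le> T powr \<alpha>" using Xn \<alpha> by (intro powr_mono2) auto
          have "s powr 1 \<le> s powr \<alpha>" using True \<alpha> by (intro powr_mono') auto
          then show "1 - s powr \<alpha> \<le> 1 - s" using True by simp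
          show "0 \<le> 1 - s powr \<alpha>" using True \<alpha> by (simp add: powr_le1)
        qed simp
        finally have "(1 - s) powr (- \<alpha> - 1) * \<bar>x (X n) - x (X n * s)\<bar>
          \<le> (1 - s) powr (- \<alpha> - 1) * (C * (T powr \<alpha> * (1 - s)))" by (rule mult_left_mono) simp
        also have "\<dots> = C * T powr \<alpha> * ((1 - s) * (1 - s) powr (- \<alpha> - 1))" by simp
        also have "(1 - s) * (1 - s) powr (- \<alpha> - 1) = (1 - s) powr (- \<alpha>)"
          using True powr_mult_base[of "1 - s" "- \<alpha> - 1"] by simp
        finally show ?thesis using True by (simp add: abs_mult)
      qed (auto simp: indicator_def)
      then show "AE s in lborel. norm (indicat_real {0..1} s *\<^sub>R ((1 - s) powr (- \<alpha> - 1) * (x (X n) - x (X n * s))))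
        \<le> (C * T powr \<alpha>) * (indicat_real {0..1} s *\<^sub>R (1 - s) powr (1 - \<alpha> - 1))" by simp
    qed (use xm r X in auto)
  qed
  have Ic: "continuous_on {0<..T} I"
  proof -
    have "continuous_on {0<..T} (\<lambda>r. r powr (- \<alpha>) * (x r - x0) + \<alpha> * (r powr (- \<alpha>) * Kf r))"
      by (intro continuous_intros continuous_on_subset[OF xcont] continuous_on_subset[OF Kc]) auto
    then show ?thesis by (subst continuous_on_cong[OF refl I_eq]) auto
  qed
  define G1 where "G1 = Gamma (1 - \<alpha>)"
  have G1: "G1 > 0" using \<alpha> by (simp add: G1_def)
  \<comment> \<open>Extension by 0 turns f, continuous only on [0, \<infinity>), into a Borel
    function on the line.\<close>
  define f' where "f' r = (if 0 \<le> r then f r else 0)" for r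
  have f'm: "f' \<in> borel_measurable borel"
  proof -
    have "f' = (\<lambda>r. indicat_real {0..} r *\<^sub>R f r)" by (auto simp: fun_eq_iff f'_def indicator_def)
    then show ?thesis using borel_measurable_continuous_on_indicator[OF _ f] by simp
  qed
  have fint: "set_integrable lborel {0..r} f'" for r
  proof -
    have "set_integrable lborel {0..r} f"
      by (intro borel_integrable_atLeastAtMost' continuous_on_subset[OF f]) auto
    then show ?thesis by (subst set_integrable_cong[OF refl refl, of _ _ f]) (auto simp: f'_def)
  qed
  \<comment> \<open>The semigroup law is applied to \<open>g\<close> with the orders 1 and 1 -
    \<alpha> in either sequence, so that the integral of \<open>I\<close> and the convolution of (r
    - s)^(-\<alpha>) with x - x0 reduce to the same integral. Since x - x0 is the fractional
    integral of f, the law with orders 1 - \<alpha> and \<alpha> turns the latter into \<Gamma>(1 -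
    \<alpha>) times the integral of f.\<close>
  have main: "set_integrable lborel {0..r} I \<and> (LINT s:{0..r}|lborel. I s) = G1 * (LINT s:{0..r}|lborel. f' s)"
    if r: "0 < r" "r \<le> T" for r
  proof -
    have w: "set_integrable lborel {0..r} (\<lambda>s. (r - s) powr (1 + (1 - \<alpha>) - 1) * g s)"
      "set_integrable lborel {0..r} (\<lambda>s. (r - s) powr ((1 - \<alpha>) + 1 - 1) * g s)"
      using wint[of r "2 - \<alpha>"] r \<alpha> by simp_all
    note A = fractional_integral_semigroup[OF zero_less_one \<alpha>1 g w(1)]
    note B = fractional_integral_semigroup[OF \<alpha>1 zero_less_one g w(2)]
    have aeq: "AE s\<in>{0..r} in lborel. (r - s) powr (1 - 1) * (LINT q:{0..s}|lborel. (s - q) powr (1 - \<alpha> - 1) * g q) = I s"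
      using AE_lborel_singleton[of r] by eventually_elim (auto simp: I_def)
    have Im: "set_borel_measurable lborel {0..r} I"
    proof -
      have "{0<..r} \<subseteq> {0<..T}" using r by auto
      then have "set_borel_measurable lborel {0<..r} I"
        unfolding set_borel_measurable_def
        using borel_measurable_continuous_on_indicator[OF _ continuous_on_subset[OF Ic], of "{0<..r}"] r by auto
      moreover have "I 0 = 0" 
        unfolding I_def by (rule trans[OF set_lebesgue_integral_cong[of _ _ _ "\<lambda>s. 0"]]) (auto simp: g_def)
      then have "indicat_real {0<..r} s *\<^sub>R I s = indicat_real {0..r} s *\<^sub>R I s" for s
        by (cases "s = 0") (auto simp: indicator_def)
      then have "(\<lambda>s. indicat_real {0<..r} s *\<^sub>R I s) = (\<lambda>s. indicat_real {0..r} s *\<^sub>R I s)" by (rule ext)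
      ultimately show ?thesis unfolding set_borel_measurable_def by (simp only:)
    qed
    have Lm: "set_borel_measurable lborel {0..r} (\<lambda>s. (r - s) powr (1 - 1) * (LINT q:{0..s}|lborel. (s - q) powr (1 - \<alpha> - 1) * g q))"
      using A(1) by (auto simp: set_integrable_def set_borel_measurable_def)
    have eq': "AE s in lborel. indicat_real {0..r} s *\<^sub>R ((r - s) powr (1 - 1) * (LINT q:{0..s}|lborel. (s - q) powr (1 - \<alpha> - 1) * g q))
        = indicat_real {0..r} s *\<^sub>R I s"
      using aeq by eventually_elim (auto simp: indicator_def)
    have 1: "set_integrable lborel {0..r} I"
      using A(1) unfolding set_integrable_def
      by (rule iffD1[OF integrable_cong_AE[OF Lm[unfolded set_borel_measurable_def] Im[unfolded set_borel_measurable_def] eq']])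
    have 2: "(LINT s:{0..r}|lborel. I s) = Beta 1 (1 - \<alpha>) * (LINT s:{0..r}|lborel. (r - s) powr (1 + (1 - \<alpha>) - 1) * g s)"
      unfolding A(2)[symmetric] unfolding set_lebesgue_integral_def[of _ "{0..r}"]
      by (rule integral_cong_AE[OF Lm[unfolded set_borel_measurable_def] Im[unfolded set_borel_measurable_def] eq', symmetric])
    have 3: "(LINT s:{0..r}|lborel. (r - s) powr (1 - \<alpha> - 1) * (x s - x0))
        = Beta (1 - \<alpha>) 1 * (LINT s:{0..r}|lborel. (r - s) powr ((1 - \<alpha>) + 1 - 1) * g s)"
      unfolding B(2)[symmetric]
    proof (intro set_lebesgue_integral_cong allI impI)
      fix s assume s: "s \<in> {0..r}"
      have "(LINT q:{0..s}|lborel. (s - q) powr (1 - 1) * g q) = (LINT q:{0..s}|lborel. g q)"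
      proof (rule set_lebesgue_integral_cong_AE)
        show "AE q\<in>{0..s} in lborel. (s - q) powr (1 - 1) * g q = g q"
          using AE_lborel_singleton[of s] by eventually_elim auto
      qed auto
      then show "(r - s) powr (1 - \<alpha> - 1) * (x s - x0) = (r - s) powr (1 - \<alpha> - 1) * (LINT q:{0..s}|lborel. (s - q) powr (1 - 1) * g q)"
        using gP[of s] s r by simp
    qed simp
    have 4: "(LINT s:{0..r}|lborel. (r - s) powr (1 - \<alpha> - 1) * (x s - x0))
        = Beta (1 - \<alpha>) \<alpha> / Gamma \<alpha> * (LINT s:{0..r}|lborel. f' s)"
    proof -
      have F: "AE s\<in>{0..r} in lborel. (r - s) powr ((1 - \<alpha>) + \<alpha> - 1) * f' s = f' s"
        using AE_lborel_singleton[of r] by eventually_elim auto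
      have Fi: "set_integrable lborel {0..r} (\<lambda>s. (r - s) powr ((1 - \<alpha>) + \<alpha> - 1) * f' s)"
        using fint[of r] set_integrable_cong_AE[OF _ _ F] f'm by simp
      have "(LINT s:{0..r}|lborel. (r - s) powr (1 - \<alpha> - 1) * (x s - x0))
        = (LINT s:{0..r}|lborel. (1 / Gamma \<alpha>) * ((r - s) powr (1 - \<alpha> - 1) * (LINT q:{0..s}|lborel. (s - q) powr (\<alpha> - 1) * f' q)))"
      proof (intro set_lebesgue_integral_cong allI impI)
        fix s assume s: "s \<in> {0..r}"
        have "x s - x0 = (LINT q:{0..s}|lborel. (s - q) powr (\<alpha> - 1) * f' q) / Gamma \<alpha>"
        proof (cases "s = 0")
          case True
          have "(LINT q:{0..0}|lborel. (0 - q) powr (\<alpha> - 1) * f' q) = 0"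
            by (rule trans[OF set_lebesgue_integral_cong[of _ _ _ "\<lambda>s. 0"]]) auto
          then show ?thesis using True x0 by simp
        next
          case False
          then have s0: "0 < s" using s by simp
          have "x s - x0 = RL_integral \<alpha> f s" using sol[of s] s by simp
          also have "\<dots> = (LINT q:{0..s}|lborel. (s - q) powr (\<alpha> - 1) * f q) / Gamma \<alpha>"
            by (rule RL_integral_convolution[OF s0])
          also have "(LINT q:{0..s}|lborel. (s - q) powr (\<alpha> - 1) * f q) = (LINT q:{0..s}|lborel. (s - q) powr (\<alpha> - 1) * f' q)"
            by (rule set_lebesgue_integral_cong) (auto simp: f'_def)
          finally show ?thesis .
        qed
        then show "(r - s) powr (1 - \<alpha> - 1) * (x s - x0)
          = (1 / Gamma \<alpha>) * ((r - s) powr (1 - \<alpha> - 1) * (LINT q:{0..s}|lborel. (s - q) powr (\<alpha> - 1) * f' q))" by simp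
      qed simp
      also have "\<dots> = (1 / Gamma \<alpha>) * (Beta (1 - \<alpha>) \<alpha> * (LINT s:{0..r}|lborel. (r - s) powr ((1 - \<alpha>) + \<alpha> - 1) * f' s))"
        unfolding fractional_integral_semigroup(2)[OF \<alpha>1 \<alpha>(1) f'm Fi, symmetric]
        by (rule set_integral_mult_right)
      also have "(LINT s:{0..r}|lborel. (r - s) powr ((1 - \<alpha>) + \<alpha> - 1) * f' s) = (LINT s:{0..r}|lborel. f' s)"
        by (rule set_lebesgue_integral_cong_AE) (use F f'm in auto)
      finally show ?thesis by simp
    qed
    have "Beta (1 - \<alpha>) \<alpha> / Gamma \<alpha> = G1"
      using Gamma_real_neq_0[OF \<alpha>(1)] by (simp add: Beta_def G1_def)
    then have "(LINT s:{0..r}|lborel. I s) = G1 * (LINT s:{0..r}|lborel. f' s)"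
      using 2 3 4 by (simp add: Beta_commute[of 1])
    with 1 show ?thesis by blast
  qed
  define k where "k s = I s - G1 * f s" for s
  \<comment> \<open>\<open>I\<close> is known to be continuous only for positive arguments, so the
    integral to be differentiated starts at a point strictly between 0 and t.\<close>
  define e where "e = t / 2"
  have e: "0 < e" "e < t" using \<open>0 < t\<close> by (auto simp: e_def)
  have kc: "continuous_on {e..T} k"
    unfolding k_def by (intro continuous_intros continuous_on_subset[OF Ic] continuous_on_subset[OF f]) (use e in auto)
  have k0: "integral {e..r} k = 0" if r: "r \<in> {e..T}" for r
  proof -
    have r': "0 < r" "r \<le> T" "e \<le> r" "e \<le> T" using r e by auto
    have ki: "set_integrable lborel {0..q} (\<lambda>s. I s - G1 * f' s)" "(LINT s:{0..q}|lborel. I s - G1 * f' s) = 0"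
      if "0 < q" "q \<le> T" for q
      using main[OF that] fint[of q] by (auto simp: set_integral_diff)
    have "(LINT s:{0..r}|lborel. I s - G1 * f' s) = (LINT s:{0..e}|lborel. I s - G1 * f' s) + (LINT s:{e<..r}|lborel. I s - G1 * f' s)"
    proof -
      have "{0..r} = {0..e} \<union> {e<..r}" using r' e by auto
      then show ?thesis
        using set_integral_Un[of "{0..e}" "{e<..r}" lborel "\<lambda>s. I s - G1 * f' s"]
          set_integrable_subset[OF ki(1)[OF r'(1,2)]] by (auto simp: ivl_disj_int)
    qed
    then have z: "(LINT s:{e<..r}|lborel. I s - G1 * f' s) = 0" using ki(2) r' e by simp
    have ksi: "set_integrable lborel {e..r} k"
      by (intro borel_integrable_atLeastAtMost' continuous_on_subset[OF kc]) (use r in auto)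
    have "integral {e..r} k = (LINT s:{e..r}|lborel. k s)"
      using set_borel_integral_eq_integral(2)[OF ksi] by simp
    also have "\<dots> = (LINT s:{e<..r}|lborel. I s - G1 * f' s)"
      unfolding set_lebesgue_integral_def
    proof (rule integral_cong_AE)
      show "(\<lambda>s. indicat_real {e..r} s *\<^sub>R k s) \<in> borel_measurable lborel"
        using ksi unfolding set_integrable_def by (rule borel_measurable_integrable)
      show "(\<lambda>s. indicat_real {e<..r} s *\<^sub>R (I s - G1 * f' s)) \<in> borel_measurable lborel"
      proof -
        have "set_integrable lborel {e<..r} (\<lambda>s. I s - G1 * f' s)"
          by (rule set_integrable_subset[OF ki(1)[OF r'(1,2)]]) (use e in auto)
        then show ?thesis unfolding set_integrable_def by (rule borel_measurable_integrable)
      qed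
      show "AE s in lborel. indicat_real {e..r} s *\<^sub>R k s = indicat_real {e<..r} s *\<^sub>R (I s - G1 * f' s)"
        using AE_lborel_singleton[of e] by eventually_elim (use e in \<open>auto simp: indicator_def k_def f'_def\<close>)
    qed
    finally show ?thesis using z by simp
  qed
  have tin: "t \<in> {e..T}" using e T by auto
  have "((\<lambda>r. integral {e..r} k) has_real_derivative k t) (at t within {e..T})"
    by (rule integral_has_real_derivative[OF kc tin])
  then have "((\<lambda>r. 0) has_real_derivative k t) (at t within {e..T})"
    by (rule has_field_derivative_transform_within[OF _ zero_less_one tin]) (use k0 in auto)
  moreover have "at t within {e..T} = at t"
    using e T by (intro at_within_interior) (simp add: interior_atLeastAtMost_real)
  ultimately have "k t = 0" using DERIV_unique[OF _ DERIV_const] by metis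
  then have It: "I t = G1 * f t" by (simp add: k_def)
  have aet: "AE s in lborel. s \<in> {0..t} \<longrightarrow> vector_derivative x (at s) = g s"
    using aeg by eventually_elim (use T in auto)
  show "has_caputo_derivative \<alpha> x (f t) t"
    unfolding has_caputo_derivative_iff[OF g aet]
    using wint\<alpha>[OF \<open>0 < t\<close>] It G1 by (simp add: I_def G1_def[symmetric])
qed

section \<open>The Mittag-Leffler function\<close>

text \<open>Splitting the Gamma integral at \<open>R\<close> shows that \<open>1 / \<Gamma>(x + 1)\<close> decays faster than
  \<open>R\<^bsup>-x\<^esup>\<close> for every \<open>R\<close>.\<close>

lemma Gamma_lower_bound:
  assumes "x \<ge> 0" "R > (0::real)"
  shows "R powr x * exp (- R) \<le> Gamma (x + 1)"
proof -
  have 1: "((\<lambda>t. t powr x / exp t) has_integral Gamma (x + 1)) {0..}"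
    using Gamma_integral_real[of "x + 1"] assms by simp
  have 2: "((\<lambda>t. R powr x * exp (- t)) has_integral R powr x * exp (- R)) {R..}"
    using has_integral_mult_right[OF has_integral_exp_minus_to_infinity[of 1 R], of "R powr x"] by simp
  have 3: "((\<lambda>t. if t \<in> {R..} then R powr x * exp (- t) else 0) has_integral R powr x * exp (- R)) {0..}"
    by (subst has_integral_restrict) (use 2 assms in auto)
  show ?thesis
  proof (rule has_integral_le[OF 3 1])
    fix t :: real assume "t \<in> {0..}"
    show "(if t \<in> {R..} then R powr x * exp (- t) else 0) \<le> t powr x / exp t"
    proof (cases "t \<in> {R..}")
      case True
      then have "R powr x \<le> t powr x" using assms by (intro powr_mono2) auto
      then show ?thesis using True by (simp add: exp_minus divide_inverse mult_right_mono)
    qed simp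
  qed
qed

lemma summable_mittag_leffler:
  fixes z :: real
  assumes "\<alpha> > 0"
  shows "summable (\<lambda>k. z ^ k / Gamma (\<alpha> * real k + 1))"
proof -
  \<comment> \<open>With R^\<alpha> = 2 |z| + 1 the lower bound for Gamma makes the k-th term at
    most e^R (|z| / (2 |z| + 1))^k, hence geometric with ratio at most 1/2.\<close>
  define R where "R = (2 * \<bar>z\<bar> + 1) powr (1 / \<alpha>)"
  have R: "R > 0" "R powr \<alpha> = 2 * \<bar>z\<bar> + 1" using assms by (auto simp: R_def powr_powr)
  have bound: "norm (z ^ k / Gamma (\<alpha> * real k + 1)) \<le> exp R * (1 / 2) ^ k" for k
  proof -
    have "R powr (\<alpha> * real k) * exp (- R) \<le> Gamma (\<alpha> * real k + 1)"
      using assms R by (intro Gamma_lower_bound) auto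
    moreover have "R powr (\<alpha> * real k) = (2 * \<bar>z\<bar> + 1) ^ k"
      using R by (simp add: powr_powr[symmetric] powr_realpow)
    ultimately have G: "(2 * \<bar>z\<bar> + 1) ^ k * exp (- R) \<le> Gamma (\<alpha> * real k + 1)" by simp
    have P: "(2 * \<bar>z\<bar> + 1) ^ k * exp (- R) > 0" by (intro mult_pos_pos zero_less_power) auto
    have GP: "Gamma (\<alpha> * real k + 1) > 0" using G P by linarith
    have "norm (z ^ k / Gamma (\<alpha> * real k + 1)) = \<bar>z\<bar> ^ k / Gamma (\<alpha> * real k + 1)"
      using GP by (simp only: real_norm_def abs_divide power_abs abs_of_pos)
    also have "\<dots> \<le> \<bar>z\<bar> ^ k / ((2 * \<bar>z\<bar> + 1) ^ k * exp (- R))"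
      using G P GP by (intro divide_left_mono mult_pos_pos) auto
    also have "\<dots> = exp R * (\<bar>z\<bar> / (2 * \<bar>z\<bar> + 1)) ^ k" by (simp add: exp_minus power_divide field_simps)
    also have "\<dots> \<le> exp R * (1 / 2) ^ k"
      by (intro mult_left_mono power_mono) (auto simp: field_simps)
    finally show ?thesis .
  qed
  show ?thesis
    by (rule summable_comparison_test'[where g = "\<lambda>k. exp R * (1 / 2) ^ k" and N = 0])
      (use bound in \<open>auto intro!: summable_mult summable_geometric\<close>)
qed

lemma mittag_leffler_0 [simp]: "mittag_leffler \<alpha> 0 = 1"
  using powser_zero[of "\<lambda>k. 1 / Gamma (\<alpha> * real k + 1)"] by (simp add: mittag_leffler_def Gamma_1)

lemma continuous_on_mittag_leffler:
  assumes "\<alpha> > 0"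
  shows "continuous_on A (mittag_leffler \<alpha>)"
proof (rule continuous_at_imp_continuous_on, rule ballI)
  fix z
  have "isCont (\<lambda>z. \<Sum>k. (1 / Gamma (\<alpha> * real k + 1)) * z ^ k) z"
    by (rule isCont_powser[where K = "\<bar>z\<bar> + 1"]) (use summable_mittag_leffler[OF assms] in auto)
  then show "isCont (mittag_leffler \<alpha>) z" by (simp add: mittag_leffler_def[abs_def])
qed

text \<open>Fractional integration of order \<alpha>, followed by multiplication with c, sends each
  term of the series to the next one by the power rule; only the initial 1 is lost.\<close>

lemma mittag_leffler_Volterra:
  assumes \<alpha>: "\<alpha> > 0" and "t \<ge> 0"
  shows "mittag_leffler \<alpha> (c * t powr \<alpha>) = 1 + RL_integral \<alpha> (\<lambda>s. c * mittag_leffler \<alpha> (c * s powr \<alpha>)) t"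
proof (cases "t = 0")
  case False
  then have t: "t > 0" using assms by simp
  define G where "G k = Gamma (\<alpha> * real k + 1)" for k
  have G: "G k > 0" for k unfolding G_def using \<alpha> by (intro Gamma_real_pos) (simp add: add_nonneg_pos)
  define K where "K s = indicat_real {0..1} s * (1 - s) powr (\<alpha> - 1)" for s
  have K: "integrable lborel K" "K s \<ge> 0" for s
    using set_integrable_kernel_unit[OF \<alpha>] by (simp_all add: K_def[abs_def] set_integrable_def)
  define F where "F k s = K s * ((c * (t * s) powr \<alpha>) ^ k / G k)" for k s
  \<comment> \<open>The series at |c| t^\<alpha> majorizes all terms on [0, t] and justifies
    exchanging sum and integral.\<close>
  define B where "B k = (\<bar>c\<bar> * t powr \<alpha>) ^ k / G k" for k
  have B: "summable B" using summable_mittag_leffler[OF \<alpha>, of "\<bar>c\<bar> * t powr \<alpha>"] by (simp add: B_def[abs_def] G_def)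
  have FB: "norm (F k s) \<le> B k * K s" for k s
  proof (cases "s \<in> {0..1}")
    case True
    have "(t * s) powr \<alpha> \<le> t powr \<alpha>" using True \<alpha> \<open>t \<ge> 0\<close> by (intro powr_mono2) (auto intro: mult_left_le)
    then have "\<bar>c * (t * s) powr \<alpha>\<bar> \<le> \<bar>c\<bar> * t powr \<alpha>" by (simp add: abs_mult mult_left_mono)
    then have "\<bar>c * (t * s) powr \<alpha>\<bar> ^ k \<le> (\<bar>c\<bar> * t powr \<alpha>) ^ k" by (rule power_mono) simp
    then have "\<bar>c * (t * s) powr \<alpha>\<bar> ^ k / G k \<le> B k" unfolding B_def using G by (intro divide_right_mono) (auto simp: less_imp_le)
    then show ?thesis using mult_right_mono[OF _ K(2)[of s]] G[of k] K(2)[of s]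
      by (fastforce simp: F_def abs_mult power_abs mult.commute)
  qed (simp add: F_def K_def)
  have Fm: "F k \<in> borel_measurable lborel" for k unfolding F_def K_def by measurable
  have Fi: "integrable lborel (F k)" for k
    by (rule Bochner_Integration.integrable_bound[OF integrable_mult_right[OF K(1), of "B k"] Fm])
      (use FB order_trans abs_ge_self in fastforce)
  have nF: "(\<integral>s. norm (F k s) \<partial>lborel) \<le> B k * (\<integral>s. K s \<partial>lborel)" for k
  proof -
    have "(\<integral>s. norm (F k s) \<partial>lborel) \<le> (\<integral>s. B k * K s \<partial>lborel)"
      by (rule integral_mono[OF integrable_norm[OF Fi] integrable_mult_right[OF K(1)] FB])
    then show ?thesis by simp
  qed
  have "(\<lambda>k. integral\<^sup>L lborel (F k)) sums (\<integral>s. (\<Sum>k. F k s) \<partial>lborel)"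
  proof (rule sums_integral[OF Fi])
    show "AE s in lborel. summable (\<lambda>k. norm (F k s))"
      by (rule AE_I2, rule summable_comparison_test'[OF summable_mult2[OF B], where N = 0]) (use FB in auto)
    show "summable (\<lambda>k. \<integral>s. norm (F k s) \<partial>lborel)"
      by (rule summable_comparison_test'[OF summable_mult2[OF B], where N = 0]) (use nF in auto)
  qed
  moreover have "(\<Sum>k. F k s) = K s * mittag_leffler \<alpha> (c * (t * s) powr \<alpha>)" for s
    unfolding F_def mittag_leffler_def G_def by (rule suminf_mult[OF summable_mittag_leffler[OF \<alpha>]])
  ultimately have S: "(\<lambda>k. c * (t powr \<alpha> / Gamma \<alpha>) * integral\<^sup>L lborel (F k)) sums
      (c * (t powr \<alpha> / Gamma \<alpha>) * (\<integral>s. K s * mittag_leffler \<alpha> (c * (t * s) powr \<alpha>) \<partial>lborel))"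
    by (intro sums_mult) simp
  have R: "RL_integral \<alpha> (\<lambda>s. c * mittag_leffler \<alpha> (c * s powr \<alpha>)) t
      = c * (t powr \<alpha> / Gamma \<alpha>) * (\<integral>s. K s * mittag_leffler \<alpha> (c * (t * s) powr \<alpha>) \<partial>lborel)"
    using RL_integral_cmult[of \<alpha> c "\<lambda>s. mittag_leffler \<alpha> (c * s powr \<alpha>)" t]
    by (simp add: RL_integral_def set_lebesgue_integral_def K_def mult.assoc)
  have T: "c * (t powr \<alpha> / Gamma \<alpha>) * integral\<^sup>L lborel (F k) = (c * t powr \<alpha>) ^ Suc k / G (Suc k)" for k
  proof -
    have pk: "s powr (\<alpha> * real k) = (s powr \<alpha>) ^ k" if "s > 0" for s :: real
      using that by (simp add: powr_powr[symmetric] powr_realpow)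
    have "integral\<^sup>L lborel (F k) = (\<integral>s. c ^ k / G k * (indicat_real {0..1} s * ((1 - s) powr (\<alpha> - 1) * (t * s) powr (\<alpha> * real k))) \<partial>lborel)"
    proof (rule integral_cong_AE)
      show "AE s in lborel. F k s = c ^ k / G k * (indicat_real {0..1} s * ((1 - s) powr (\<alpha> - 1) * (t * s) powr (\<alpha> * real k)))"
        using AE_lborel_singleton[of 0]
        by eventually_elim (use t pk in \<open>auto simp: F_def K_def indicator_def power_mult_distrib\<close>)
    qed (use Fm in auto)
    also have "\<dots> = c ^ k / G k * (LINT s:{0..1}|lborel. (1 - s) powr (\<alpha> - 1) * (t * s) powr (\<alpha> * real k))"
      by (simp add: set_lebesgue_integral_def)
    finally have "c * (t powr \<alpha> / Gamma \<alpha>) * integral\<^sup>L lborel (F k)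
        = c ^ Suc k / G k * RL_integral \<alpha> (\<lambda>s. s powr (\<alpha> * real k)) t"
      by (simp add: RL_integral_def mult_ac)
    also have "RL_integral \<alpha> (\<lambda>s. s powr (\<alpha> * real k)) t = G k / G (Suc k) * t powr (\<alpha> * real (Suc k))"
      using RL_integral_powr[OF \<alpha>, of "\<alpha> * real k" t] \<alpha> \<open>t \<ge> 0\<close> by (simp add: G_def algebra_simps)
    also have "t powr (\<alpha> * real (Suc k)) = (t powr \<alpha>) ^ Suc k"
      using t by (simp only: powr_powr[symmetric]) (rule powr_realpow, simp)
    finally show ?thesis using G[of k] by (simp add: power_mult_distrib)
  qed
  have "(\<lambda>k. (c * t powr \<alpha>) ^ k / G k) sums mittag_leffler \<alpha> (c * t powr \<alpha>)"
    unfolding mittag_leffler_def G_def by (rule summable_sums[OF summable_mittag_leffler[OF \<alpha>]])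
  then have "(\<lambda>k. (c * t powr \<alpha>) ^ Suc k / G (Suc k)) sums (mittag_leffler \<alpha> (c * t powr \<alpha>) - 1)"
    by (subst sums_Suc_iff) (simp add: G_def)
  moreover have "(\<lambda>k. (c * t powr \<alpha>) ^ Suc k / G (Suc k)) sums RL_integral \<alpha> (\<lambda>s. c * mittag_leffler \<alpha> (c * s powr \<alpha>)) t"
    using S unfolding T R .
  ultimately show ?thesis using sums_unique2 by fastforce
qed (use \<alpha> in simp)

text \<open>The Volterra equation for the linear map v \<mapsto> c v makes this an instance of the
  general regularity theory, so the series is not differentiated term by term.\<close>

lemma mittag_leffler_solution:
  assumes \<alpha>: "0 < \<alpha>" "\<alpha> < 1"
  shows "continuous_on {0..} (\<lambda>t. mittag_leffler \<alpha> (c * t powr \<alpha>))"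
    and "0 \<le> a \<Longrightarrow> abs_continuous_on_interval a b (\<lambda>t. mittag_leffler \<alpha> (c * t powr \<alpha>))"
    and "0 < t \<Longrightarrow> has_caputo_derivative \<alpha> (\<lambda>t. mittag_leffler \<alpha> (c * t powr \<alpha>)) (c * mittag_leffler \<alpha> (c * t powr \<alpha>)) t"
proof -
  let ?u = "\<lambda>t. mittag_leffler \<alpha> (c * t powr \<alpha>)"
  show c: "continuous_on {0..} ?u"
    by (rule continuous_on_compose2[OF continuous_on_mittag_leffler[OF \<alpha>(1), of UNIV]])
      (use \<alpha> in \<open>auto intro!: continuous_on_mult continuous_on_powr' continuous_on_const continuous_on_id\<close>)
  have lip: "\<bar>c\<bar>-lipschitz_on UNIV (\<lambda>v. c * v)"
    by (rule lipschitz_onI) (auto simp: dist_real_def abs_mult right_diff_distrib[symmetric])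
  have sol: "?u t = 1 + RL_integral \<alpha> (\<lambda>s. c * ?u s) t" if "t \<ge> 0" for t
    by (rule mittag_leffler_Volterra[OF \<alpha>(1) that])
  have inc: "\<exists>C\<ge>0. \<forall>u v. 0 \<le> u \<longrightarrow> u \<le> v \<longrightarrow> v \<le> T \<longrightarrow> \<bar>?u v - ?u u\<bar> \<le> C * (v powr \<alpha> - u powr \<alpha>)" for T
    using Volterra_solution_increment[OF \<alpha>(1) lip c sol, of T] unfolding real_norm_def by metis
  show "0 \<le> a \<Longrightarrow> abs_continuous_on_interval a b ?u" "0 < t \<Longrightarrow> has_caputo_derivative \<alpha> ?u (c * ?u t) t"
    by (rule Volterra_imp_Caputo[OF \<alpha> _ sol inc]; auto intro: continuous_intros c)+
qed

section \<open>Contractions\<close>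

text \<open>The weighted sum norm when the vectors \<open>b k\<close> are coordinate vectors scaled
  by the weights. In general only a seminorm; where definiteness matters, a bound of
  \<open>norm\<close> by a multiple of it is assumed.\<close>

definition l1_norm :: "('k::finite \<Rightarrow> 'e::euclidean_space) \<Rightarrow> 'e \<Rightarrow> real" where
  "l1_norm b e = (\<Sum>k\<in>UNIV. \<bar>e \<bullet> b k\<bar>)"

lemma l1_norm_nonneg: "0 \<le> l1_norm b e"
  by (simp add: l1_norm_def sum_nonneg)

lemma l1_norm_0 [simp]: "l1_norm b 0 = 0"
  by (simp add: l1_norm_def)

lemma l1_norm_le: "l1_norm b e \<le> (\<Sum>k\<in>UNIV. norm (b k)) * norm e"
  unfolding l1_norm_def sum_distrib_right
  by (intro sum_mono) (metis Cauchy_Schwarz_ineq2 mult.commute)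

lemma l1_norm_triangle: "l1_norm b u \<le> l1_norm b v + l1_norm b (u - v)"
  unfolding l1_norm_def sum.distrib[symmetric] by (intro sum_mono) (simp add: inner_diff_left)

lemma l1_norm_lipschitz: "(\<Sum>k\<in>UNIV. norm (b k))-lipschitz_on A (l1_norm b)"
proof (rule lipschitz_onI)
  fix u v
  show "dist (l1_norm b u) (l1_norm b v) \<le> (\<Sum>k\<in>UNIV. norm (b k)) * dist u v"
    using l1_norm_triangle[of b u v] l1_norm_triangle[of b v u] l1_norm_le[of b "u - v"] l1_norm_le[of b "v - u"]
    by (simp add: dist_norm norm_minus_commute abs_le_iff)
qed (simp add: sum_nonneg)

lemma continuous_on_l1_norm: "continuous_on A f \<Longrightarrow> continuous_on A (\<lambda>t. l1_norm b (f t))"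
  unfolding l1_norm_def by (intro continuous_intros)

lemma abs_continuous_const: "abs_continuous_on_interval a b (\<lambda>_. c)"
  unfolding abs_continuous_on_interval_def by (auto intro!: exI[of _ 1])

text \<open>Solutions are absolutely continuous on [a, b] with a \<le> b, while the comparison
  theorem asks for [0, T] with every T; negative T are settled here.\<close>

lemma abs_continuous_empty:
  assumes "b < a"
  shows "abs_continuous_on_interval a b f"
  unfolding abs_continuous_on_interval_def
proof (intro allI impI exI[of _ 1] conjI, goal_cases)
  case (2 \<epsilon> N u v)
  have "N = 0"
  proof (rule ccontr)
    assume "N \<noteq> 0"
    then have "a \<le> u 0" "u 0 \<le> v 0" "v 0 \<le> b" using 2 by auto
    then show False using assms by linarith
  qed
  then show ?case using 2 by simp
qed simp

lemma Caputo_solution_exists: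
  fixes F :: "'e::euclidean_space \<Rightarrow> 'e"
  assumes \<alpha>: "0 < \<alpha>" "\<alpha> < 1" and F: "L-lipschitz_on UNIV F"
  obtains z where "z 0 = z0" "\<And>a b. 0 \<le> a \<Longrightarrow> abs_continuous_on_interval a b z"
    "\<And>t. 0 < t \<Longrightarrow> has_caputo_derivative \<alpha> z (F (z t)) t"
proof -
  obtain z where z: "continuous_on {0..} z" and sol: "\<And>t. t \<ge> 0 \<Longrightarrow> z t = z0 + RL_integral \<alpha> (\<lambda>s. F (z s)) t"
    using Volterra_solution_exists[OF \<alpha>(1) F] by metis
  have Fz: "continuous_on {0..} (\<lambda>s. F (z s))"
    by (intro continuous_on_compose2[OF lipschitz_on_continuous_on[OF F] z]) auto
  have inc: "\<exists>C\<ge>0. \<forall>u v. 0 \<le> u \<longrightarrow> u \<le> v \<longrightarrow> v \<le> T \<longrightarrow> norm (z v - z u) \<le> C * (v powr \<alpha> - u powr \<alpha>)" for T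
    by (rule Volterra_solution_increment[OF \<alpha>(1) F z sol, of T]) blast+
  have comp: "(0 \<le> a \<longrightarrow> abs_continuous_on_interval a b (\<lambda>s. z s \<bullet> i)) \<and>
      (0 < t \<longrightarrow> has_caputo_derivative \<alpha> (\<lambda>s. z s \<bullet> i) (F (z t) \<bullet> i) t)" if i: "i \<in> Basis" for i a b t
  proof -
    have c: "continuous_on {0..} (\<lambda>s. F (z s) \<bullet> i)" by (intro continuous_intros Fz)
    have s: "z t \<bullet> i = z0 \<bullet> i + RL_integral \<alpha> (\<lambda>s. F (z s) \<bullet> i) t" if "t \<ge> 0" for t
      using sol[OF that] RL_integral_inner[OF \<alpha>(1) that continuous_on_subset[OF Fz], of i]
      by (auto simp: inner_add_left)
    have n: "\<exists>C\<ge>0. \<forall>u v. 0 \<le> u \<longrightarrow> u \<le> v \<longrightarrow> v \<le> T \<longrightarrow> \<bar>z v \<bullet> i - z u \<bullet> i\<bar> \<le> C * (v powr \<alpha> - u powr \<alpha>)" for T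
      using inc[of T] Basis_le_norm[OF i] by (metis inner_diff_left order_trans)
    show ?thesis using Volterra_imp_Caputo[OF \<alpha> c s n] by blast
  qed
  show thesis
  proof
    show "z 0 = z0" using sol[of 0] \<alpha> by simp
    show "abs_continuous_on_interval a b z" if "0 \<le> a" for a b
    proof -
      obtain C where C: "C \<ge> 0" "\<And>u v. 0 \<le> u \<Longrightarrow> u \<le> v \<Longrightarrow> v \<le> b \<Longrightarrow> norm (z v - z u) \<le> C * (v powr \<alpha> - u powr \<alpha>)"
        using inc[of b] by blast
      show ?thesis
      proof (rule abs_continuous_comparison[OF abs_continuous_powr[OF \<alpha> that] C(1)])
        fix u v assume "a \<le> u" "u \<le> v" "v \<le> b"
        then show "norm (z v - z u) \<le> C * norm (v powr \<alpha> - u powr \<alpha>)"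
          using C(2)[of u v] that mult_left_mono[OF abs_ge_self C(1), of "v powr \<alpha> - u powr \<alpha>"] by simp
      qed
    qed
    show "has_caputo_derivative \<alpha> z (F (z t)) t" if "0 < t" for t
      by (rule has_caputo_derivative_componentwise) (use comp that in auto)
  qed
qed

text \<open>If the estimate failed, then at the first time \<open>t\<close> of failure the linear functional
  \<open>e \<mapsto> \<Sum>\<^sub>k sgn(e(t) \<bullet> b\<^sub>k) (e \<bullet> b\<^sub>k)\<close>, evaluated along the difference \<open>e\<close> of the solutions and
  diminished by the Mittag-Leffler bound, would have a maximum at \<open>t\<close> with nonpositive Caputo
  derivative. No differentiation of absolute values is needed.\<close>

theorem Caputo_contraction_comparison:
  fixes \<Phi> :: "'e::euclidean_space \<Rightarrow> 'e" and b :: "'k::finite \<Rightarrow> 'e"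
  assumes \<alpha>: "0 < \<alpha>" "\<alpha> < 1" and \<theta>: "\<theta> < 1"
    and contr: "\<And>u v. l1_norm b (\<Phi> u - \<Phi> v) \<le> \<theta> * l1_norm b (u - v)"
    and z: "\<And>T. abs_continuous_on_interval 0 T z" "\<And>t. 0 < t \<Longrightarrow> has_caputo_derivative \<alpha> z (\<Phi> (z t) - z t) t"
    and z': "\<And>T. abs_continuous_on_interval 0 T z'" "\<And>t. 0 < t \<Longrightarrow> has_caputo_derivative \<alpha> z' (\<Phi> (z' t) - z' t) t"
    and "0 \<le> t"
  shows "l1_norm b (z t - z' t) \<le> l1_norm b (z 0 - z' 0) * mittag_leffler \<alpha> (- (1 - \<theta>) * t powr \<alpha>)"
proof -
  define u where "u t = mittag_leffler \<alpha> (- (1 - \<theta>) * t powr \<alpha>)" for t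
  define e where "e t = z t - z' t" for t
  define N0 where "N0 = l1_norm b (e 0)"
  have u0: "u 0 = 1" using \<alpha> by (simp add: u_def)
  have uc: "continuous_on {0..} u" unfolding u_def by (rule mittag_leffler_solution(1)[OF \<alpha>])
  have uac: "abs_continuous_on_interval 0 T u" for T
    unfolding u_def by (rule mittag_leffler_solution(2)[OF \<alpha>]) simp
  have ucap: "has_caputo_derivative \<alpha> u (- (1 - \<theta>) * u t) t" if "0 < t" for t
    unfolding u_def by (rule mittag_leffler_solution(3)[OF \<alpha> that])
  have eac: "abs_continuous_on_interval 0 T e" for T
    unfolding e_def by (intro abs_continuous_diff z z')
  have ecap: "has_caputo_derivative \<alpha> e ((\<Phi> (z t) - z t) - (\<Phi> (z' t) - z' t)) t" if "0 < t" for t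
    unfolding e_def by (intro has_caputo_derivative_diff z z' that)
  \<comment> \<open>The slack \<epsilon> makes the inequality strict at time 0, so a first failure
    occurs at a positive time.\<close>
  have less: "l1_norm b (e t) < (N0 + \<epsilon>) * u t" if \<epsilon>: "\<epsilon> > 0" for \<epsilon>
  proof (rule ccontr)
    define W where "W s = (N0 + \<epsilon>) * u s" for s
    define \<psi> where "\<psi> s = l1_norm b (e s) - W s" for s
    assume "\<not> l1_norm b (e t) < (N0 + \<epsilon>) * u t"
    then have "0 \<le> \<psi> t" by (simp add: \<psi>_def W_def)
    have \<psi>c: "continuous_on {0..t} \<psi>"
      unfolding \<psi>_def W_def
      by (intro continuous_intros continuous_on_l1_norm abs_continuous_imp_continuous_on[OF eac] continuous_on_subset[OF uc]) auto
    define S where "S = {s \<in> {0..t}. 0 \<le> \<psi> s}"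
    have "closed S" unfolding S_def
      by (rule continuous_on_closed_Collect_le[OF continuous_on_const \<psi>c]) simp
    moreover have "S \<noteq> {}" using \<open>0 \<le> \<psi> t\<close> \<open>0 \<le> t\<close> by (auto simp: S_def)
    moreover have bdd: "bdd_below S" by (rule bdd_belowI[of _ 0]) (auto simp: S_def)
    ultimately have "Inf S \<in> S" by (intro closed_contains_Inf)
    \<comment> \<open>The first touching time: \<open>S\<close> is closed, so the infimum is
      attained, and \<psi> is negative before it.\<close>
    define r where "r = Inf S"
    have r: "0 \<le> r" "r \<le> t" "0 \<le> \<psi> r" using \<open>Inf S \<in> S\<close> by (auto simp: S_def r_def)
    have before: "\<psi> s < 0" if "0 \<le> s" "s < r" for s
    proof (rule ccontr)
      assume "\<not> \<psi> s < 0"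
      then have "s \<in> S" using that r by (auto simp: S_def)
      then show False using cInf_lower[OF _ bdd] that by (force simp: r_def)
    qed
    have "\<psi> 0 < 0" using \<epsilon> by (simp add: \<psi>_def W_def u0 N0_def)
    then have "r > 0" using r by (cases "r = 0") auto
    define v where "v = (\<Sum>k\<in>UNIV. sgn (e r \<bullet> b k) *\<^sub>R b k)"
    have v: "x \<bullet> v \<le> l1_norm b x" for x
    proof -
      have "x \<bullet> v = (\<Sum>k\<in>UNIV. sgn (e r \<bullet> b k) * (x \<bullet> b k))" by (simp add: v_def inner_sum_right)
      also have "\<dots> \<le> (\<Sum>k\<in>UNIV. \<bar>x \<bullet> b k\<bar>)"
        by (intro sum_mono) (auto simp: sgn_if)
      finally show ?thesis by (simp add: l1_norm_def)
    qed
    have vr: "e r \<bullet> v = l1_norm b (e r)"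
      by (simp add: v_def inner_sum_right l1_norm_def abs_sgn mult.commute)
    define p where "p s = e s \<bullet> v - W s" for s
    have p_le: "p s \<le> \<psi> s" for s using v[of "e s"] by (simp add: p_def \<psi>_def)
    have pr: "p r = \<psi> r" by (simp add: p_def \<psi>_def vr)
    have Wac: "abs_continuous_on_interval 0 r W"
      by (rule abs_continuous_comparison[OF uac, where K = "\<bar>N0 + \<epsilon>\<bar>"])
        (auto simp: W_def abs_mult right_diff_distrib[symmetric])
    have Wcap: "has_caputo_derivative \<alpha> W ((N0 + \<epsilon>) * (- (1 - \<theta>) * u r)) r"
      using has_caputo_derivative_inner[OF uac ucap[OF \<open>r > 0\<close>], of "N0 + \<epsilon>"] by (simp add: W_def[abs_def] mult.commute)
    define D where "D = ((\<Phi> (z r) - z r) - (\<Phi> (z' r) - z' r)) \<bullet> v - (N0 + \<epsilon>) * (- (1 - \<theta>) * u r)"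
    have "0 < D"
    proof (rule Caputo_derivative_pos_at_maximum[OF \<alpha> \<open>r > 0\<close>])
      show "abs_continuous_on_interval 0 r p"
        unfolding p_def by (intro abs_continuous_diff abs_continuous_inner eac Wac)
      show "has_caputo_derivative \<alpha> p D r"
        unfolding p_def D_def
        by (intro has_caputo_derivative_diff has_caputo_derivative_inner abs_continuous_inner eac Wac ecap Wcap \<open>r > 0\<close>)
      show "p s \<le> p r" if "0 \<le> s" "s \<le> r" for s
      proof (cases "s = r")
        case False
        then show ?thesis using before[of s] p_le[of s] pr r that by simp
      qed simp
      show "p 0 < p r" using \<open>\<psi> 0 < 0\<close> p_le[of 0] pr r by linarith
    qed
    \<comment> \<open>The functional v is bounded by the weighted norm and attains it at e(r), so
      the contraction gives D \<le> -(1 - \<theta>) \<psi>(r), and \<psi>(r) is nonnegative.\<close>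
    moreover have "D \<le> 0"
    proof -
      have "D = (\<Phi> (z r) - \<Phi> (z' r)) \<bullet> v - l1_norm b (e r) + (1 - \<theta>) * W r"
        unfolding D_def vr[symmetric] by (simp add: e_def W_def inner_diff_left algebra_simps)
      also have "\<dots> \<le> \<theta> * l1_norm b (e r) - l1_norm b (e r) + (1 - \<theta>) * W r"
        using v[of "\<Phi> (z r) - \<Phi> (z' r)"] contr[of "z r" "z' r"] by (simp add: e_def)
      also have "\<dots> = - ((1 - \<theta>) * \<psi> r)" by (simp add: \<psi>_def algebra_simps)
      also have "\<dots> \<le> 0" using \<theta> r by simp
      finally show ?thesis .
    qed
    ultimately show False by simp
  qed
  have "l1_norm b (e t) \<le> N0 * u t"
  proof (rule field_le_epsilon)
    fix d :: real assume "d > 0"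
    \<comment> \<open>The absolute value makes the choice independent of the sign of
      \<open>u t\<close>.\<close>
    define \<epsilon> where "\<epsilon> = d / (\<bar>u t\<bar> + 1)"
    have "\<epsilon> > 0" using \<open>d > 0\<close> by (simp add: \<epsilon>_def)
    have "\<epsilon> * u t \<le> \<epsilon> * (\<bar>u t\<bar> + 1)" using \<open>\<epsilon> > 0\<close> by (intro mult_left_mono) auto
    also have "\<dots> = d" by (simp add: \<epsilon>_def)
    finally show "l1_norm b (e t) \<le> N0 * u t + d" using less[OF \<open>\<epsilon> > 0\<close>] by (simp add: algebra_simps)
  qed
  then show ?thesis by (simp add: e_def N0_def u_def)
qed

text \<open>\<open>\<Phi>\<close> contracts the weighted norm but perhaps not the norm of the type.
  Norm equivalence makes a high iterate contract the latter; \<open>\<Phi>\<close> commutes with its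
  iterate and therefore preserves the unique fixed point.\<close>

lemma l1_contraction_fixed_point:
  fixes \<Phi> :: "'e::euclidean_space \<Rightarrow> 'e"
  assumes c: "\<And>e. norm e \<le> c * l1_norm b e" and \<theta>: "0 \<le> \<theta>" "\<theta> < 1"
    and contr: "\<And>u v. l1_norm b (\<Phi> u - \<Phi> v) \<le> \<theta> * l1_norm b (u - v)"
  obtains z where "\<Phi> z = z"
proof -
  define c' where "c' = (\<Sum>k\<in>UNIV. norm (b k))"
  have c'0: "c' \<ge> 0" by (simp add: c'_def sum_nonneg)
  have iter: "l1_norm b ((\<Phi> ^^ n) u - (\<Phi> ^^ n) v) \<le> \<theta> ^ n * l1_norm b (u - v)" for n u v
  proof (induction n)
    case (Suc n)
    have "l1_norm b ((\<Phi> ^^ Suc n) u - (\<Phi> ^^ Suc n) v) \<le> \<theta> * l1_norm b ((\<Phi> ^^ n) u - (\<Phi> ^^ n) v)"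
      using contr by simp
    also have "\<dots> \<le> \<theta> * (\<theta> ^ n * l1_norm b (u - v))" using Suc \<theta> by (intro mult_left_mono)
    finally show ?case by simp
  qed simp
  have "(\<lambda>n. (\<bar>c\<bar> * c') * \<theta> ^ n) \<longlonglongrightarrow> (\<bar>c\<bar> * c') * 0"
    using \<theta> by (intro tendsto_intros LIMSEQ_power_zero) auto
  then have "\<forall>\<^sub>F n in sequentially. (\<bar>c\<bar> * c') * \<theta> ^ n < 1 / 2"
    by (intro order_tendstoD(2)[where a = "1 / 2"]) auto
  then obtain n where n: "(\<bar>c\<bar> * c') * \<theta> ^ n < 1 / 2" by (auto simp: eventually_sequentially)
  have "dist ((\<Phi> ^^ n) u) ((\<Phi> ^^ n) v) \<le> 1 / 2 * dist u v" for u v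
  proof -
    have "dist ((\<Phi> ^^ n) u) ((\<Phi> ^^ n) v) \<le> c * l1_norm b ((\<Phi> ^^ n) u - (\<Phi> ^^ n) v)"
      unfolding dist_norm by (rule c)
    also have "\<dots> \<le> \<bar>c\<bar> * (\<theta> ^ n * (c' * norm (u - v)))"
      using iter[of n u v] l1_norm_le[of b "u - v"] \<theta>
      by (intro mult_mono order_trans[OF iter] mult_left_mono) (auto simp: c'_def l1_norm_nonneg)
    also have "\<dots> = (\<bar>c\<bar> * c') * \<theta> ^ n * dist u v" by (simp add: dist_norm mult_ac)
    also have "\<dots> \<le> 1 / 2 * dist u v" using n by (intro mult_right_mono) auto
    finally show ?thesis .
  qed
  then have ex: "\<exists>!z. (\<Phi> ^^ n) z = z" by (intro banach_fix_type[where c = "1 / 2"]) auto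
  then obtain z where z: "(\<Phi> ^^ n) z = z" by blast
  have "(\<Phi> ^^ n) (\<Phi> z) = \<Phi> z" using z by (metis funpow_swap1)
  then have "\<Phi> z = z" using ex z by blast
  then show thesis by (rule that)
qed

text \<open>Isolates the dynamics from the projections: all that enters is a contraction on the
  product space in a norm of l1 type.\<close>

theorem contraction_globally_mittag_leffler_stable:
  fixes f :: "'a::euclidean_space \<Rightarrow> 'b::euclidean_space \<Rightarrow> 'a" and g :: "'a \<Rightarrow> 'b \<Rightarrow> 'b"
    and b :: "'k::finite \<Rightarrow> 'a \<times> 'b"
  assumes \<alpha>: "0 < \<alpha>" "\<alpha> < 1" and c: "\<And>e. norm e \<le> c * l1_norm b e" and \<theta>: "0 \<le> \<theta>" "\<theta> < 1"
    and contr: "\<And>u v. l1_norm b (\<Phi> u - \<Phi> v) \<le> \<theta> * l1_norm b (u - v)"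
    and fg: "\<And>x y. f x y = fst (\<Phi> (x, y)) - x" "\<And>x y. g x y = snd (\<Phi> (x, y)) - y"
  shows "globally_mittag_leffler_stable \<alpha> f g"
proof -
  obtain ze where ze: "\<Phi> ze = ze" using l1_contraction_fixed_point[OF c \<theta> contr] .
  define F where "F z = \<Phi> z - z" for z
  have Fpair: "F (x, y) = (f x y, g x y)" for x y by (simp add: F_def fg prod_eq_iff)
  define c' where "c' = (\<Sum>k\<in>UNIV. norm (b k))"
  have c'0: "c' \<ge> 0" by (simp add: c'_def sum_nonneg)
  have lipF: "(\<bar>c\<bar> * (\<theta> * c') + 1)-lipschitz_on UNIV F"
  proof (rule lipschitz_onI)
    fix u v
    have "norm (F u - F v) \<le> norm (\<Phi> u - \<Phi> v) + norm (u - v)"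
      using norm_triangle_ineq4[of "\<Phi> u - \<Phi> v" "u - v"] by (simp add: F_def algebra_simps)
    also have "norm (\<Phi> u - \<Phi> v) \<le> c * l1_norm b (\<Phi> u - \<Phi> v)" by (rule c)
    also have "\<dots> \<le> \<bar>c\<bar> * (\<theta> * (c' * norm (u - v)))"
      using l1_norm_le[of b "u - v"] \<theta>
      by (intro mult_mono order_trans[OF contr] mult_left_mono) (auto simp: c'_def l1_norm_nonneg)
    finally show "dist (F u) (F v) \<le> (\<bar>c\<bar> * (\<theta> * c') + 1) * dist u v" by (simp add: dist_norm algebra_simps)
  qed (use \<theta> c'0 in simp)
  \<comment> \<open>The constant |c| converts the weighted norm back to the Euclidean one, in which
    the estimate is stated.\<close>
  define M where "M z = \<bar>c\<bar> * l1_norm b z" for z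
  have pair_sol: "(\<forall>T. abs_continuous_on_interval 0 T (\<lambda>t. (x t, y t))) \<and>
      (\<forall>t>0. has_caputo_derivative \<alpha> (\<lambda>t. (x t, y t)) (\<Phi> (x t, y t) - (x t, y t)) t) \<and> x 0 = x0 \<and> y 0 = y0"
    if sol: "caputo_solution \<alpha> f g x0 y0 x y" for x y x0 y0
  proof -
    have xy: "abs_continuous_on_interval 0 T x" "abs_continuous_on_interval 0 T y" for T
      using sol abs_continuous_empty[of T 0 x] abs_continuous_empty[of T 0 y]
      by (cases "0 \<le> T"; simp add: caputo_solution_def)+
    have ac: "abs_continuous_on_interval 0 T (\<lambda>t. (x t, y t))" for T
    proof -
      have "abs_continuous_on_interval 0 T (\<lambda>t. (x t, 0 :: 'b))"
        by (rule abs_continuous_comparison[OF xy(1), where K = 1]) (auto simp: norm_Pair)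
      moreover have "abs_continuous_on_interval 0 T (\<lambda>t. (0 :: 'a, y t))"
        by (rule abs_continuous_comparison[OF xy(2), where K = 1]) (auto simp: norm_Pair)
      ultimately show ?thesis using abs_continuous_add by fastforce
    qed
    have "has_caputo_derivative \<alpha> (\<lambda>t. (x t, y t)) (f (x t) (y t), g (x t) (y t)) t" if "t > 0" for t
    proof (rule has_caputo_derivative_componentwise)
      have d: "has_caputo_derivative \<alpha> x (f (x t) (y t)) t" "has_caputo_derivative \<alpha> y (g (x t) (y t)) t"
        using sol that by (auto simp: caputo_solution_def)
      fix k :: "'a \<times> 'b" assume "k \<in> Basis"
      show "abs_continuous_on_interval 0 t (\<lambda>s. (x s, y s) \<bullet> k)" by (rule abs_continuous_inner[OF ac])
      show "has_caputo_derivative \<alpha> (\<lambda>s. (x s, y s) \<bullet> k) ((f (x t) (y t), g (x t) (y t)) \<bullet> k) t"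
        using \<open>k \<in> Basis\<close> has_caputo_derivative_inner[OF xy(1) d(1)] has_caputo_derivative_inner[OF xy(2) d(2)]
        by (auto simp: Basis_prod_def)
    qed
    then show ?thesis using ac sol Fpair by (auto simp: caputo_solution_def F_def)
  qed
  have compare: "l1_norm b ((x t, y t) - (x' t, y' t))
      \<le> l1_norm b ((x0, y0) - (x0', y0')) * mittag_leffler \<alpha> (- (1 - \<theta>) * t powr \<alpha>)"
    if "caputo_solution \<alpha> f g x0 y0 x y" "caputo_solution \<alpha> f g x0' y0' x' y'" "0 \<le> t" for x y x' y' x0 y0 x0' y0' t
    using Caputo_contraction_comparison[OF \<alpha> \<theta>(2) contr, of "\<lambda>t. (x t, y t)" "\<lambda>t. (x' t, y' t)" t]
      pair_sol[OF that(1)] pair_sol[OF that(2)] that(3) by auto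
  have eq: "equilibrium_point f g (fst ze, snd ze)" using ze by (simp add: equilibrium_point_def fg)
  \<comment> \<open>Comparison with the equilibrium, read as a constant solution, turns the estimate
    for two solutions into stability.\<close>
  have const: "caputo_solution \<alpha> f g (fst ze) (snd ze) (\<lambda>_. fst ze) (\<lambda>_. snd ze)"
    using ze by (simp add: caputo_solution_def fg abs_continuous_const has_caputo_derivative_def
        set_integrable_def set_lebesgue_integral_def)
  have exist: "\<exists>x y. caputo_solution \<alpha> f g x0 y0 x y" for x0 y0
  proof -
    obtain z where z: "z 0 = (x0, y0)" "\<And>a b. 0 \<le> a \<Longrightarrow> abs_continuous_on_interval a b z"
      "\<And>t. 0 < t \<Longrightarrow> has_caputo_derivative \<alpha> z (F (z t)) t"
      using Caputo_solution_exists[OF \<alpha> lipF, of "(x0, y0)"] by blast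
    have fz: "abs_continuous_on_interval a b (\<lambda>t. fst (z t))" "abs_continuous_on_interval a b (\<lambda>t. snd (z t))"
      if "0 \<le> a" for a b
    proof -
      have "norm (fst p) \<le> 1 * norm p" "norm (snd p) \<le> 1 * norm p" for p :: "'a \<times> 'b"
        using norm_fst_le[of "fst p" "snd p"] norm_snd_le[of "snd p" "fst p"] by simp_all
      then show "abs_continuous_on_interval a b (\<lambda>t. fst (z t))" "abs_continuous_on_interval a b (\<lambda>t. snd (z t))"
        by (intro abs_continuous_comparison[OF z(2)[OF that], where K = 1];
            simp only: fst_diff[symmetric] snd_diff[symmetric] zero_le_one)+
    qed
    have "has_caputo_derivative \<alpha> (\<lambda>t. fst (z t)) (fst (F (z t))) t"
      "has_caputo_derivative \<alpha> (\<lambda>t. snd (z t)) (snd (F (z t))) t" if "0 < t" for t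
    proof -
      show "has_caputo_derivative \<alpha> (\<lambda>t. fst (z t)) (fst (F (z t))) t"
      proof (rule has_caputo_derivative_componentwise)
        fix i :: 'a
        show "abs_continuous_on_interval 0 t (\<lambda>s. fst (z s) \<bullet> i)" by (intro abs_continuous_inner fz) simp
        show "has_caputo_derivative \<alpha> (\<lambda>s. fst (z s) \<bullet> i) (fst (F (z t)) \<bullet> i) t"
          using has_caputo_derivative_inner[OF z(2) z(3)[OF that], of "(i, 0)"] by (simp add: inner_prod_def)
      qed
      show "has_caputo_derivative \<alpha> (\<lambda>t. snd (z t)) (snd (F (z t))) t"
      proof (rule has_caputo_derivative_componentwise)
        fix i :: 'b
        show "abs_continuous_on_interval 0 t (\<lambda>s. snd (z s) \<bullet> i)" by (intro abs_continuous_inner fz) simp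
        show "has_caputo_derivative \<alpha> (\<lambda>s. snd (z s) \<bullet> i) (snd (F (z t)) \<bullet> i) t"
          using has_caputo_derivative_inner[OF z(2) z(3)[OF that], of "(0, i)"] by (simp add: inner_prod_def)
      qed
    qed
    moreover have "fst (F (z t)) = f (fst (z t)) (snd (z t))" "snd (F (z t)) = g (fst (z t)) (snd (z t))" for t
      using Fpair[of "fst (z t)" "snd (z t)"] by simp_all
    ultimately have "caputo_solution \<alpha> f g x0 y0 (\<lambda>t. fst (z t)) (\<lambda>t. snd (z t))"
      using fz z(1) by (simp add: caputo_solution_def)
    then show ?thesis by blast
  qed
  have unique: "x t = x' t \<and> y t = y' t"
    if "caputo_solution \<alpha> f g x0 y0 x y" "caputo_solution \<alpha> f g x0 y0 x' y'" "0 \<le> t" for x y x' y' x0 y0 t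
  proof -
    have "l1_norm b ((x t, y t) - (x' t, y' t)) \<le> 0" using compare[OF that] by simp
    then have "norm ((x t, y t) - (x' t, y' t)) \<le> 0"
      using c[of "(x t, y t) - (x' t, y' t)"] l1_norm_nonneg[of b "(x t, y t) - (x' t, y' t)"] by simp
    then show ?thesis by (simp add: zero_prod_def)
  qed
  have est: "norm ((x t, y t) - (fst ze, snd ze))
      \<le> (M ((x0, y0) - (fst ze, snd ze)) * mittag_leffler \<alpha> (- (1 - \<theta>) * t powr \<alpha>)) powr 1"
    if "caputo_solution \<alpha> f g x0 y0 x y" "0 \<le> t" for x y x0 y0 t
  proof -
    let ?e = "(x t, y t) - (fst ze, snd ze)"
    have "norm ?e \<le> c * l1_norm b ?e" by (rule c)
    also have "\<dots> \<le> \<bar>c\<bar> * l1_norm b ?e" by (intro mult_right_mono) (auto simp: l1_norm_nonneg)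
    also have "\<dots> \<le> \<bar>c\<bar> * (l1_norm b ((x0, y0) - (fst ze, snd ze)) * mittag_leffler \<alpha> (- (1 - \<theta>) * t powr \<alpha>))"
      by (intro mult_left_mono compare[OF that(1) const that(2)]) auto
    finally have le: "norm ?e \<le> M ((x0, y0) - (fst ze, snd ze)) * mittag_leffler \<alpha> (- (1 - \<theta>) * t powr \<alpha>)"
      by (simp add: M_def mult.assoc)
    \<comment> \<open>\<open>powr 1\<close> is the identity only on nonnegative numbers; the sign is
      read off from the bound just proved.\<close>
    also have "\<dots> = (M ((x0, y0) - (fst ze, snd ze)) * mittag_leffler \<alpha> (- (1 - \<theta>) * t powr \<alpha>)) powr 1"
      using order_trans[OF norm_ge_zero le] by simp
    finally show ?thesis .
  qed
  have lipM: "(\<bar>c\<bar> * c')-lipschitz_on A M" for A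
  proof (rule lipschitz_onI)
    fix u v :: "'a \<times> 'b"
    have "dist (M u) (M v) = \<bar>c\<bar> * dist (l1_norm b u) (l1_norm b v)"
      by (simp add: M_def dist_real_def abs_mult right_diff_distrib[symmetric])
    also have "\<dots> \<le> \<bar>c\<bar> * (c' * dist u v)"
      using lipschitz_onD[OF l1_norm_lipschitz[of b UNIV], of u v] by (intro mult_left_mono) (auto simp: c'_def)
    finally show "dist (M u) (M v) \<le> \<bar>c\<bar> * c' * dist u v" by (simp add: mult.assoc)
  qed (use c'0 in simp)
  show ?thesis
    unfolding globally_mittag_leffler_stable_def
  proof (rule exI[of _ "fst ze"], rule exI[of _ "snd ze"], rule conjI[OF eq], rule exI[of _ "1 - \<theta>"], rule conjI,
      simp add: \<theta>, rule exI[of _ 1], rule conjI, simp, rule exI[of _ M], intro conjI allI impI)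
    show "0 \<le> M z" for z by (simp add: M_def l1_norm_nonneg)
    show "M 0 = 0" by (simp add: M_def)
    show "\<exists>r>0. \<exists>L. L-lipschitz_on (cball z r) M" for z using lipM by (intro exI[of _ 1] conjI exI) auto
    show "\<exists>x y. caputo_solution \<alpha> f g x0 y0 x y" for x0 y0 by (rule exist)
    show "x t = x' t" "y t = y' t"
      if "caputo_solution \<alpha> f g x0 y0 x y \<and> caputo_solution \<alpha> f g x0 y0 x' y'" "0 \<le> t" for x0 y0 x y x' y' t
      using unique that by blast+
    show "norm ((x t, y t) - (fst ze, snd ze))
      \<le> (M ((x0, y0) - (fst ze, snd ze)) * mittag_leffler \<alpha> (- (1 - \<theta>) * t powr \<alpha>)) powr 1"
      if "caputo_solution \<alpha> f g x0 y0 x y" "0 \<le> t" for x0 y0 x y t by (rule est[OF that])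
  qed
qed

section \<open>Projections onto moving boxes\<close>

text \<open>Clamping minimizes the distance in all coordinates simultaneously, and the Euclidean
  norm is monotone in the moduli of the coordinates. The box is closed and convex, so the minimizer
  is unique.\<close>

lemma closest_point_moving_box:
  fixes H :: "real^'n^'n"
  assumes "c1 \<le> c2"
  shows "closest_point (moving_box H c1 c2 x) v $ i
    = (H *v x) $ i + max (c1 $ i) (min (c2 $ i) (v $ i - (H *v x) $ i))"
proof -
  define w :: "real^'n" where "w = (\<chi> i. max (c1 $ i) (min (c2 $ i) (v $ i - (H *v x) $ i)))"
  have c: "c1 $ i \<le> c2 $ i" for i using assms by (simp add: less_eq_vec_def)
  have w: "w \<in> {c1..c2}" using c by (auto simp: w_def less_eq_vec_def)
  have "H *v x + w = closest_point (moving_box H c1 c2 x) v"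
  proof (rule closest_point_unique)
    show "convex (moving_box H c1 c2 x)" "closed (moving_box H c1 c2 x)"
      unfolding moving_box_def interval_cbox_cart
      by (rule convex_translation[OF convex_box(1)], rule closed_translation[OF closed_cbox])
    show "H *v x + w \<in> moving_box H c1 c2 x" using w by (auto simp: moving_box_def)
    show "\<forall>z\<in>moving_box H c1 c2 x. dist v (H *v x + w) \<le> dist v z"
    proof
      fix z assume "z \<in> moving_box H c1 c2 x"
      then obtain q where q: "z = H *v x + q" "c1 \<le> q" "q \<le> c2" by (auto simp: moving_box_def)
      show "dist v (H *v x + w) \<le> dist v z"
        unfolding dist_norm
      proof (rule norm_le_componentwise_cart)
        fix i
        have "c1 $ i \<le> q $ i" "q $ i \<le> c2 $ i" using q by (auto simp: less_eq_vec_def)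
        then show "norm ((v - (H *v x + w)) $ i) \<le> norm ((v - z) $ i)"
          by (simp add: q w_def max_def min_def)
      qed
    qed
  qed
  from this[symmetric] show ?thesis by (simp add: w_def)
qed

lemma abs_clamp_diff_le: "\<bar>max lo (min hi s) - max lo (min hi t)\<bar> \<le> \<bar>s - t :: real\<bar>"
  by (simp add: max_def min_def)

lemma abs_le_max_endpoints: "lo \<le> t \<Longrightarrow> t \<le> hi \<Longrightarrow> \<bar>t\<bar> \<le> max \<bar>lo\<bar> \<bar>hi :: real\<bar>"
  by linarith

text \<open>The translation by \<open>H *v x\<close> enters twice: inside the clamp, where it
  combines with r A to give |r a_ij + h_ij|, and outside it, where it adds |h_ij|. On the diagonal
  the sign hypothesis lets the inner coefficient keep its sign, which explains the sum -h_ii +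
  |h_ii|.\<close>

lemma projection_component_bound:
  fixes H A :: "real^'n^'n" and As :: "real^'m^'n"
  assumes "c1 \<le> c2" "r > 0" and diag: "0 \<le> 1 - r * A $ i $ i - H $ i $ i"
  shows "\<bar>closest_point (moving_box H c1 c2 x) (x - r *\<^sub>R (A *v x + As *v y) - r *\<^sub>R a) $ i
      - closest_point (moving_box H c1 c2 x') (x' - r *\<^sub>R (A *v x' + As *v y') - r *\<^sub>R a) $ i\<bar>
    \<le> (1 - r * A $ i $ i - H $ i $ i + \<bar>H $ i $ i\<bar>) * \<bar>(x - x') $ i\<bar>
      + (\<Sum>j\<in>UNIV - {i}. (\<bar>r * A $ i $ j + H $ i $ j\<bar> + \<bar>H $ i $ j\<bar>) * \<bar>(x - x') $ j\<bar>)
      + (\<Sum>j\<in>UNIV. r * \<bar>As $ i $ j\<bar> * \<bar>(y - y') $ j\<bar>)"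
proof -
  define d where "d = x - x'"
  define e where "e = y - y'"
  \<comment> \<open>The argument of the clamp after the translation has been subtracted.\<close>
  define p where "p x y = x $ i - r * ((A *v x) $ i + (As *v y) $ i) - r * a $ i - (H *v x) $ i" for x y
  have mv: "(B *v z) $ i = (\<Sum>j\<in>UNIV. B $ i $ j * z $ j)" for B :: "real^'k^'n" and z
    by (simp add: matrix_vector_mult_def)
  have split: "(\<Sum>j\<in>UNIV. g j) = g i + (\<Sum>j\<in>UNIV - {i}. g j)" for g :: "'n \<Rightarrow> real"
    by (simp add: sum.remove[of UNIV i])
  have H: "\<bar>(H *v d) $ i\<bar> \<le> \<bar>H $ i $ i\<bar> * \<bar>d $ i\<bar> + (\<Sum>j\<in>UNIV - {i}. \<bar>H $ i $ j\<bar> * \<bar>d $ j\<bar>)"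
    unfolding mv split[of "\<lambda>j. H $ i $ j * d $ j"] abs_mult[symmetric]
    by (rule order_trans[OF abs_triangle_ineq]) (intro add_left_mono sum_abs)
  have "p x y - p x' y' = (d $ i - (r * (A *v d) $ i + (H *v d) $ i)) - r * (As *v e) $ i"
    by (simp add: p_def d_def e_def matrix_vector_mult_diff_distrib algebra_simps)
  also have "r * (A *v d) $ i + (H *v d) $ i = (\<Sum>j\<in>UNIV. (r * A $ i $ j + H $ i $ j) * d $ j)"
    unfolding mv by (simp add: sum_distrib_left sum.distrib algebra_simps)
  also have "d $ i - \<dots> = (1 - r * A $ i $ i - H $ i $ i) * d $ i - (\<Sum>j\<in>UNIV - {i}. (r * A $ i $ j + H $ i $ j) * d $ j)"
    by (subst split) (simp add: algebra_simps)
  also have "r * (As *v e) $ i = (\<Sum>j\<in>UNIV. r * As $ i $ j * e $ j)"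
    unfolding mv by (simp add: sum_distrib_left mult.assoc)
  finally have "p x y - p x' y' = (1 - r * A $ i $ i - H $ i $ i) * d $ i
    - (\<Sum>j\<in>UNIV - {i}. (r * A $ i $ j + H $ i $ j) * d $ j) - (\<Sum>j\<in>UNIV. r * As $ i $ j * e $ j)" .
  then have "\<bar>p x y - p x' y'\<bar> \<le> \<bar>(1 - r * A $ i $ i - H $ i $ i) * d $ i\<bar>
    + \<bar>\<Sum>j\<in>UNIV - {i}. (r * A $ i $ j + H $ i $ j) * d $ j\<bar> + \<bar>\<Sum>j\<in>UNIV. r * As $ i $ j * e $ j\<bar>"
    by linarith
  also have "\<bar>(1 - r * A $ i $ i - H $ i $ i) * d $ i\<bar> = (1 - r * A $ i $ i - H $ i $ i) * \<bar>d $ i\<bar>"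
    using diag by (simp add: abs_mult)
  also have "\<bar>\<Sum>j\<in>UNIV - {i}. (r * A $ i $ j + H $ i $ j) * d $ j\<bar> \<le> (\<Sum>j\<in>UNIV - {i}. \<bar>r * A $ i $ j + H $ i $ j\<bar> * \<bar>d $ j\<bar>)"
    unfolding abs_mult[symmetric] by (rule sum_abs)
  also have "\<bar>\<Sum>j\<in>UNIV. r * As $ i $ j * e $ j\<bar> \<le> (\<Sum>j\<in>UNIV. r * \<bar>As $ i $ j\<bar> * \<bar>e $ j\<bar>)"
    by (rule order_trans[OF sum_abs]) (use \<open>r > 0\<close> in \<open>simp add: abs_mult\<close>)
  finally have P: "\<bar>p x y - p x' y'\<bar> \<le> (1 - r * A $ i $ i - H $ i $ i) * \<bar>d $ i\<bar>
    + (\<Sum>j\<in>UNIV - {i}. \<bar>r * A $ i $ j + H $ i $ j\<bar> * \<bar>d $ j\<bar>) + (\<Sum>j\<in>UNIV. r * \<bar>As $ i $ j\<bar> * \<bar>e $ j\<bar>)"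
    by simp
  have "\<bar>closest_point (moving_box H c1 c2 x) (x - r *\<^sub>R (A *v x + As *v y) - r *\<^sub>R a) $ i
      - closest_point (moving_box H c1 c2 x') (x' - r *\<^sub>R (A *v x' + As *v y') - r *\<^sub>R a) $ i\<bar>
    = \<bar>(H *v d) $ i + (max (c1 $ i) (min (c2 $ i) (p x y)) - max (c1 $ i) (min (c2 $ i) (p x' y')))\<bar>"
    unfolding closest_point_moving_box[OF \<open>c1 \<le> c2\<close>]
    by (simp add: p_def d_def matrix_vector_mult_diff_distrib algebra_simps)
  also have "\<dots> \<le> \<bar>(H *v d) $ i\<bar> + \<bar>p x y - p x' y'\<bar>"
    by (rule order_trans[OF abs_triangle_ineq]) (intro add_left_mono abs_clamp_diff_le)
  finally show ?thesis
    using H P unfolding d_def[symmetric] e_def[symmetric] by (simp add: sum.distrib distrib_right)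
qed

text \<open>Replaces the matrices by the extreme values over their intervals and regroups row
  estimates by columns, the form in which (A4) is given. It serves both equations, with the roles of
  x and y exchanged for the second.\<close>

lemma projection_weighted_bound:
  fixes H A Al Au :: "real^'n^'n" and As Asl Asu :: "real^'m^'n" and \<mu> :: "'n \<Rightarrow> real"
  assumes "c1 \<le> c2" "r > 0" and A: "Al \<le> A" "A \<le> Au" and As: "Asl \<le> As" "As \<le> Asu"
    and diag: "\<And>i. 1 - r * Au $ i $ i \<ge> H $ i $ i" and \<mu>: "\<And>i. \<mu> i > 0"
  shows "(\<Sum>i\<in>UNIV. \<mu> i * \<bar>closest_point (moving_box H c1 c2 x) (x - r *\<^sub>R (A *v x + As *v y) - r *\<^sub>R a) $ i
      - closest_point (moving_box H c1 c2 x') (x' - r *\<^sub>R (A *v x' + As *v y') - r *\<^sub>R a) $ i\<bar>)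
    \<le> (\<Sum>j\<in>UNIV. (\<mu> j * (1 - r * Al $ j $ j - H $ j $ j + \<bar>H $ j $ j\<bar>)
        + (\<Sum>i\<in>UNIV - {j}. \<mu> i * (max \<bar>r * Al $ i $ j + H $ i $ j\<bar> \<bar>r * Au $ i $ j + H $ i $ j\<bar> + \<bar>H $ i $ j\<bar>)))
          * \<bar>(x - x') $ j\<bar>)
      + (\<Sum>j\<in>UNIV. (\<Sum>i\<in>UNIV. \<mu> i * r * max \<bar>Asl $ i $ j\<bar> \<bar>Asu $ i $ j\<bar>) * \<bar>(y - y') $ j\<bar>)"
proof -
  have A': "Al $ i $ j \<le> A $ i $ j" "A $ i $ j \<le> Au $ i $ j" for i j
    using A by (auto simp: less_eq_vec_def)
  have As': "Asl $ i $ j \<le> As $ i $ j" "As $ i $ j \<le> Asu $ i $ j" for i j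
    using As by (auto simp: less_eq_vec_def)
  define d where "d j = \<bar>(x - x') $ j\<bar>" for j
  define e where "e j = \<bar>(y - y') $ j\<bar>" for j
  define D where "D j = 1 - r * Al $ j $ j - H $ j $ j + \<bar>H $ j $ j\<bar>" for j
  define P where "P i j = max \<bar>r * Al $ i $ j + H $ i $ j\<bar> \<bar>r * Au $ i $ j + H $ i $ j\<bar> + \<bar>H $ i $ j\<bar>" for i j
  define Q where "Q i j = max \<bar>Asl $ i $ j\<bar> \<bar>Asu $ i $ j\<bar>" for i j
  have comp: "\<bar>closest_point (moving_box H c1 c2 x) (x - r *\<^sub>R (A *v x + As *v y) - r *\<^sub>R a) $ i
      - closest_point (moving_box H c1 c2 x') (x' - r *\<^sub>R (A *v x' + As *v y') - r *\<^sub>R a) $ i\<bar>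
    \<le> D i * d i + (\<Sum>j\<in>UNIV - {i}. P i j * d j) + (\<Sum>j\<in>UNIV. r * Q i j * e j)" for i
  proof -
    have rA: "r * Al $ k $ j \<le> r * A $ k $ j" "r * A $ k $ j \<le> r * Au $ k $ j" for k j
      using A'[of k j] \<open>r > 0\<close> by (auto intro: mult_left_mono)
    \<comment> \<open>The upper end of the interval fixes the sign of the diagonal coefficient; the
      lower end, in \<open>D\<close>, bounds its size.\<close>
    have "0 \<le> 1 - r * A $ i $ i - H $ i $ i" using diag[of i] rA(2)[of i i] by linarith
    note projection_component_bound[OF \<open>c1 \<le> c2\<close> \<open>r > 0\<close> this, of x As y a x' y']
    also have "(1 - r * A $ i $ i - H $ i $ i + \<bar>H $ i $ i\<bar>) * \<bar>(x - x') $ i\<bar>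
      + (\<Sum>j\<in>UNIV - {i}. (\<bar>r * A $ i $ j + H $ i $ j\<bar> + \<bar>H $ i $ j\<bar>) * \<bar>(x - x') $ j\<bar>)
      + (\<Sum>j\<in>UNIV. r * \<bar>As $ i $ j\<bar> * \<bar>(y - y') $ j\<bar>)
      \<le> D i * d i + (\<Sum>j\<in>UNIV - {i}. P i j * d j) + (\<Sum>j\<in>UNIV. r * Q i j * e j)"
    proof (intro add_mono sum_mono)
      show "(1 - r * A $ i $ i - H $ i $ i + \<bar>H $ i $ i\<bar>) * \<bar>(x - x') $ i\<bar> \<le> D i * d i"
        unfolding D_def d_def using rA(1)[of i i] by (intro mult_right_mono) auto
      show "(\<bar>r * A $ i $ j + H $ i $ j\<bar> + \<bar>H $ i $ j\<bar>) * \<bar>(x - x') $ j\<bar> \<le> P i j * d j" for j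
        unfolding P_def d_def using rA[of i j]
        by (intro mult_right_mono add_right_mono abs_le_max_endpoints) auto
      show "r * \<bar>As $ i $ j\<bar> * \<bar>(y - y') $ j\<bar> \<le> r * Q i j * e j" for j
        unfolding Q_def e_def using As'[of i j] \<open>r > 0\<close>
        by (intro mult_right_mono mult_left_mono abs_le_max_endpoints) auto
    qed
    finally show ?thesis .
  qed
  have "(\<Sum>i\<in>UNIV. \<mu> i * \<bar>closest_point (moving_box H c1 c2 x) (x - r *\<^sub>R (A *v x + As *v y) - r *\<^sub>R a) $ i
      - closest_point (moving_box H c1 c2 x') (x' - r *\<^sub>R (A *v x' + As *v y') - r *\<^sub>R a) $ i\<bar>)
    \<le> (\<Sum>i\<in>UNIV. \<mu> i * (D i * d i + (\<Sum>j\<in>UNIV - {i}. P i j * d j) + (\<Sum>j\<in>UNIV. r * Q i j * e j)))"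
    by (intro sum_mono mult_left_mono comp less_imp_le \<mu>)
  also have "\<dots> = (\<Sum>i\<in>UNIV. \<mu> i * D i * d i) + (\<Sum>i\<in>UNIV. \<Sum>j\<in>UNIV - {i}. \<mu> i * P i j * d j)
      + (\<Sum>i\<in>UNIV. \<Sum>j\<in>UNIV. \<mu> i * r * Q i j * e j)"
    by (simp add: distrib_left sum.distrib sum_distrib_left mult.assoc)
  \<comment> \<open>The condition that i and j differ is symmetric, so the off-diagonal sums may be
    exchanged.\<close>
  also have "(\<Sum>i\<in>UNIV. \<Sum>j\<in>UNIV - {i}. \<mu> i * P i j * d j) = (\<Sum>j\<in>UNIV. \<Sum>i\<in>UNIV - {j}. \<mu> i * P i j * d j)"
  proof -
    have "(\<Sum>i\<in>UNIV. \<Sum>j\<in>UNIV - {i}. \<mu> i * P i j * d j) = (\<Sum>i\<in>UNIV. \<Sum>j | j \<in> UNIV \<and> i \<noteq> j. \<mu> i * P i j * d j)"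
      by (intro sum.cong) auto
    also have "\<dots> = (\<Sum>j\<in>UNIV. \<Sum>i | i \<in> UNIV \<and> i \<noteq> j. \<mu> i * P i j * d j)"
      by (rule sum.swap_restrict) auto
    also have "\<dots> = (\<Sum>j\<in>UNIV. \<Sum>i\<in>UNIV - {j}. \<mu> i * P i j * d j)"
      by (intro sum.cong) auto
    finally show ?thesis .
  qed
  also have "(\<Sum>i\<in>UNIV. \<Sum>j\<in>UNIV. \<mu> i * r * Q i j * e j) = (\<Sum>j\<in>UNIV. \<Sum>i\<in>UNIV. \<mu> i * r * Q i j * e j)"
    by (rule sum.swap)
  finally show ?thesis
    by (simp add: D_def[symmetric] P_def[symmetric] Q_def[symmetric] d_def[symmetric] e_def[symmetric]
        distrib_right sum.distrib sum_distrib_right del: vector_minus_component)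
qed

section \<open>The contraction constant of the interval system\<close>

theorem theorem3p2:
  fixes \<alpha> \<rho> lam :: real
    and a c1 c2 :: "real^'n::finite"
    and b d1 d2 :: "real^'m::finite"
    and Al Au h :: "real^'n^'n"
    and Asl Asu :: "real^'m^'n"
    and Bl Bu l :: "real^'m^'m"
    and Bsl Bsu :: "real^'n^'m"
  assumes alpha: "0 < \<alpha>" "\<alpha> < 1"
    and rho: "\<rho> > 0"
    and lam: "lam > 0"
    and intervals: "Al \<le> Au" "Asl \<le> Asu" "Bl \<le> Bu" "Bsl \<le> Bsu"
    and A1: "c1 \<le> c2" "d1 \<le> d2"
    and A2: "\<forall>i. 1 - \<rho> * Au $ i $ i \<ge> h $ i $ i"
    and A3: "\<forall>j. 1 - lam * Bu $ j $ j \<ge> l $ j $ j"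
    and A4: "\<exists>(\<mu> :: 'n \<Rightarrow> real) (\<tau> :: 'm \<Rightarrow> real).
        (\<forall>i. \<mu> i > 0) \<and> (\<forall>j. \<tau> j > 0) \<and>
        (\<forall>i. let s =
            1 - \<rho> * Al $ i $ i - h $ i $ i + \<bar>h $ i $ i\<bar>
            + (\<Sum>j\<in>UNIV - {i}. \<mu> j / \<mu> i *
                 (max \<bar>\<rho> * Al $ j $ i + h $ j $ i\<bar> \<bar>\<rho> * Au $ j $ i + h $ j $ i\<bar> + \<bar>h $ j $ i\<bar>))
            + (\<Sum>j\<in>UNIV. \<tau> j / \<mu> i * lam * max \<bar>Bsl $ j $ i\<bar> \<bar>Bsu $ j $ i\<bar>)
          in 0 < s \<and> s < 1) \<and>
        (\<forall>j. let s =
            1 - lam * Bl $ j $ j - l $ j $ j + \<bar>l $ j $ j\<bar>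
            + (\<Sum>i\<in>UNIV - {j}. \<tau> i / \<tau> j *
                 (max \<bar>lam * Bl $ i $ j + l $ i $ j\<bar> \<bar>lam * Bu $ i $ j + l $ i $ j\<bar> + \<bar>l $ i $ j\<bar>))
            + (\<Sum>i\<in>UNIV. \<mu> i / \<tau> j * \<rho> * max \<bar>Asl $ i $ j\<bar> \<bar>Asu $ i $ j\<bar>)
          in 0 < s \<and> s < 1)"
  shows "\<forall>A\<in>{Al..Au}. \<forall>As\<in>{Asl..Asu}. \<forall>B\<in>{Bl..Bu}. \<forall>Bs\<in>{Bsl..Bsu}.
    globally_mittag_leffler_stable \<alpha>
      (\<lambda>x y. projection_rhs \<rho> A As a (moving_box h c1 c2) x y)
      (\<lambda>x y. projection_rhs lam B Bs b (moving_box l d1 d2) y x)"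
proof (intro ballI)
  fix A As B Bs
  assume mem: "A \<in> {Al..Au}" "As \<in> {Asl..Asu}" "B \<in> {Bl..Bu}" "Bs \<in> {Bsl..Bsu}"
  obtain \<mu> :: "'n \<Rightarrow> real" and \<tau> :: "'m \<Rightarrow> real" where pos: "\<And>i. \<mu> i > 0" "\<And>j. \<tau> j > 0"
    and A4x: "\<And>i. let s =
            1 - \<rho> * Al $ i $ i - h $ i $ i + \<bar>h $ i $ i\<bar>
            + (\<Sum>j\<in>UNIV - {i}. \<mu> j / \<mu> i *
                 (max \<bar>\<rho> * Al $ j $ i + h $ j $ i\<bar> \<bar>\<rho> * Au $ j $ i + h $ j $ i\<bar> + \<bar>h $ j $ i\<bar>))
            + (\<Sum>j\<in>UNIV. \<tau> j / \<mu> i * lam * max \<bar>Bsl $ j $ i\<bar> \<bar>Bsu $ j $ i\<bar>)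
          in 0 < s \<and> s < 1"
    and A4y: "\<And>j. let s =
            1 - lam * Bl $ j $ j - l $ j $ j + \<bar>l $ j $ j\<bar>
            + (\<Sum>i\<in>UNIV - {j}. \<tau> i / \<tau> j *
                 (max \<bar>lam * Bl $ i $ j + l $ i $ j\<bar> \<bar>lam * Bu $ i $ j + l $ i $ j\<bar> + \<bar>l $ i $ j\<bar>))
            + (\<Sum>i\<in>UNIV. \<mu> i / \<tau> j * \<rho> * max \<bar>Asl $ i $ j\<bar> \<bar>Asu $ i $ j\<bar>)
          in 0 < s \<and> s < 1"
    using A4 by blast
  define Px where "Px j = \<mu> j * (1 - \<rho> * Al $ j $ j - h $ j $ j + \<bar>h $ j $ j\<bar>)
        + (\<Sum>i\<in>UNIV - {j}. \<mu> i * (max \<bar>\<rho> * Al $ i $ j + h $ i $ j\<bar> \<bar>\<rho> * Au $ i $ j + h $ i $ j\<bar> + \<bar>h $ i $ j\<bar>))" for j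
  define Qx where "Qx j = (\<Sum>i\<in>UNIV. \<mu> i * \<rho> * max \<bar>Asl $ i $ j\<bar> \<bar>Asu $ i $ j\<bar>)" for j
  define Py where "Py j = \<tau> j * (1 - lam * Bl $ j $ j - l $ j $ j + \<bar>l $ j $ j\<bar>)
        + (\<Sum>i\<in>UNIV - {j}. \<tau> i * (max \<bar>lam * Bl $ i $ j + l $ i $ j\<bar> \<bar>lam * Bu $ i $ j + l $ i $ j\<bar> + \<bar>l $ i $ j\<bar>))" for j
  define Qy where "Qy j = (\<Sum>i\<in>UNIV. \<tau> i * lam * max \<bar>Bsl $ i $ j\<bar> \<bar>Bsu $ i $ j\<bar>)" for j
  \<comment> \<open>After division by the weight these are the expressions in (A4):
    \<open>Px\<close> collects the influence of a component of x on the x-equation,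
    \<open>Qy\<close> its influence on the y-equation.\<close>
  define sx where "sx i = (Px i + Qy i) / \<mu> i" for i
  define sy where "sy j = (Py j + Qx j) / \<tau> j" for j
  have sx: "0 < sx i" "sx i < 1" for i
    using A4x[of i] pos(1)[of i]
    by (simp_all add: Let_def sx_def Px_def Qy_def add_divide_distrib sum_divide_distrib)
  have sy: "0 < sy j" "sy j < 1" for j
    using A4y[of j] pos(2)[of j]
    by (simp_all add: Let_def sy_def Py_def Qx_def add_divide_distrib sum_divide_distrib)
  \<comment> \<open>A maximum of finitely many numbers in (0, 1), hence itself below 1.\<close>
  define \<theta> where "\<theta> = Max (range sx \<union> range sy)"
  have fin: "finite (range sx \<union> range sy)" by simp
  have \<theta>: "sx i \<le> \<theta>" "sy j \<le> \<theta>" for i j unfolding \<theta>_def using fin by (auto intro!: Max_ge)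
  have \<theta>01: "0 \<le> \<theta>" "\<theta> < 1"
  proof -
    show "0 \<le> \<theta>" using \<theta>(1) sx(1) less_imp_le order_trans by blast
    show "\<theta> < 1" unfolding \<theta>_def using fin sx(2) sy(2) by (subst Max_less_iff) auto
  qed
  \<comment> \<open>Coordinate vectors of the product space scaled by the weights, indexed by the
    sum type so that both groups of components form one family.\<close>
  define w :: "'n + 'm \<Rightarrow> (real^'n) \<times> (real^'m)" where
    "w k = (case k of Inl i \<Rightarrow> (axis i (\<mu> i), 0) | Inr j \<Rightarrow> (0, axis j (\<tau> j)))" for k
  have l1: "l1_norm w e = (\<Sum>i\<in>UNIV. \<mu> i * \<bar>fst e $ i\<bar>) + (\<Sum>j\<in>UNIV. \<tau> j * \<bar>snd e $ j\<bar>)" for e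
  proof -
    have "l1_norm w e = (\<Sum>k\<in>UNIV <+> UNIV. \<bar>e \<bullet> w k\<bar>)" by (simp add: l1_norm_def)
    also have "\<dots> = (\<Sum>i\<in>UNIV. \<bar>e \<bullet> w (Inl i)\<bar>) + (\<Sum>j\<in>UNIV. \<bar>e \<bullet> w (Inr j)\<bar>)"
      by (subst sum.Plus) auto
    also have "\<dots> = (\<Sum>i\<in>UNIV. \<mu> i * \<bar>fst e $ i\<bar>) + (\<Sum>j\<in>UNIV. \<tau> j * \<bar>snd e $ j\<bar>)"
      using less_imp_le[OF pos(1)] less_imp_le[OF pos(2)]
      by (simp add: w_def inner_prod_def inner_axis abs_mult mult.commute)
    finally show ?thesis .
  qed
  \<comment> \<open>The sum of the reciprocal weights dominates each of them, which gives one
    constant for the norm comparison.\<close>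
  define c where "c = (\<Sum>i\<in>UNIV. 1 / \<mu> i) + (\<Sum>j\<in>UNIV. 1 / \<tau> j)"
  have cx: "t \<le> c * (\<mu> i * t)" if "0 \<le> t" for t i
  proof -
    have "1 / \<mu> i \<le> (\<Sum>i\<in>UNIV. 1 / \<mu> i)" using pos by (intro member_le_sum) (auto simp: less_imp_le)
    moreover have "0 \<le> (\<Sum>j\<in>UNIV. 1 / \<tau> j)" using pos by (intro sum_nonneg) (auto simp: less_imp_le)
    ultimately have "1 / \<mu> i * (\<mu> i * t) \<le> c * (\<mu> i * t)"
      unfolding c_def using that pos(1)[of i] by (intro mult_right_mono) auto
    then show ?thesis using pos(1)[of i] by simp
  qed
  have cy: "t \<le> c * (\<tau> j * t)" if "0 \<le> t" for t j
  proof -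
    have "1 / \<tau> j \<le> (\<Sum>j\<in>UNIV. 1 / \<tau> j)" using pos by (intro member_le_sum) (auto simp: less_imp_le)
    moreover have "0 \<le> (\<Sum>i\<in>UNIV. 1 / \<mu> i)" using pos by (intro sum_nonneg) (auto simp: less_imp_le)
    ultimately have "1 / \<tau> j * (\<tau> j * t) \<le> c * (\<tau> j * t)"
      unfolding c_def using that pos(2)[of j] by (intro mult_right_mono) auto
    then show ?thesis using pos(2)[of j] by simp
  qed
  have c: "norm e \<le> c * l1_norm w e" for e
  proof -
    have "norm e \<le> norm (fst e) + norm (snd e)" using norm_Pair_le[of "fst e" "snd e"] by simp
    also have "\<dots> \<le> (\<Sum>i\<in>UNIV. \<bar>fst e $ i\<bar>) + (\<Sum>j\<in>UNIV. \<bar>snd e $ j\<bar>)"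
      by (intro add_mono norm_le_l1_cart)
    also have "\<dots> \<le> (\<Sum>i\<in>UNIV. c * (\<mu> i * \<bar>fst e $ i\<bar>)) + (\<Sum>j\<in>UNIV. c * (\<tau> j * \<bar>snd e $ j\<bar>))"
      by (intro add_mono sum_mono cx cy) auto
    finally show ?thesis by (simp add: l1 distrib_left sum_distrib_left)
  qed
  define X where "X x y = closest_point (moving_box h c1 c2 x) (x - \<rho> *\<^sub>R (A *v x + As *v y) - \<rho> *\<^sub>R a)" for x y
  define Y where "Y x y = closest_point (moving_box l d1 d2 y) (y - lam *\<^sub>R (B *v y + Bs *v x) - lam *\<^sub>R b)" for x y
  define \<Phi> where "\<Phi> z = (X (fst z) (snd z), Y (fst z) (snd z))" for z
  show "globally_mittag_leffler_stable \<alpha>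
      (\<lambda>x y. projection_rhs \<rho> A As a (moving_box h c1 c2) x y)
      (\<lambda>x y. projection_rhs lam B Bs b (moving_box l d1 d2) y x)"
  proof (rule contraction_globally_mittag_leffler_stable[OF alpha c \<theta>01, where \<Phi> = \<Phi>])
    fix z z' :: "(real^'n) \<times> (real^'m)"
    define x y x' y' where "x = fst z" "y = snd z" "x' = fst z'" "y' = snd z'"
    note xy = this
    have "l1_norm w (\<Phi> z - \<Phi> z') = (\<Sum>i\<in>UNIV. \<mu> i * \<bar>X x y $ i - X x' y' $ i\<bar>) + (\<Sum>j\<in>UNIV. \<tau> j * \<bar>Y x y $ j - Y x' y' $ j\<bar>)"
      by (simp add: l1 \<Phi>_def xy)
    also have "(\<Sum>i\<in>UNIV. \<mu> i * \<bar>X x y $ i - X x' y' $ i\<bar>)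
        \<le> (\<Sum>j\<in>UNIV. Px j * \<bar>(x - x') $ j\<bar>) + (\<Sum>j\<in>UNIV. Qx j * \<bar>(y - y') $ j\<bar>)"
      unfolding X_def Px_def Qx_def
      by (rule projection_weighted_bound) (use A1 rho mem A2 pos in auto)
    also have "(\<Sum>j\<in>UNIV. \<tau> j * \<bar>Y x y $ j - Y x' y' $ j\<bar>)
        \<le> (\<Sum>j\<in>UNIV. Py j * \<bar>(y - y') $ j\<bar>) + (\<Sum>j\<in>UNIV. Qy j * \<bar>(x - x') $ j\<bar>)"
      unfolding Y_def Py_def Qy_def
      by (rule projection_weighted_bound) (use A1 lam mem A3 pos in auto)
    \<comment> \<open>Regrouping by component brings the two contributions of each variable
      together, as (A4) requires.\<close>
    also have "(\<Sum>j\<in>UNIV. Px j * \<bar>(x - x') $ j\<bar>) + (\<Sum>j\<in>UNIV. Qx j * \<bar>(y - y') $ j\<bar>)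
        + ((\<Sum>j\<in>UNIV. Py j * \<bar>(y - y') $ j\<bar>) + (\<Sum>j\<in>UNIV. Qy j * \<bar>(x - x') $ j\<bar>))
      = (\<Sum>i\<in>UNIV. (Px i + Qy i) * \<bar>(x - x') $ i\<bar>) + (\<Sum>j\<in>UNIV. (Py j + Qx j) * \<bar>(y - y') $ j\<bar>)"
      by (simp add: distrib_right sum.distrib)
    also have "\<dots> \<le> (\<Sum>i\<in>UNIV. \<theta> * (\<mu> i * \<bar>(x - x') $ i\<bar>)) + (\<Sum>j\<in>UNIV. \<theta> * (\<tau> j * \<bar>(y - y') $ j\<bar>))"
    proof (intro add_mono sum_mono)
      fix i
      have "Px i + Qy i \<le> \<theta> * \<mu> i" using \<theta>(1)[of i] pos(1)[of i] by (simp add: sx_def pos_divide_le_eq)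
      then show "(Px i + Qy i) * \<bar>(x - x') $ i\<bar> \<le> \<theta> * (\<mu> i * \<bar>(x - x') $ i\<bar>)"
        unfolding mult.assoc[symmetric] by (rule mult_right_mono) simp
    next
      fix j
      have "Py j + Qx j \<le> \<theta> * \<tau> j" using \<theta>(2)[of j] pos(2)[of j] by (simp add: sy_def pos_divide_le_eq)
      then show "(Py j + Qx j) * \<bar>(y - y') $ j\<bar> \<le> \<theta> * (\<tau> j * \<bar>(y - y') $ j\<bar>)"
        unfolding mult.assoc[symmetric] by (rule mult_right_mono) simp
    qed
    also have "\<dots> = \<theta> * l1_norm w (z - z')" by (simp add: l1 xy distrib_left sum_distrib_left)
    finally show "l1_norm w (\<Phi> z - \<Phi> z') \<le> \<theta> * l1_norm w (z - z')" by simp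
  qed (simp_all add: \<Phi>_def X_def Y_def projection_rhs_def)
qed

end
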